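(* Let $P:\mathbb R^d\to\mathbb R_+$ be a measurable function taking positive values and $P(D)$ the associated positive self-adjoint Fourier multiplier on $L^2(\mathbb R^d)$. Assume that $e^{-tP(D)}$ is lattice positive for all $t\ge0$ (more generally, that $|e^{-tP(D)}f|\le S_t|f|$ for all $f\in L^2(\mathbb R^d)$, $t\ge0$, for some positive contraction semigroup $(S_t)_{t\ge0}$ on $L^2(\mathbb R^d)$). Let $f\in D(P(D)^\delta)$ with $\delta>2$ (e.g. if $|P(\xi)|\cong|\xi|^a$, then $f\in H^s(\mathbb R^d)$ with $s>2a$ suffices). Then $$e^{itP(D)}f(x)\to f(x)\quad\text{as }t\to0+,\ \text{for a.e. }x\in\mathbb R^d.$$
   Context: $P(D)$ is the operator $f\mapsto\mathcal F^{-1}[P\hat f]$ with its maximal domain in $L^2(\mathbb R^d)$; functions of it are defined by the self-adjoint functional calculus. Lattice positive means mapping nonnegative functions to nonnegative functions. $H^s(\mathbb R^d)=\{f\in L^2(\mathbb R^d):(1+|\xi|^2)^{s/2}\hat f\in L^2(\mathbb R^d)\}$. $|P(\xi)|\cong|\xi|^a$ means two-sided estimates up to positive constants. The pointwise convergence is understood for representatives of $e^{itP(D)}f\in L^2(\mathbb R^d)$ chosen so that for a.e. $x$ the function $t\mapsto e^{itP(D)}f(x)$ is continuous. *)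

theory Defs
  imports "HOL-Analysis.Analysis"
begin

(* Elements of L^2(R^d) are represented by functions, equality in L^2 is equality almost
   everywhere.  A (possibly unbounded) operator A is represented by its graph: A f h means that
   f lies in the domain of A and that h is a representative of A f. *)

type_synonym 'n cfun = "real^'n \<Rightarrow> complex"
type_synonym 'n operator = "'n cfun \<Rightarrow> 'n cfun \<Rightarrow> bool"

definition ae_eq :: "'n::finite cfun \<Rightarrow> 'n cfun \<Rightarrow> bool"  (infix \<open>=\<^sub>a\<^sub>e\<close> 50) where
  "f =\<^sub>a\<^sub>e g \<longleftrightarrow> (AE x in lebesgue. f x = g x)"

definition L2 :: "'n::finite cfun set" where
  "L2 = {f \<in> borel_measurable lebesgue. integrable lebesgue (\<lambda>x. (cmod (f x))\<^sup>2)}"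

definition L2_inner :: "'n::finite cfun \<Rightarrow> 'n cfun \<Rightarrow> complex" where
  "L2_inner f g = (LINT x|lebesgue. f x * cnj (g x))"

definition L2_norm :: "'n::finite cfun \<Rightarrow> real" where
  "L2_norm f = sqrt (LINT x|lebesgue. (cmod (f x))\<^sup>2)"

definition L2_tendsto :: "(nat \<Rightarrow> 'n::finite cfun) \<Rightarrow> 'n cfun \<Rightarrow> bool" where
  "L2_tendsto \<phi> f \<longleftrightarrow>
     (\<forall>n. \<phi> n \<in> L2) \<and> f \<in> L2 \<and> (\<lambda>n. L2_norm (\<lambda>x. \<phi> n x - f x)) \<longlonglongrightarrow> 0"

definition op_dom :: "'n::finite operator \<Rightarrow> 'n cfun set" where
  "op_dom A = {f. \<exists>h. A f h}"


(* Fourier transform on L^1 with kernel exp(-i x.xi); has_fourier is its continuous extension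
   from the intersection of L^1 and L^2 to L^2.  The normalising constant does not affect P(D). *)

definition fourier_integral :: "'n::finite cfun \<Rightarrow> 'n cfun" where
  "fourier_integral f = (\<lambda>\<xi>. LINT x|lebesgue. cis (- (x \<bullet> \<xi>)) * f x)"

definition has_fourier :: "'n::finite cfun \<Rightarrow> 'n cfun \<Rightarrow> bool" where
  "has_fourier f F \<longleftrightarrow>
     (\<exists>\<phi>. (\<forall>n. integrable lebesgue (\<phi> n)) \<and> L2_tendsto \<phi> f \<and>
          L2_tendsto (\<lambda>n. fourier_integral (\<phi> n)) F)"

(* P(D) f = h iff the Fourier transform of h is P times that of f; since the Fourier transform
   maps L^2 onto L^2, the domain consists of all f in L^2 for which this product is in L^2. *)

definition fourier_multiplier :: "(real^'n::finite \<Rightarrow> real) \<Rightarrow> 'n operator" where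
  "fourier_multiplier P f h \<longleftrightarrow>
     (\<exists>F. has_fourier f F \<and> has_fourier h (\<lambda>\<xi>. complex_of_real (P \<xi>) * F \<xi>))"

definition sobolev :: "real \<Rightarrow> 'n::finite cfun set" where
  "sobolev s = {f \<in> L2. \<exists>F. has_fourier f F \<and>
     (\<lambda>\<xi>. complex_of_real ((1 + (norm \<xi>)\<^sup>2) powr (s / 2)) * F \<xi>) \<in> L2}"


(* Functional calculus of a self-adjoint operator via its spectral measure.  The projections
   E B are bounded operators, given as maps on representatives; being symmetric and everywhere
   defined, they are automatically linear and compatible with a.e. equality. *)

definition projection_valued_measure :: "(real set \<Rightarrow> 'n::finite cfun \<Rightarrow> 'n cfun) \<Rightarrow> bool" where
  "projection_valued_measure E \<longleftrightarrow>
     (\<forall>B\<in>sets borel. \<forall>f\<in>L2. E B f \<in> L2) \<and>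
     (\<forall>B\<in>sets borel. \<forall>f\<in>L2. \<forall>g\<in>L2. L2_inner (E B f) g = L2_inner f (E B g)) \<and>
     (\<forall>B\<in>sets borel. \<forall>C\<in>sets borel. \<forall>f\<in>L2. E (B \<inter> C) f =\<^sub>a\<^sub>e E B (E C f)) \<and>
     (\<forall>f\<in>L2. E UNIV f =\<^sub>a\<^sub>e f) \<and>
     (\<forall>B :: nat \<Rightarrow> real set. range B \<subseteq> sets borel \<longrightarrow> disjoint_family B \<longrightarrow>
        (\<forall>f\<in>L2. (\<lambda>n. L2_inner (E (B n) f) f) sums L2_inner (E (\<Union>n. B n) f) f))"

definition scalar_measure :: "(real set \<Rightarrow> 'n::finite cfun \<Rightarrow> 'n cfun) \<Rightarrow> 'n cfun \<Rightarrow> real measure" where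
  "scalar_measure E f = measure_of UNIV (sets borel) (\<lambda>B. ennreal (Re (L2_inner (E B f) f)))"

(* The integral of g against the complex measure B |-> <E B f, k>, by polarization. *)

definition spectral_integral ::
    "(real set \<Rightarrow> 'n::finite cfun \<Rightarrow> 'n cfun) \<Rightarrow> (real \<Rightarrow> complex) \<Rightarrow> 'n cfun \<Rightarrow> 'n cfun \<Rightarrow> complex" where
  "spectral_integral E g f k =
     (\<Sum>j<4. \<i> ^ j * (LINT r|scalar_measure E (\<lambda>x. f x + \<i> ^ j * k x). g r)) / 4"

definition spectral_domain ::
    "(real set \<Rightarrow> 'n::finite cfun \<Rightarrow> 'n cfun) \<Rightarrow> (real \<Rightarrow> complex) \<Rightarrow> 'n cfun set" where
  "spectral_domain E g = {f \<in> L2. integrable (scalar_measure E f) (\<lambda>r. (cmod (g r))\<^sup>2)}"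

(* The operator given by the integral of g dE: testing against the dense subspace
   spectral_domain E g determines h almost everywhere. *)

definition spectral_operator ::
    "(real set \<Rightarrow> 'n::finite cfun \<Rightarrow> 'n cfun) \<Rightarrow> (real \<Rightarrow> complex) \<Rightarrow> 'n operator" where
  "spectral_operator E g f h \<longleftrightarrow>
     g \<in> borel_measurable borel \<and> f \<in> spectral_domain E g \<and> h \<in> L2 \<and>
     (\<forall>k\<in>spectral_domain E g. L2_inner h k = spectral_integral E g f k)"

definition is_spectral_measure :: "'n::finite operator \<Rightarrow> (real set \<Rightarrow> 'n cfun \<Rightarrow> 'n cfun) \<Rightarrow> bool" where
  "is_spectral_measure A E \<longleftrightarrow>
     projection_valued_measure E \<and> A = spectral_operator E complex_of_real"

(* By the spectral theorem a self-adjoint A has exactly one spectral measure (up to a.e.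
   equality), so that the existential quantifier merely names it. *)

definition fun_calc :: "'n::finite operator \<Rightarrow> (real \<Rightarrow> complex) \<Rightarrow> 'n operator" where
  "fun_calc A g f h \<longleftrightarrow> (\<exists>E. is_spectral_measure A E \<and> spectral_operator E g f h)"

(* The values of these functions at negative arguments are irrelevant for A \<ge> 0. *)

definition op_powr :: "'n::finite operator \<Rightarrow> real \<Rightarrow> 'n operator" where
  "op_powr A \<delta> = fun_calc A (\<lambda>r. complex_of_real (r powr \<delta>))"

definition heat_op :: "'n::finite operator \<Rightarrow> real \<Rightarrow> 'n operator" where
  "heat_op A t = fun_calc A (\<lambda>r. complex_of_real (exp (- t * r)))"

definition unitary_op :: "'n::finite operator \<Rightarrow> real \<Rightarrow> 'n operator" where
  "unitary_op A t = fun_calc A (\<lambda>r. cis (t * r))"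


definition ae_nonneg :: "'n::finite cfun \<Rightarrow> bool" where
  "ae_nonneg f \<longleftrightarrow> (AE x in lebesgue. f x \<in> \<real>\<^sub>\<ge>\<^sub>0)"

definition lattice_positive :: "'n::finite operator \<Rightarrow> bool" where
  "lattice_positive A \<longleftrightarrow> (\<forall>f h. A f h \<longrightarrow> ae_nonneg f \<longrightarrow> ae_nonneg h)"

definition positive_contraction_semigroup :: "(real \<Rightarrow> 'n::finite cfun \<Rightarrow> 'n cfun) \<Rightarrow> bool" where
  "positive_contraction_semigroup S \<longleftrightarrow>
     (\<forall>t\<ge>0. \<forall>f\<in>L2. S t f \<in> L2) \<and>
     (\<forall>t\<ge>0. \<forall>f\<in>L2. \<forall>g\<in>L2. \<forall>a b. S t (\<lambda>x. a * f x + b * g x) =\<^sub>a\<^sub>e (\<lambda>x. a * S t f x + b * S t g x)) \<and>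
     (\<forall>t\<ge>0. \<forall>f\<in>L2. L2_norm (S t f) \<le> L2_norm f) \<and>
     (\<forall>t\<ge>0. \<forall>f\<in>L2. ae_nonneg f \<longrightarrow> ae_nonneg (S t f)) \<and>
     (\<forall>f\<in>L2. S 0 f =\<^sub>a\<^sub>e f) \<and>
     (\<forall>s\<ge>0. \<forall>t\<ge>0. \<forall>f\<in>L2. S (s + t) f =\<^sub>a\<^sub>e S s (S t f))"

(* The right-hand side is a.e. real, as S is positive. *)

definition dominated_by :: "(real \<Rightarrow> 'n::finite operator) \<Rightarrow> (real \<Rightarrow> 'n cfun \<Rightarrow> 'n cfun) \<Rightarrow> bool" where
  "dominated_by T S \<longleftrightarrow>
     (\<forall>t\<ge>0. \<forall>f h. T t f h \<longrightarrow>
        (AE x in lebesgue. cmod (h x) \<le> Re (S t (\<lambda>y. complex_of_real (cmod (f y))) x)))"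

definition comparable_to_power :: "(real^'n::finite \<Rightarrow> real) \<Rightarrow> real \<Rightarrow> bool" where
  "comparable_to_power P a \<longleftrightarrow>
     (\<exists>c>0. \<exists>C>0. AE \<xi> in lebesgue.
        c * norm \<xi> powr a \<le> \<bar>P \<xi>\<bar> \<and> \<bar>P \<xi>\<bar> \<le> C * norm \<xi> powr a)"

(* u t is a representative of exp(i t A) f for each t in J, chosen so that t |-> u t x is
   continuous on J for a.e. x. *)

definition continuous_version ::
    "'n::finite operator \<Rightarrow> 'n cfun \<Rightarrow> real set \<Rightarrow> (real \<Rightarrow> 'n cfun) \<Rightarrow> bool" where
  "continuous_version A f J u \<longleftrightarrow>
     (\<forall>t\<in>J. unitary_op A t f (u t)) \<and>
     (AE x in lebesgue. continuous_on J (\<lambda>t. u t x))"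

end

theory Submission
  imports Defs "HOL-Probability.Characteristic_Functions"
begin

text \<open>By Plancherel's theorem the spectral measure of \<open>P(D)\<close> is \<open>B \<mapsto> F\<^sup>-\<^sup>1 1\<^bsub>B\<^esub>(P) F\<close>, where \<open>F\<close> is the Fourier
  transform, so its functional calculus consists of Fourier multipliers. For \<open>f\<close> in the domain of
  \<open>P(D)\<close> the map \<open>t \<mapsto> exp(itP(D)) f\<close> is Lipschitz into \<open>L2\<close>. A square function over dyadic
  increments then controls the pointwise oscillation in \<open>t\<close>, and the values at dyadic times extend
  to a version that is continuous in \<open>t\<close> for almost every \<open>x\<close>. Every such version tends, as
  \<open>t \<rightarrow> 0+\<close>, to its value at \<open>t = 0\<close>, which is \<open>f\<close> almost everywhere.\<close>

section \<open>The space \<open>L2\<close>\<close>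

text \<open>The main obstacle is that \<open>fun_calc\<close> quantifies the spectral measure
  existentially: membership in the domain of \<open>P(D)^\<delta>\<close> supplies some
  \<open>E\<close>, which is not known to be the Fourier one. Uniqueness of spectral measures is
  avoided. An arbitrary \<open>E\<close> is used for two things only: its domains and the
  Cauchy-Schwarz bound for its spectral integrals force \<open>P F\<close> into \<open>L2\<close>,
  where \<open>F\<close> is the transform of \<open>f\<close>; and the integral of the constant 1 is
  the identity, which fixes the value of any version at time 0. Whatever has to be exhibited is then
  built with the Fourier projections alone. On the analytic side a Lipschitz bound in
  \<open>L2\<close> is more than Kolmogorov's argument needs: about \<open>2 ^ n\<close> intervals
  of length \<open>1 / 2 ^ n\<close> each contribute a squared increment of order
  \<open>1 / 4 ^ n\<close>, and the total \<open>1 / 2 ^ n\<close> leaves room for a geometric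
  pointwise rate. The transform has the unnormalised kernel, hence the recurring constant
  \<open>(2 * pi) ^ CARD('n)\<close>.\<close>

lemma L2_measurable [measurable_dest]: "f \<in> L2 \<Longrightarrow> f \<in> borel_measurable lebesgue"
  by (simp add: L2_def)

lemma L2_integrable: "f \<in> L2 \<Longrightarrow> integrable lebesgue (\<lambda>x. (cmod (f x))\<^sup>2)"
  by (simp add: L2_def)

lemma L2_dominated:
  assumes "integrable lebesgue w" and [measurable]: "h \<in> borel_measurable lebesgue"
    and "AE x in lebesgue. (cmod (h x))\<^sup>2 \<le> w x"
  shows "h \<in> L2"
  unfolding L2_def
proof (intro CollectI conjI)
  show "integrable lebesgue (\<lambda>x. (cmod (h x))\<^sup>2)"
    by (rule Bochner_Integration.integrable_bound[OF assms(1)]) (use assms(3) in auto)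
qed fact

lemma L2_lincomb:
  assumes "f \<in> L2" "g \<in> L2"
  shows "(\<lambda>x. a * f x + b * g x) \<in> L2"
proof (rule L2_dominated)
  show "integrable lebesgue (\<lambda>x. 2 * (cmod a)\<^sup>2 * (cmod (f x))\<^sup>2 + 2 * (cmod b)\<^sup>2 * (cmod (g x))\<^sup>2)"
    using assms[THEN L2_integrable] by auto
  show "(\<lambda>x. a * f x + b * g x) \<in> borel_measurable lebesgue"
    using assms by measurable
  have "(cmod (u + v))\<^sup>2 \<le> 2 * (cmod u)\<^sup>2 + 2 * (cmod v)\<^sup>2" for u v :: complex
  proof -
    have "(cmod (u + v))\<^sup>2 \<le> (cmod u + cmod v)\<^sup>2"
      by (intro power_mono norm_triangle_ineq) auto
    also have "\<dots> \<le> 2 * (cmod u)\<^sup>2 + 2 * (cmod v)\<^sup>2"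
      using sum_squares_bound[of "cmod u" "cmod v"] by (simp add: power2_sum)
    finally show ?thesis .
  qed
  from this[of "a * f x" "b * g x" for x]
  show "AE x in lebesgue. (cmod (a * f x + b * g x))\<^sup>2
      \<le> 2 * (cmod a)\<^sup>2 * (cmod (f x))\<^sup>2 + 2 * (cmod b)\<^sup>2 * (cmod (g x))\<^sup>2"
    by (simp add: norm_mult power_mult_distrib mult.assoc)
qed

lemma borel_measurable_cnj [measurable (raw)]:
  assumes "f \<in> borel_measurable M"
  shows "(\<lambda>x. cnj (f x)) \<in> borel_measurable M"
  using measurable_compose[OF assms borel_measurable_continuous_onI[of cnj]]
  by (simp add: continuous_on_cnj)

lemma borel_measurable_lebesgue_ident [measurable]: "(\<lambda>x. x) \<in> borel_measurable lebesgue"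
  by (intro measurable_completion) simp

lemma L2_zero [simp]: "(\<lambda>x. 0) \<in> L2"
  by (simp add: L2_def)

lemma L2_scale [intro]: "f \<in> L2 \<Longrightarrow> (\<lambda>x. a * f x) \<in> L2"
  using L2_lincomb[of f f a 0] by simp

lemma L2_add [intro]: "f \<in> L2 \<Longrightarrow> g \<in> L2 \<Longrightarrow> (\<lambda>x. f x + g x) \<in> L2"
  using L2_lincomb[of f g 1 1] by simp

lemma L2_diff [intro]: "f \<in> L2 \<Longrightarrow> g \<in> L2 \<Longrightarrow> (\<lambda>x. f x - g x) \<in> L2"
  using L2_lincomb[of f g 1 "-1"] by simp

lemma L2_cnj [intro]: "f \<in> L2 \<Longrightarrow> (\<lambda>x. cnj (f x)) \<in> L2"
  unfolding L2_def by auto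

lemma L2_mult_bounded:
  assumes "f \<in> L2" and [measurable]: "m \<in> borel_measurable lebesgue"
    and "\<And>x. cmod (m x) \<le> C"
  shows "(\<lambda>x. m x * f x) \<in> L2"
proof (rule L2_dominated)
  show "integrable lebesgue (\<lambda>x. C\<^sup>2 * (cmod (f x))\<^sup>2)"
    using L2_integrable[OF assms(1)] by simp
  show "(\<lambda>x. m x * f x) \<in> borel_measurable lebesgue"
    using assms by measurable
  show "AE x in lebesgue. (cmod (m x * f x))\<^sup>2 \<le> C\<^sup>2 * (cmod (f x))\<^sup>2"
    by (auto simp: norm_mult power_mult_distrib intro!: mult_right_mono power_mono assms)
qed

lemma L2_integrable_mult:
  assumes "f \<in> L2" "g \<in> L2"
  shows "integrable lebesgue (\<lambda>x. f x * g x)"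
proof (rule Bochner_Integration.integrable_bound)
  show "integrable lebesgue (\<lambda>x. (cmod (f x))\<^sup>2 + (cmod (g x))\<^sup>2)"
    using assms[THEN L2_integrable] by auto
  show "(\<lambda>x. f x * g x) \<in> borel_measurable lebesgue"
    using assms by measurable
  have "a * b \<le> a\<^sup>2 + b\<^sup>2" if "0 \<le> a" "0 \<le> b" for a b :: real
    using sum_squares_bound[of a b] mult_nonneg_nonneg[OF that] by linarith
  then show "AE x in lebesgue. norm (f x * g x) \<le> norm ((cmod (f x))\<^sup>2 + (cmod (g x))\<^sup>2)"
    by (auto simp: norm_mult)
qed

lemma L2_integrable_inner: "f \<in> L2 \<Longrightarrow> g \<in> L2 \<Longrightarrow> integrable lebesgue (\<lambda>x. f x * cnj (g x))"
  using L2_integrable_mult[OF _ L2_cnj] by blast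

lemma ae_eq_measurable:
  assumes "f =\<^sub>a\<^sub>e g" "f \<in> borel_measurable lebesgue"
  shows "g \<in> borel_measurable lebesgue"
  using borel_measurable_AE[OF assms(2)] assms(1) by (simp add: ae_eq_def)

lemma ae_eq_refl [simp]: "f =\<^sub>a\<^sub>e f"
  unfolding ae_eq_def by simp

lemma ae_eq_L2:
  assumes "f =\<^sub>a\<^sub>e g" "f \<in> L2"
  shows "g \<in> L2"
proof (rule L2_dominated[OF L2_integrable[OF assms(2)]])
  show "g \<in> borel_measurable lebesgue"
    using assms by (auto intro: ae_eq_measurable)
  show "AE x in lebesgue. (cmod (g x))\<^sup>2 \<le> (cmod (f x))\<^sup>2"
    using assms(1) unfolding ae_eq_def by (auto elim: eventually_mono)
qed

lemma L2_inner_cong: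
  assumes "f =\<^sub>a\<^sub>e f'" "g =\<^sub>a\<^sub>e g'" "f \<in> L2" "g \<in> L2"
  shows "L2_inner f g = L2_inner f' g'"
  unfolding L2_inner_def
proof (rule integral_cong_AE)
  have "f' \<in> L2" "g' \<in> L2"
    using assms by (auto intro: ae_eq_L2)
  then show "(\<lambda>x. f' x * cnj (g' x)) \<in> borel_measurable lebesgue"
    using borel_measurable_integrable[OF L2_integrable_inner] by blast
  show "(\<lambda>x. f x * cnj (g x)) \<in> borel_measurable lebesgue"
    using borel_measurable_integrable[OF L2_integrable_inner] assms by blast
  show "AE x in lebesgue. f x * cnj (g x) = f' x * cnj (g' x)"
    using assms(1,2) unfolding ae_eq_def by eventually_elim auto
qed

lemma L2_norm_nonneg [simp]: "0 \<le> L2_norm f"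
  by (simp add: L2_norm_def)

lemma L2_norm_sq: "(L2_norm f)\<^sup>2 = (LINT x|lebesgue. (cmod (f x))\<^sup>2)"
  by (simp add: L2_norm_def)

lemma L2_inner_self: "L2_inner f f = complex_of_real ((L2_norm f)\<^sup>2)"
  unfolding L2_inner_def L2_norm_sq
  by (simp add: complex_norm_square[symmetric] flip: of_real_power integral_complex_of_real)

lemma L2_inner_cnj: "L2_inner g f = cnj (L2_inner f g)"
  unfolding L2_inner_def by (subst Bochner_Integration.integral_cnj[symmetric]) (simp add: mult.commute)

lemma L2_inner_lincomb_left:
  assumes "f \<in> L2" "g \<in> L2" "h \<in> L2"
  shows "L2_inner (\<lambda>x. a * f x + b * g x) h = a * L2_inner f h + b * L2_inner g h"
proof -
  have "L2_inner (\<lambda>x. a * f x + b * g x) h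
      = (LINT x|lebesgue. a * (f x * cnj (h x)) + b * (g x * cnj (h x)))"
    unfolding L2_inner_def by (simp add: algebra_simps)
  also have "\<dots> = a * L2_inner f h + b * L2_inner g h"
    unfolding L2_inner_def
    using L2_integrable_inner[OF assms(1,3)] L2_integrable_inner[OF assms(2,3)] by simp
  finally show ?thesis .
qed

lemma L2_inner_diff_left:
  "f \<in> L2 \<Longrightarrow> g \<in> L2 \<Longrightarrow> h \<in> L2 \<Longrightarrow> L2_inner (\<lambda>x. f x - g x) h = L2_inner f h - L2_inner g h"
  using L2_inner_lincomb_left[of f g h 1 "-1"] by simp

lemma L2_inner_lincomb_right:
  assumes "f \<in> L2" "g \<in> L2" "h \<in> L2"
  shows "L2_inner h (\<lambda>x. a * f x + b * g x) = cnj a * L2_inner h f + cnj b * L2_inner h g"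
  using L2_inner_lincomb_left[OF assms, of a b]
  by (subst (1 2 3) L2_inner_cnj) simp

lemma L2_inner_diff_right:
  "f \<in> L2 \<Longrightarrow> g \<in> L2 \<Longrightarrow> h \<in> L2 \<Longrightarrow> L2_inner h (\<lambda>x. f x - g x) = L2_inner h f - L2_inner h g"
  using L2_inner_lincomb_right[of f g h 1 "-1"] by simp

lemma L2_norm_scale: "L2_norm (\<lambda>x. a * f x) = cmod a * L2_norm f"
  unfolding L2_norm_def
  by (simp add: norm_mult power_mult_distrib real_sqrt_mult)

lemma L2_norm_minus_commute: "L2_norm (\<lambda>x. f x - g x) = L2_norm (\<lambda>x. g x - f x)"
  unfolding L2_norm_def by (simp add: norm_minus_commute)

lemma L2_norm_eq_0:
  assumes "f \<in> L2"
  shows "L2_norm f = 0 \<longleftrightarrow> f =\<^sub>a\<^sub>e (\<lambda>x. 0)"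
proof -
  have "L2_norm f = 0 \<longleftrightarrow> (LINT x|lebesgue. (cmod (f x))\<^sup>2) = 0"
    by (simp add: L2_norm_def)
  also have "\<dots> \<longleftrightarrow> (AE x in lebesgue. (cmod (f x))\<^sup>2 = 0)"
    by (rule integral_nonneg_eq_0_iff_AE[OF L2_integrable[OF assms]]) auto
  finally show ?thesis by (simp add: ae_eq_def)
qed

lemma L2_norm_diff_eq_0:
  assumes "f \<in> L2" "g \<in> L2" "L2_norm (\<lambda>x. f x - g x) = 0"
  shows "f =\<^sub>a\<^sub>e g"
  using L2_norm_eq_0[OF L2_diff[OF assms(1,2)]] assms(3) by (simp add: ae_eq_def)

lemma L2_norm_cong:
  assumes "f =\<^sub>a\<^sub>e g" "f \<in> L2"
  shows "L2_norm f = L2_norm g"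
proof -
  have "complex_of_real ((L2_norm f)\<^sup>2) = complex_of_real ((L2_norm g)\<^sup>2)"
    using L2_inner_cong[OF assms(1,1,2,2)] unfolding L2_inner_self .
  then show ?thesis
    by (simp only: of_real_eq_iff power2_eq_iff_nonneg[OF L2_norm_nonneg L2_norm_nonneg])
qed

lemma L2_Cauchy_Schwarz:
  assumes f: "f \<in> L2" and g: "g \<in> L2"
  shows "cmod (L2_inner f g) \<le> L2_norm f * L2_norm g"
proof (cases "L2_norm g = 0")
  case True
  then have "L2_inner f g = L2_inner f (\<lambda>x. 0)"
    using L2_norm_eq_0[OF g] by (intro L2_inner_cong) (auto simp: f g)
  then show ?thesis by (simp add: L2_inner_def)
next
  case False
  define a where "a = (L2_norm f)\<^sup>2"
  define b where "b = (L2_norm g)\<^sup>2"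
  define c where "c = L2_inner f g"
  have b: "b > 0" using False by (simp add: b_def)
  \<comment> \<open>This is \<open>b\<close> times the component of \<open>f\<close> orthogonal to
    \<open>g\<close>. Clearing the denominator \<open>b\<close> keeps the expansion of its norm
    polynomial.\<close>
  let ?h = "\<lambda>x. of_real b * f x + (- c) * g x"
  have fg: "L2_inner f f = of_real a" "L2_inner g g = of_real b" "L2_inner g f = cnj c"
    by (auto simp: a_def b_def c_def L2_inner_self intro: L2_inner_cnj)
  have "L2_inner ?h ?h = of_real b * (of_real b * of_real a + cnj (- c) * c)
      + (- c) * (of_real b * cnj c + cnj (- c) * of_real b)"
    by (subst L2_inner_lincomb_left[OF f g L2_lincomb[OF f g]],
        subst (1 2) L2_inner_lincomb_right[OF f g], simp_all add: f g fg c_def[symmetric])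
  also have "\<dots> = of_real (b * (b * a - (cmod c)\<^sup>2))"
    using complex_norm_square[of c] by (simp add: algebra_simps)
  finally have "(L2_norm ?h)\<^sup>2 = b * (b * a - (cmod c)\<^sup>2)"
    unfolding L2_inner_self of_real_eq_iff .
  then have "0 \<le> b * (b * a - (cmod c)\<^sup>2)"
    by (metis zero_le_power2)
  with b have "(cmod c)\<^sup>2 \<le> (L2_norm f * L2_norm g)\<^sup>2"
    by (simp add: zero_le_mult_iff a_def b_def power_mult_distrib mult.commute)
  then show ?thesis
    unfolding c_def by (rule power2_le_imp_le) simp
qed

lemma L2_norm_triangle:
  assumes f: "f \<in> L2" and g: "g \<in> L2"
  shows "L2_norm (\<lambda>x. f x + g x) \<le> L2_norm f + L2_norm g"
proof (rule power2_le_imp_le)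
  let ?h = "\<lambda>x. 1 * f x + 1 * g x"
  have "L2_inner ?h ?h = L2_inner f f + L2_inner f g + cnj (L2_inner f g) + L2_inner g g"
    by (subst L2_inner_lincomb_left[OF f g L2_lincomb[OF f g]],
        subst (1 2) L2_inner_lincomb_right[OF f g])
       (simp_all add: f g L2_inner_cnj[of g f])
  then have "Re (L2_inner ?h ?h) = (L2_norm f)\<^sup>2 + 2 * Re (L2_inner f g) + (L2_norm g)\<^sup>2"
    unfolding L2_inner_self by simp
  moreover have "Re (L2_inner f g) \<le> L2_norm f * L2_norm g"
    using L2_Cauchy_Schwarz[OF f g] complex_Re_le_cmod order_trans by blast
  ultimately show "(L2_norm (\<lambda>x. f x + g x))\<^sup>2 \<le> (L2_norm f + L2_norm g)\<^sup>2"
    by (simp add: L2_inner_self power2_sum)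
qed simp

lemma L2_norm_diff_triangle:
  assumes "f \<in> L2" "g \<in> L2" "h \<in> L2"
  shows "L2_norm (\<lambda>x. f x - h x) \<le> L2_norm (\<lambda>x. f x - g x) + L2_norm (\<lambda>x. g x - h x)"
  using L2_norm_triangle[OF L2_diff[OF assms(1,2)] L2_diff[OF assms(2,3)]] by simp

lemma L2_norm_abs_diff:
  assumes "f \<in> L2" "g \<in> L2"
  shows "\<bar>L2_norm f - L2_norm g\<bar> \<le> L2_norm (\<lambda>x. f x - g x)"
  using L2_norm_triangle[OF assms(2) L2_diff[OF assms]]
    L2_norm_triangle[OF assms(1) L2_diff[OF assms(2,1)]] L2_norm_minus_commute[of f g] by simp

section \<open>Convergence in \<open>L2\<close>\<close>

lemma L2_tendstoD:
  assumes "L2_tendsto \<phi> f"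
  shows "\<phi> n \<in> L2" "f \<in> L2" "(\<lambda>n. L2_norm (\<lambda>x. \<phi> n x - f x)) \<longlonglongrightarrow> 0"
  using assms by (auto simp: L2_tendsto_def)

lemma L2_tendsto_inner:
  assumes "L2_tendsto \<phi> f" "L2_tendsto \<psi> g"
  shows "(\<lambda>n. L2_inner (\<phi> n) (\<psi> n)) \<longlonglongrightarrow> L2_inner f g"
proof (rule LIM_zero_cancel, rule Lim_null_comparison)
  note [simp] = L2_tendstoD(1,2)[OF assms(1)] L2_tendstoD(1,2)[OF assms(2)]
  let ?a = "\<lambda>n. L2_norm (\<lambda>x. \<phi> n x - f x)" and ?b = "\<lambda>n. L2_norm (\<lambda>x. \<psi> n x - g x)"
  have "cmod (L2_inner (\<phi> n) (\<psi> n) - L2_inner f g) \<le> ?a n * (L2_norm g + ?b n) + L2_norm f * ?b n" for n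
  proof -
    have "L2_inner (\<phi> n) (\<psi> n) - L2_inner f g
        = L2_inner (\<lambda>x. \<phi> n x - f x) (\<psi> n) + L2_inner f (\<lambda>x. \<psi> n x - g x)"
      by (simp add: L2_inner_diff_left L2_inner_diff_right)
    also have "cmod \<dots> \<le> ?a n * L2_norm (\<psi> n) + L2_norm f * ?b n"
      by (intro norm_triangle_mono L2_Cauchy_Schwarz L2_diff) auto
    also have "L2_norm (\<psi> n) \<le> L2_norm g + ?b n"
      using L2_norm_abs_diff[of "\<psi> n" g] by simp
    finally show ?thesis by (simp add: mult_left_mono)
  qed
  then show "\<forall>\<^sub>F n in sequentially. cmod (L2_inner (\<phi> n) (\<psi> n) - L2_inner f g)
      \<le> ?a n * (L2_norm g + ?b n) + L2_norm f * ?b n" by simp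
  have "(\<lambda>n. ?a n * (L2_norm g + ?b n) + L2_norm f * ?b n) \<longlonglongrightarrow> 0 * (L2_norm g + 0) + L2_norm f * 0"
    by (intro tendsto_intros L2_tendstoD assms)
  then show "(\<lambda>n. ?a n * (L2_norm g + ?b n) + L2_norm f * ?b n) \<longlonglongrightarrow> 0" by simp
qed

lemma L2_tendsto_const: "f \<in> L2 \<Longrightarrow> L2_tendsto (\<lambda>n. f) f"
  by (simp add: L2_tendsto_def L2_norm_def)

lemma L2_tendsto_lincomb:
  assumes "L2_tendsto \<phi> f" "L2_tendsto \<psi> g"
  shows "L2_tendsto (\<lambda>n x. a * \<phi> n x + b * \<psi> n x) (\<lambda>x. a * f x + b * g x)"
  unfolding L2_tendsto_def
proof (intro conjI allI)
  note [simp] = L2_tendstoD(1,2)[OF assms(1)] L2_tendstoD(1,2)[OF assms(2)]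
  show "(\<lambda>x. a * \<phi> n x + b * \<psi> n x) \<in> L2" for n by (intro L2_lincomb) simp_all
  show "(\<lambda>x. a * f x + b * g x) \<in> L2" by (intro L2_lincomb) simp_all
  have le: "L2_norm (\<lambda>x. (a * \<phi> n x + b * \<psi> n x) - (a * f x + b * g x))
      \<le> cmod a * L2_norm (\<lambda>x. \<phi> n x - f x) + cmod b * L2_norm (\<lambda>x. \<psi> n x - g x)" for n
    using L2_norm_triangle[OF L2_scale[OF L2_diff] L2_scale[OF L2_diff], of "\<phi> n" f "\<psi> n" g a b]
    by (simp add: L2_norm_scale) (simp add: algebra_simps)
  have "(\<lambda>n. cmod a * L2_norm (\<lambda>x. \<phi> n x - f x) + cmod b * L2_norm (\<lambda>x. \<psi> n x - g x))
      \<longlonglongrightarrow> cmod a * 0 + cmod b * 0"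
    by (intro tendsto_intros L2_tendstoD assms)
  then have *: "(\<lambda>n. cmod a * L2_norm (\<lambda>x. \<phi> n x - f x) + cmod b * L2_norm (\<lambda>x. \<psi> n x - g x))
      \<longlonglongrightarrow> 0" by simp
  show "(\<lambda>n. L2_norm (\<lambda>x. (a * \<phi> n x + b * \<psi> n x) - (a * f x + b * g x))) \<longlonglongrightarrow> 0"
    by (rule Lim_null_comparison[OF _ *]) (simp add: le)
qed

lemma nn_integral_L2_norm:
  assumes "f \<in> L2"
  shows "(\<integral>\<^sup>+x. ennreal ((cmod (f x))\<^sup>2) \<partial>lebesgue) = ennreal ((L2_norm f)\<^sup>2)"
  unfolding L2_norm_sq by (rule nn_integral_eq_integral[OF L2_integrable[OF assms]]) simp

text \<open>The form in which Fatou's lemma delivers its conclusions: an extended nonnegative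
  integral is bounded before integrability is known.\<close>

lemma L2_nn_integralI:
  assumes [measurable]: "f \<in> borel_measurable lebesgue" and "0 \<le> c"
    and le: "(\<integral>\<^sup>+x. ennreal ((cmod (f x))\<^sup>2) \<partial>lebesgue) \<le> ennreal (c\<^sup>2)"
  shows "f \<in> L2" "L2_norm f \<le> c"
proof -
  have "integrable lebesgue (\<lambda>x. (cmod (f x))\<^sup>2)"
    by (rule integrableI_nonneg) (use le in \<open>auto simp: less_top[symmetric] top_unique\<close>)
  then show "f \<in> L2" by (simp add: L2_def)
  then have "ennreal ((L2_norm f)\<^sup>2) \<le> ennreal (c\<^sup>2)"
    using le by (simp add: nn_integral_L2_norm)
  then have "(L2_norm f)\<^sup>2 \<le> c\<^sup>2"
    by (subst (asm) ennreal_le_iff) auto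
  then show "L2_norm f \<le> c"
    using \<open>0 \<le> c\<close> by (rule power2_le_imp_le)
qed

text \<open>A quantitative Borel-Cantelli argument. Of the two factors \<open>q\<close> gained per
  step, one makes the integrals of \<open>h k / q ^ k\<close> summable, and the other survives as
  the pointwise rate, since each term is below the almost everywhere finite sum. It serves the
  completeness of \<open>L2\<close> and both halves of Kolmogorov's argument.\<close>

lemma AE_geometric_bound:
  fixes h :: "nat \<Rightarrow> 'a \<Rightarrow> real"
  assumes [measurable]: "\<And>k. h k \<in> borel_measurable M" and h0: "\<And>k x. 0 \<le> h k x"
    and q: "0 < q" "q < 1" and K: "0 \<le> K"
    and le: "\<And>k. (\<integral>\<^sup>+x. ennreal (h k x) \<partial>M) \<le> ennreal (K * (q\<^sup>2) ^ k)"
  shows "AE x in M. \<exists>C. \<forall>k. h k x \<le> C * q ^ k"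
proof -
  have "(\<integral>\<^sup>+x. (\<Sum>k. ennreal (h k x / q ^ k)) \<partial>M) = (\<Sum>k. \<integral>\<^sup>+x. ennreal (h k x / q ^ k) \<partial>M)"
    by (rule nn_integral_suminf) simp
  also have "\<dots> \<le> (\<Sum>k. ennreal (K * q ^ k))"
  proof (rule suminf_le)
    fix k
    have "(\<integral>\<^sup>+x. ennreal (h k x / q ^ k) \<partial>M) = (\<integral>\<^sup>+x. ennreal (1 / q ^ k) * ennreal (h k x) \<partial>M)"
      using q h0 by (intro nn_integral_cong) (simp flip: ennreal_mult)
    also have "\<dots> = ennreal (1 / q ^ k) * (\<integral>\<^sup>+x. ennreal (h k x) \<partial>M)"
      by (rule nn_integral_cmult) simp
    also have "\<dots> \<le> ennreal (1 / q ^ k) * ennreal (K * (q\<^sup>2) ^ k)"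
      by (intro mult_left_mono le) simp
    also have "\<dots> = ennreal (K * q ^ k)"
      using q K by (simp flip: ennreal_mult add: power_even_eq power2_eq_square power_mult_distrib)
    finally show "(\<integral>\<^sup>+x. ennreal (h k x / q ^ k) \<partial>M) \<le> ennreal (K * q ^ k)" .
  qed auto
  also have "\<dots> = ennreal (\<Sum>k. K * q ^ k)"
    using q K by (intro suminf_ennreal2) (auto intro!: summable_mult summable_geometric)
  finally have "(\<integral>\<^sup>+x. (\<Sum>k. ennreal (h k x / q ^ k)) \<partial>M) \<noteq> \<infinity>"
    by (auto simp: top_unique)
  then have "AE x in M. (\<Sum>k. ennreal (h k x / q ^ k)) \<noteq> \<infinity>"
    by (intro nn_integral_PInf_AE) auto
  then show ?thesis
  proof eventually_elim
    case (elim x)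
    then obtain C where C: "0 \<le> C" "(\<Sum>k. ennreal (h k x / q ^ k)) = ennreal C"
      by (cases "\<Sum>k. ennreal (h k x / q ^ k)") auto
    have "h k x \<le> C * q ^ k" for k
    proof -
      have "ennreal (h k x / q ^ k) \<le> ennreal C"
        unfolding C(2)[symmetric] using sum_le_suminf[of "\<lambda>k. ennreal (h k x / q ^ k)" "{k}"] by simp
      then show ?thesis
        using C(1) q by (simp add: field_simps)
    qed
    then show ?case by blast
  qed
qed

text \<open>Riesz-Fischer: a subsequence with geometrically small increments converges almost
  everywhere, and Fatou's lemma along it shows that its pointwise limit is also the limit in norm of
  the full sequence.\<close>

lemma L2_complete:
  fixes f :: "nat \<Rightarrow> 'n::finite cfun"
  assumes f: "\<And>n. f n \<in> L2"
    and cauchy: "\<And>e. 0 < e \<Longrightarrow> \<exists>N. \<forall>m\<ge>N. \<forall>n\<ge>N. L2_norm (\<lambda>x. f m x - f n x) < e"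
  shows "\<exists>g. L2_tendsto f g"
proof -
  have [measurable]: "f n \<in> borel_measurable lebesgue" for n
    using f by measurable
  obtain N where N: "\<And>k m n. m \<ge> N k \<Longrightarrow> n \<ge> N k \<Longrightarrow> L2_norm (\<lambda>x. f m x - f n x) < (1/2) ^ k"
    using cauchy[of "(1/2) ^ k" for k] by (metis zero_less_power zero_less_divide_1_iff zero_less_numeral)
  \<comment> \<open>Summing the thresholds gives indices that are monotone in \<open>k\<close> and
    still dominate \<open>N k\<close>.\<close>
  define r where "r k = (\<Sum>i\<le>k. N i)" for k
  have r: "N k \<le> r k" for k
    unfolding r_def by (rule member_le_sum) auto
  have r_mono: "r k \<le> r (Suc k)" for k
    by (simp add: r_def)
  have "AE x in lebesgue. \<exists>C. \<forall>k. (cmod (f (r (Suc k)) x - f (r k) x))\<^sup>2 \<le> C * (1/2) ^ k"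
  proof (rule AE_geometric_bound[where K=1])
    fix k
    have "(\<integral>\<^sup>+x. ennreal ((cmod (f (r (Suc k)) x - f (r k) x))\<^sup>2) \<partial>lebesgue)
        = ennreal ((L2_norm (\<lambda>x. f (r (Suc k)) x - f (r k) x))\<^sup>2)"
      by (intro nn_integral_L2_norm L2_diff f)
    also have "\<dots> \<le> ennreal (((1/2) ^ k)\<^sup>2)"
      using r[of k] r_mono[of k]
      by (intro ennreal_leI power_mono less_imp_le[OF N]) auto
    finally show "(\<integral>\<^sup>+x. ennreal ((cmod (f (r (Suc k)) x - f (r k) x))\<^sup>2) \<partial>lebesgue)
        \<le> ennreal (1 * ((1/2)\<^sup>2) ^ k)"
      by (simp only: power_mult[symmetric] mult.commute[of k 2] mult_1)
  qed auto
  then have conv: "AE x in lebesgue. convergent (\<lambda>k. f (r k) x)"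
  proof eventually_elim
    case (elim x)
    then obtain C where C: "\<And>k. (cmod (f (r (Suc k)) x - f (r k) x))\<^sup>2 \<le> C * (1/2) ^ k" by auto
    have bnd: "cmod (f (r (Suc k)) x - f (r k) x) \<le> sqrt C * (sqrt (1/2)) ^ k" for k
      using real_le_rsqrt[OF C[of k]] by (simp only: real_sqrt_mult real_sqrt_power)
    have "summable (\<lambda>k. sqrt C * (sqrt (1/2)) ^ k)"
      by (intro summable_mult summable_geometric) (simp add: real_sqrt_divide)
    then have "summable (\<lambda>k. f (r (Suc k)) x - f (r k) x)"
      by (rule summable_comparison_test'[where N=0]) (rule bnd)
    then show ?case
      by (simp add: summable_iff_convergent sum_lessThan_telescope[where f="\<lambda>k. f (r k) x"] convergent_diff_const_right_iff)
  qed
  \<comment> \<open>Off the convergence set \<open>lim\<close> takes a default value; this does not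
    disturb measurability on the whole space.\<close>
  define g where "g x = lim (\<lambda>k. f (r k) x)" for x
  have [measurable]: "g \<in> borel_measurable lebesgue"
    unfolding g_def[abs_def] by measurable
  have lim: "AE x in lebesgue. (\<lambda>k. f (r k) x) \<longlonglongrightarrow> g x"
    using conv by eventually_elim (simp add: g_def convergent_LIMSEQ_iff)
  \<comment> \<open>Fatou along \<open>r j\<close> with \<open>n\<close> fixed. That
    \<open>g\<close> itself lies in \<open>L2\<close> follows afterwards, from
    \<open>g = f n - (f n - g)\<close>.\<close>
  have near: "(\<lambda>x. f n x - g x) \<in> L2 \<and> L2_norm (\<lambda>x. f n x - g x) \<le> (1/2) ^ k" if "n \<ge> N k" for n k
  proof -
    have "(\<integral>\<^sup>+x. ennreal ((cmod (f n x - g x))\<^sup>2) \<partial>lebesgue)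
        = (\<integral>\<^sup>+x. liminf (\<lambda>j. ennreal ((cmod (f n x - f (r j) x))\<^sup>2)) \<partial>lebesgue)"
    proof (rule nn_integral_cong_AE)
      show "AE x in lebesgue. ennreal ((cmod (f n x - g x))\<^sup>2)
          = liminf (\<lambda>j. ennreal ((cmod (f n x - f (r j) x))\<^sup>2))"
        using lim
      proof eventually_elim
        case (elim x)
        have "(\<lambda>j. ennreal ((cmod (f n x - f (r j) x))\<^sup>2)) \<longlonglongrightarrow> ennreal ((cmod (f n x - g x))\<^sup>2)"
          by (intro tendsto_intros elim)
        then show ?case
          using lim_imp_Liminf trivial_limit_sequentially by metis
      qed
    qed
    also have "\<dots> \<le> liminf (\<lambda>j. \<integral>\<^sup>+x. ennreal ((cmod (f n x - f (r j) x))\<^sup>2) \<partial>lebesgue)"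
      by (rule nn_integral_liminf) simp
    also have "\<dots> \<le> ennreal (((1/2) ^ k)\<^sup>2)"
    proof (rule Liminf_le)
      have "(\<integral>\<^sup>+x. ennreal ((cmod (f n x - f (r j) x))\<^sup>2) \<partial>lebesgue) \<le> ennreal (((1/2) ^ k)\<^sup>2)"
        if "j \<ge> k" for j
      proof -
        have "r j \<ge> r k"
          by (rule lift_Suc_mono_le[of r, OF r_mono that])
        then have "r j \<ge> N k" using r[of k] by simp
        then show ?thesis
          using \<open>n \<ge> N k\<close>
          by (subst nn_integral_L2_norm[OF L2_diff[OF f f]])
             (intro ennreal_leI power_mono less_imp_le[OF N]; simp)
      qed
      then show "\<forall>\<^sub>F j in sequentially.
          (\<integral>\<^sup>+x. ennreal ((cmod (f n x - f (r j) x))\<^sup>2) \<partial>lebesgue) \<le> ennreal (((1/2) ^ k)\<^sup>2)"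
        by (auto simp: eventually_sequentially)
    qed simp
    finally have le: "(\<integral>\<^sup>+x. ennreal ((cmod (f n x - g x))\<^sup>2) \<partial>lebesgue) \<le> ennreal (((1/2) ^ k)\<^sup>2)" .
    show ?thesis
      using L2_nn_integralI[OF _ _ le] by simp
  qed
  have "g \<in> L2"
    using L2_diff[OF f[of "N 0"] conjunct1[OF near[of 0 "N 0"]]] by simp
  moreover have "(\<lambda>n. L2_norm (\<lambda>x. f n x - g x)) \<longlonglongrightarrow> 0"
  proof (rule LIMSEQ_I)
    fix e :: real assume "0 < e"
    then obtain k where "(1/2) ^ k < e"
      using real_arch_pow_inv[of e "1/2"] by auto
    then show "\<exists>M. \<forall>n\<ge>M. norm (L2_norm (\<lambda>x. f n x - g x) - 0) < e"
      using near[of k] by (intro exI[of _ "N k"]) force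
  qed
  ultimately show ?thesis
    using f by (auto simp: L2_tendsto_def)
qed

section \<open>Approximation by truncated and by continuous functions\<close>

lemma L2_tendsto_dominated:
  assumes [measurable]: "\<And>n. \<phi> n \<in> borel_measurable lebesgue" and f: "f \<in> L2"
    and lim: "AE x in lebesgue. (\<lambda>n. \<phi> n x) \<longlonglongrightarrow> f x"
    and w: "integrable lebesgue w" and dom: "\<And>n. AE x in lebesgue. (cmod (\<phi> n x))\<^sup>2 \<le> w x"
  shows "L2_tendsto \<phi> f"
proof -
  have \<phi>: "\<phi> n \<in> L2" for n
    by (rule L2_dominated[OF w _ dom]) simp
  have [measurable]: "f \<in> borel_measurable lebesgue" using f by measurable
  have "(\<lambda>n. LINT x|lebesgue. (cmod (\<phi> n x - f x))\<^sup>2) \<longlonglongrightarrow> (LINT x|(lebesgue::(real^'a) measure). 0)"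
  proof (rule integral_dominated_convergence)
    show "integrable lebesgue (\<lambda>x. 2 * w x + 2 * (cmod (f x))\<^sup>2)"
      using w L2_integrable[OF f] by simp
    show "AE x in lebesgue. (\<lambda>n. (cmod (\<phi> n x - f x))\<^sup>2) \<longlonglongrightarrow> 0"
      using lim
    proof eventually_elim
      case (elim x)
      have "(\<lambda>n. (cmod (\<phi> n x - f x))\<^sup>2) \<longlonglongrightarrow> (cmod (f x - f x))\<^sup>2"
        by (intro tendsto_intros elim)
      then show ?case by simp
    qed
    show "AE x in lebesgue. norm ((cmod (\<phi> n x - f x))\<^sup>2) \<le> 2 * w x + 2 * (cmod (f x))\<^sup>2" for n
      using dom[of n]
    proof eventually_elim
      case (elim x)
      have "(cmod (\<phi> n x - f x))\<^sup>2 \<le> (cmod (\<phi> n x) + cmod (f x))\<^sup>2"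
        by (intro power_mono norm_triangle_ineq4) auto
      also have "\<dots> \<le> 2 * (cmod (\<phi> n x))\<^sup>2 + 2 * (cmod (f x))\<^sup>2"
        using sum_squares_bound[of "cmod (\<phi> n x)" "cmod (f x)"] by (simp add: power2_sum)
      finally show ?case using elim by simp
    qed
  qed auto
  then have "(\<lambda>n. sqrt (LINT x|lebesgue. (cmod (\<phi> n x - f x))\<^sup>2)) \<longlonglongrightarrow> sqrt 0"
    by (intro tendsto_real_sqrt) simp
  then show ?thesis
    using \<phi> f by (simp add: L2_tendsto_def L2_norm_def)
qed

text \<open>Common source of three cutoffs: to a ball, to bounded values, and to the set where a
  symbol is bounded.\<close>

lemma L2_tendsto_truncate:
  fixes f :: "'n::finite cfun"
  assumes f: "f \<in> L2" and [measurable]: "\<And>n. Measurable.pred lebesgue (Q n)"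
    and ev: "\<And>x. \<forall>\<^sub>F n in sequentially. Q n x"
  shows "L2_tendsto (\<lambda>n x. if Q n x then f x else 0) f"
proof (rule L2_tendsto_dominated[OF _ f _ L2_integrable[OF f]])
  have [measurable]: "f \<in> borel_measurable lebesgue" using f by measurable
  show "(\<lambda>x. if Q n x then f x else 0) \<in> borel_measurable lebesgue" for n
    by measurable
  show "AE x in lebesgue. (\<lambda>n. if Q n x then f x else 0) \<longlonglongrightarrow> f x"
  proof (intro AE_I2 tendsto_eventually)
    show "\<forall>\<^sub>F n in sequentially. (if Q n x then f x else 0) = f x" for x
      using ev[of x] by (rule eventually_mono) simp
  qed
qed auto

lemma L2_cutoff_integrable:
  fixes f :: "'n::finite cfun"
  assumes f: "f \<in> L2"
  shows "integrable lebesgue (\<lambda>x. if norm x \<le> R then f x else 0)"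
proof -
  have [measurable]: "f \<in> borel_measurable lebesgue" using f by measurable
  have "(\<lambda>x. complex_of_real (indicator (cball (0::real^'n) R) x)) \<in> L2"
  proof (rule L2_dominated)
    show "integrable lebesgue (indicator (cball (0::real^'n) R) :: _ \<Rightarrow> real)"
      using lmeasurable_cball[of "0::real^'n" R] by (simp add: fmeasurable_def less_top)
  qed (auto simp: indicator_def)
  from L2_integrable_mult[OF f this] show ?thesis
    by (rule Bochner_Integration.integrable_bound) (auto simp: indicator_def)
qed

text \<open>A measurable function is an almost everywhere limit of continuous ones, but without
  domination. So \<open>f\<close> is first truncated in size and in space, and the continuous
  approximants are then forced into the same bounds, after which dominated convergence
  applies.\<close>

lemma L2_dense_continuous:
  fixes f :: "'n::finite cfun"
  assumes f: "f \<in> L2" and "0 < e"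
  shows "\<exists>g R. continuous_on UNIV g \<and> (\<forall>x. norm x > R \<longrightarrow> g x = 0) \<and> g \<in> L2 \<and> L2_norm (\<lambda>x. f x - g x) < e"
proof -
  have [measurable]: "f \<in> borel_measurable lebesgue" using f by measurable
  define Q where "Q n x \<longleftrightarrow> cmod (f x) \<le> real n \<and> norm x \<le> real n" for n x
  have [measurable]: "Measurable.pred lebesgue (Q n)" for n unfolding Q_def by measurable
  define F where "F n x = (if Q n x then f x else 0)" for n x
  have FL: "L2_tendsto F f"
    unfolding F_def[abs_def]
  proof (rule L2_tendsto_truncate[OF f])
    fix x
    obtain m where "max (cmod (f x)) (norm x) \<le> real m"
      using real_arch_simple by blast
    then show "\<forall>\<^sub>F n in sequentially. Q n x"
      by (intro eventually_sequentiallyI[of m]) (auto simp: Q_def)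
  qed simp
  from LIMSEQ_D[OF L2_tendstoD(3)[OF FL], of "e/2"] \<open>0 < e\<close>
  obtain M where M: "L2_norm (\<lambda>x. F M x - f x) < e / 2" by auto
  have "F M \<in> borel_measurable lebesgue" unfolding F_def[abs_def] by measurable
  then have "F M measurable_on UNIV"
    by (simp add: lebesgue_measurable_imp_measurable_on)
  then obtain N c where N: "negligible N" and c: "\<And>n. continuous_on UNIV (c n)"
    and lim: "\<And>x. x \<notin> N \<Longrightarrow> (\<lambda>n. c n x) \<longlonglongrightarrow> F M x"
    unfolding measurable_on_def by auto
  \<comment> \<open>The margin 1 makes \<open>cut\<close> equal to 1 on the ball of radius
    \<open>M\<close> that supports \<open>F M\<close>, and keeps \<open>K\<close> positive when
    \<open>M = 0\<close>.\<close>
  define K where "K = real M + 1"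
  have K: "K > 0" "cmod (F M x) \<le> K" for x
    by (auto simp: K_def F_def Q_def)
  define cut where "cut x = max 0 (min 1 (K - norm x))" for x :: "real^'n"
  have cut: "0 \<le> cut x" "cut x \<le> 1" for x by (auto simp: cut_def)
  \<comment> \<open>Composition of \<open>c n\<close> with the radial retraction onto the disc of
    radius \<open>K\<close>: it is continuous and fixes the values of \<open>F M\<close>, so the
    pointwise limit is unchanged.\<close>
  define d where "d n x = of_real (K / max K (cmod (c n x))) * c n x" for n x
  define h where "h n x = complex_of_real (cut x) * d n x" for n x
  have h_cont: "continuous_on UNIV (h n)" for n
    unfolding h_def[abs_def] d_def cut_def using K(1)
    by (intro continuous_intros c) (auto simp: max_def)
  have h_supp: "h n x = 0" if "norm x > K" for n x
    using that by (simp add: h_def cut_def)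
  have h_bdd: "cmod (h n x) \<le> K" for n x
  proof -
    have "cmod (d n x) = K / max K (cmod (c n x)) * cmod (c n x)"
      using K(1) by (simp add: d_def norm_mult norm_divide)
    also have "\<dots> \<le> K"
      using K(1) by (simp add: divide_simps max_def)
    finally have "cmod (d n x) \<le> K" .
    from mult_mono[OF cut(2)[of x] this] show ?thesis
      using cut(1)[of x] by (simp add: h_def norm_mult)
  qed
  have "L2_tendsto h (F M)"
  proof (rule L2_tendsto_dominated)
    show "h n \<in> borel_measurable lebesgue" for n
      using borel_measurable_continuous_onI[OF h_cont] by simp
    show "F M \<in> L2" using FL by (rule L2_tendstoD)
    show "integrable lebesgue (\<lambda>x. K\<^sup>2 * indicator (cball (0::real^'n) K) x)"
      using lmeasurable_cball[of "0::real^'n" K] by (simp add: fmeasurable_def less_top)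
    show "AE x in lebesgue. (cmod (h n x))\<^sup>2 \<le> K\<^sup>2 * indicator (cball 0 K) x" for n
      using h_bdd h_supp K(1) by (auto simp: indicator_def intro!: power_mono)
    have "AE x in lebesgue. x \<notin> N"
      using N by (simp add: AE_not_in negligible_iff_null_sets)
    then show "AE x in lebesgue. (\<lambda>n. h n x) \<longlonglongrightarrow> F M x"
    proof eventually_elim
      case (elim x)
      have "(\<lambda>n. h n x) \<longlonglongrightarrow> complex_of_real (cut x) * (of_real (K / max K (cmod (F M x))) * F M x)"
        unfolding h_def d_def using K(1) by (intro tendsto_intros lim elim) (auto simp: max_def)
      also have "max K (cmod (F M x)) = K" using K(2)[of x] by simp
      also have "complex_of_real (cut x) * (of_real (K / K) * F M x) = F M x"
        using K(1) by (auto simp: F_def Q_def cut_def K_def)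
      finally show ?case .
    qed
  qed
  note hL = this
  from LIMSEQ_D[OF L2_tendstoD(3)[OF hL], of "e/2"] \<open>0 < e\<close>
  obtain m where m: "L2_norm (\<lambda>x. h m x - F M x) < e / 2" by auto
  have "L2_norm (\<lambda>x. f x - h m x) \<le> L2_norm (\<lambda>x. f x - F M x) + L2_norm (\<lambda>x. F M x - h m x)"
    by (intro L2_norm_diff_triangle f L2_tendstoD[OF FL] L2_tendstoD[OF hL])
  then have "L2_norm (\<lambda>x. f x - h m x) < e"
    using M m L2_norm_minus_commute[of f "F M"] L2_norm_minus_commute[of "h m" "F M"] by simp
  then show ?thesis
    using h_cont h_supp L2_tendstoD(1)[OF hL] by blast
qed

section \<open>Gaussians and the Fourier integral\<close>

text \<open>This is the characteristic function of the standard normal distribution with the factor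
  \<open>sqrt (2 * pi)\<close> of the density removed.\<close>

lemma std_gaussian_1d:
  "integrable lborel (\<lambda>x::real. complex_of_real (exp (- x\<^sup>2 / 2)) * cis (t * x))"
  "(LINT x|lborel. complex_of_real (exp (- x\<^sup>2 / 2)) * cis (t * x)) = of_real (sqrt (2 * pi) * exp (- t\<^sup>2 / 2))"
proof -
  have int: "integrable lborel (\<lambda>x::real. exp (- x\<^sup>2 / 2))"
    using integrable_mult_right[OF integrable_std_normal_moment[of 0], of "sqrt (2 * pi)"]
    by (simp add: std_normal_density_def)
  show "integrable lborel (\<lambda>x::real. complex_of_real (exp (- x\<^sup>2 / 2)) * cis (t * x))"
    by (rule Bochner_Integration.integrable_bound[OF int]) (auto simp: norm_mult cis_conv_exp)
  have "of_real (exp (- t\<^sup>2 / 2)) = char std_normal_distribution t"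
    by (simp add: char_std_normal_distribution)
  also have "\<dots> = (LINT x|lborel. std_normal_density x *\<^sub>R cis (t * x))"
    unfolding char_def by (subst integral_density) (auto simp: cis_conv_exp)
  also have "\<dots> = (LINT x|lborel. of_real (1 / sqrt (2 * pi)) * (complex_of_real (exp (- x\<^sup>2 / 2)) * cis (t * x)))"
    by (simp add: std_normal_density_def scaleR_conv_of_real)
  also have "\<dots> = of_real (1 / sqrt (2 * pi)) * (LINT x|lborel. (complex_of_real (exp (- x\<^sup>2 / 2)) * cis (t * x)))"
    by (rule integral_mult_right_zero)
  finally show "(LINT x|lborel. complex_of_real (exp (- x\<^sup>2 / 2)) * cis (t * x)) = of_real (sqrt (2 * pi) * exp (- t\<^sup>2 / 2))"
    by (simp add: field_simps)
qed

lemma cis_sum: "finite A \<Longrightarrow> cis (sum f A) = (\<Prod>x\<in>A. cis (f x))"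
  by (induction rule: finite_induct) (auto simp: cis_mult[symmetric])

text \<open>In coordinates \<open>lborel\<close> is the image of a product measure and the integrand
  is a product of one-dimensional ones, so the integral factorises over
  \<open>Basis\<close>.\<close>

lemma std_gaussian:
  fixes v :: "'a::euclidean_space"
  shows "integrable lborel (\<lambda>x. complex_of_real (exp (- (norm x)\<^sup>2 / 2)) * cis (v \<bullet> x))"
    and "(LINT x|lborel. complex_of_real (exp (- (norm x)\<^sup>2 / 2)) * cis (v \<bullet> x))
      = of_real (sqrt (2 * pi) ^ DIM('a) * exp (- (norm v)\<^sup>2 / 2))"
proof -
  interpret product_sigma_finite "\<lambda>b::'a. lborel :: real measure" ..
  let ?s = "\<lambda>f. \<Sum>b\<in>Basis. f b *\<^sub>R b :: 'a"
  let ?h = "\<lambda>x::'a. complex_of_real (exp (- (norm x)\<^sup>2 / 2)) * cis (v \<bullet> x)"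
  let ?k = "\<lambda>b (x::real). complex_of_real (exp (- x\<^sup>2 / 2)) * cis ((v \<bullet> b) * x)"
  have "(\<lambda>f. f b) \<in> (\<Pi>\<^sub>M b\<in>(Basis::'a set). (lborel::real measure)) \<rightarrow>\<^sub>M borel" if "b \<in> Basis" for b
    using measurable_component_singleton[OF that, of "\<lambda>_. lborel"] by simp
  then have [measurable]: "?s \<in> (\<Pi>\<^sub>M b\<in>Basis. lborel) \<rightarrow>\<^sub>M borel"
    by (intro borel_measurable_sum borel_measurable_scaleR) auto
  have [measurable]: "?h \<in> borel_measurable borel"
    by (auto simp: cis_conv_exp)
  have norm2: "(norm x)\<^sup>2 = (\<Sum>b\<in>Basis. (x \<bullet> b)\<^sup>2)" for x :: 'a
    by (subst power2_norm_eq_inner, subst euclidean_inner) (simp add: power2_eq_square)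
  have eq: "?h (?s f) = (\<Prod>b\<in>Basis. ?k b (f b))" for f
  proof -
    have "(norm (?s f))\<^sup>2 = (\<Sum>b\<in>Basis. (f b)\<^sup>2)"
      by (simp add: norm2)
    then have "exp (- (norm (?s f))\<^sup>2 / 2) = (\<Prod>b\<in>Basis. exp (- (f b)\<^sup>2 / 2))"
      by (simp add: exp_sum[symmetric] sum_negf sum_divide_distrib)
    moreover have "cis (v \<bullet> ?s f) = (\<Prod>b\<in>Basis. cis ((v \<bullet> b) * f b))"
      by (simp add: inner_sum_right cis_sum[symmetric] mult.commute)
    ultimately show ?thesis by (simp add: prod.distrib)
  qed
  have "integrable (\<Pi>\<^sub>M b\<in>(Basis::'a set). lborel) (\<lambda>f. ?h (?s f))"
    unfolding eq by (intro product_integrable_prod std_gaussian_1d) simp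
  show "integrable lborel ?h"
    by (subst lborel_eq, subst integrable_distr_eq) fact+
  have "(LINT x|lborel. ?h x) = (LINT f|(\<Pi>\<^sub>M b\<in>(Basis::'a set). lborel). ?h (?s f))"
    by (subst lborel_eq, rule integral_distr) fact+
  also have "\<dots> = (\<Prod>b\<in>Basis. LINT x|lborel. ?k b x)"
    unfolding eq by (intro product_integral_prod std_gaussian_1d) simp
  also have "\<dots> = (\<Prod>b\<in>Basis. of_real (sqrt (2 * pi) * exp (- (v \<bullet> b)\<^sup>2 / 2)))"
    by (intro prod.cong refl std_gaussian_1d)
  also have "\<dots> = of_real (sqrt (2 * pi) ^ DIM('a) * exp (- (norm v)\<^sup>2 / 2))"
    by (simp add: norm2 prod.distrib exp_sum[symmetric] sum_negf[symmetric] sum_divide_distrib flip: of_real_prod)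
  finally show "(LINT x|lborel. ?h x) = of_real (sqrt (2 * pi) ^ DIM('a) * exp (- (norm v)\<^sup>2 / 2))" .
qed

lemma lborel_affine_integral:
  fixes f :: "'a::euclidean_space \<Rightarrow> 'b::{banach, second_countable_topology}"
  assumes "c \<noteq> 0" and [measurable]: "f \<in> borel_measurable borel"
  shows "(LINT x|lborel. f x) = \<bar>c\<bar> ^ DIM('a) *\<^sub>R (LINT x|lborel. f (t + c *\<^sub>R x))"
    and "integrable lborel f \<longleftrightarrow> integrable lborel (\<lambda>x. f (t + c *\<^sub>R x))"
proof -
  have eq: "lborel = density (distr lborel borel (\<lambda>x::'a. t + c *\<^sub>R x)) (\<lambda>_. ennreal (\<bar>c\<bar> ^ DIM('a)))"
    using lborel_affine[OF assms(1), of t] by (simp add: ennreal_power)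
  show "(LINT x|lborel. f x) = \<bar>c\<bar> ^ DIM('a) *\<^sub>R (LINT x|lborel. f (t + c *\<^sub>R x))"
    by (subst eq, subst integral_density) (auto simp: integral_distr)
  show "integrable lborel f \<longleftrightarrow> integrable lborel (\<lambda>x. f (t + c *\<^sub>R x))"
    using assms(1) integrable_scaleR_right[of "inverse (\<bar>c\<bar> ^ DIM('a))" lborel "\<lambda>x. \<bar>c\<bar> ^ DIM('a) *\<^sub>R f (t + c *\<^sub>R x)"]
    by (subst eq, subst integrable_density) (auto simp: integrable_distr_eq)
qed

lemma gaussian_fourier:
  fixes v :: "'a::euclidean_space"
  assumes "0 < s"
  shows "integrable lborel (\<lambda>x. complex_of_real (exp (- (s * norm x)\<^sup>2 / 2)) * cis (v \<bullet> x))"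
    and "(LINT x|lborel. complex_of_real (exp (- (s * norm x)\<^sup>2 / 2)) * cis (v \<bullet> x))
      = of_real ((sqrt (2 * pi) / s) ^ DIM('a) * exp (- (norm v / s)\<^sup>2 / 2))"
proof -
  let ?h = "\<lambda>x::'a. complex_of_real (exp (- (norm x)\<^sup>2 / 2)) * cis ((v /\<^sub>R s) \<bullet> x)"
  have h: "?h \<in> borel_measurable borel"
    by (simp add: cis_conv_exp)
  have s: "s \<noteq> 0" using assms by simp
  have eq: "?h (0 + s *\<^sub>R x) = complex_of_real (exp (- (s * norm x)\<^sup>2 / 2)) * cis (v \<bullet> x)" for x
    using assms by (simp flip: mult.assoc)
  have *: "s ^ DIM('a) *\<^sub>R (LINT x|lborel. ?h (0 + s *\<^sub>R x)) = (LINT x|lborel. ?h x)"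
    using lborel_affine_integral(1)[OF s h, of 0] assms by (simp only: abs_of_pos)
  have "integrable lborel (\<lambda>x. ?h (0 + s *\<^sub>R x))"
    using lborel_affine_integral(2)[OF s h, of 0] std_gaussian(1)[of "v /\<^sub>R s"] by (simp only:)
  then show "integrable lborel (\<lambda>x. complex_of_real (exp (- (s * norm x)\<^sup>2 / 2)) * cis (v \<bullet> x))"
    unfolding eq .
  show "(LINT x|lborel. complex_of_real (exp (- (s * norm x)\<^sup>2 / 2)) * cis (v \<bullet> x))
      = of_real ((sqrt (2 * pi) / s) ^ DIM('a) * exp (- (norm v / s)\<^sup>2 / 2))"
    using * assms unfolding eq std_gaussian(2)
    by (simp add: scaleR_conv_of_real field_simps)
qed

text \<open>Fubini's theorem is applied to products of \<open>lebesgue\<close> with itself, so the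
  completed measure has to be sigma-finite in its own right.\<close>

lemma sigma_finite_completion:
  assumes "sigma_finite_measure M"
  shows "sigma_finite_measure (completion M)"
proof
  obtain A where A: "countable A" "A \<subseteq> sets M" "\<Union>A = space M" "\<forall>a\<in>A. emeasure M a \<noteq> \<infinity>"
    using sigma_finite_measure.sigma_finite_countable[OF assms] by blast
  then have "\<forall>a\<in>A. emeasure (completion M) a \<noteq> \<infinity>"
    by (auto simp: subset_eq)
  then show "\<exists>A. countable A \<and> A \<subseteq> sets (completion M) \<and> \<Union>A = space (completion M)
      \<and> (\<forall>a\<in>A. emeasure (completion M) a \<noteq> \<infinity>)"
    using A by (intro exI[of _ A]) (auto intro: sets_completionI_sets)
qed

interpretation lebesgue: sigma_finite_measure "lebesgue :: 'a::euclidean_space measure"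
  by (rule sigma_finite_completion) (rule sigma_finite_lborel)

interpretation lebesgue_pair: pair_sigma_finite "lebesgue :: 'a::euclidean_space measure" "lebesgue :: 'b::euclidean_space measure" ..

lemma cis_inner_measurable [measurable (raw)]:
  fixes f g :: "'b \<Rightarrow> 'a::euclidean_space"
  assumes [measurable]: "f \<in> borel_measurable M" "g \<in> borel_measurable M"
  shows "(\<lambda>x. cis (f x \<bullet> g x)) \<in> borel_measurable M" "(\<lambda>x. cis (- (f x \<bullet> g x))) \<in> borel_measurable M"
  unfolding cis_conv_exp by measurable

lemma measurable_lebesgue_fst [measurable]: "fst \<in> borel_measurable (lebesgue \<Otimes>\<^sub>M M)"
  by (rule measurable_compose[OF measurable_fst borel_measurable_lebesgue_ident])

lemma measurable_lebesgue_snd [measurable]: "snd \<in> borel_measurable (M \<Otimes>\<^sub>M lebesgue)"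
  by (rule measurable_compose[OF measurable_snd borel_measurable_lebesgue_ident])

section \<open>Fourier integrals of integrable functions\<close>

lemma integrable_cis_mult:
  fixes f :: "'n::finite cfun"
  assumes "integrable lebesgue f"
  shows "integrable lebesgue (\<lambda>x. cis (- (x \<bullet> \<xi>)) * f x)"
  using assms by (rule Bochner_Integration.integrable_bound) (use assms in \<open>auto simp: norm_mult\<close>)

lemma fourier_integral_measurable:
  fixes f :: "'n::finite cfun"
  assumes [measurable]: "f \<in> borel_measurable lebesgue"
  shows "fourier_integral f \<in> borel_measurable lebesgue"
  unfolding fourier_integral_def by measurable

lemma fourier_integral_bounded: "cmod (fourier_integral f \<xi>) \<le> (LINT x|lebesgue. cmod (f x))"
  unfolding fourier_integral_def
  by (rule order_trans[OF integral_norm_bound]) (simp add: norm_mult)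

lemma fourier_integral_lincomb:
  assumes "integrable lebesgue f" "integrable lebesgue g"
  shows "fourier_integral (\<lambda>x. a * f x + b * g x) = (\<lambda>\<xi>. a * fourier_integral f \<xi> + b * fourier_integral g \<xi>)"
proof
  fix \<xi>
  have "fourier_integral (\<lambda>x. a * f x + b * g x) \<xi>
     = (LINT x|lebesgue. a * (cis (- (x \<bullet> \<xi>)) * f x) + b * (cis (- (x \<bullet> \<xi>)) * g x))"
    unfolding fourier_integral_def by (simp add: algebra_simps)
  then show "fourier_integral (\<lambda>x. a * f x + b * g x) \<xi> = a * fourier_integral f \<xi> + b * fourier_integral g \<xi>"
    using integrable_cis_mult[OF assms(1), of \<xi>] integrable_cis_mult[OF assms(2), of \<xi>]
    by (simp add: fourier_integral_def)
qed

lemma integrable_fourier_mult: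
  fixes f g :: "'n::finite cfun"
  assumes f: "integrable lebesgue f" and g: "integrable lebesgue g"
  shows "integrable lebesgue (\<lambda>\<xi>. fourier_integral f \<xi> * g \<xi>)"
proof (rule Bochner_Integration.integrable_bound)
  show "integrable lebesgue (\<lambda>\<xi>. (LINT x|lebesgue. cmod (f x)) * cmod (g \<xi>))"
    using g by auto
  show "(\<lambda>\<xi>. fourier_integral f \<xi> * g \<xi>) \<in> borel_measurable lebesgue"
    using f g fourier_integral_measurable[of f] by auto
  show "AE \<xi> in lebesgue. norm (fourier_integral f \<xi> * g \<xi>) \<le> norm ((LINT x|lebesgue. cmod (f x)) * cmod (g \<xi>))"
    using fourier_integral_bounded[of f] by (auto simp: norm_mult intro!: mult_right_mono order_trans[OF _ abs_ge_self])
qed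

text \<open>Fubini together with the symmetry of the kernel in its two variables. This formula
  stands in for the adjoint of the transform, both in the Gaussian identity and in the proof of
  surjectivity.\<close>

lemma fourier_multiplication_formula:
  fixes f k :: "'n::finite cfun"
  assumes f: "integrable lebesgue f" and k: "integrable lebesgue k"
  shows "(LINT \<xi>|lebesgue. fourier_integral f \<xi> * k \<xi>) = (LINT x|lebesgue. f x * fourier_integral k x)"
proof -
  have [measurable]: "f \<in> borel_measurable lebesgue" "k \<in> borel_measurable lebesgue"
    using f k by auto
  have "integrable (lebesgue \<Otimes>\<^sub>M lebesgue) (\<lambda>(\<xi>, x). cis (- (x \<bullet> \<xi>)) * f x * k \<xi>)"
  proof (rule lebesgue_pair.Fubini_integrable)
    show "integrable lebesgue (\<lambda>\<xi>. LINT x|lebesgue. norm (case (\<xi>, x) of (\<xi>, x) \<Rightarrow> cis (- (x \<bullet> \<xi>)) * f x * k \<xi>))"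
      using integrable_mult_right[OF integrable_norm[OF k], of "LINT x|lebesgue. cmod (f x)"]
      by (simp add: norm_mult)
    show "AE \<xi> in lebesgue. integrable lebesgue (\<lambda>x. case (\<xi>, x) of (\<xi>, x) \<Rightarrow> cis (- (x \<bullet> \<xi>)) * f x * k \<xi>)"
      using integrable_mult_left[OF integrable_cis_mult[OF f]] by auto
  qed measurable
  from lebesgue_pair.Fubini_integral[OF this]
  have "(LINT x|lebesgue. LINT \<xi>|lebesgue. cis (- (x \<bullet> \<xi>)) * f x * k \<xi>)
      = (LINT \<xi>|lebesgue. LINT x|lebesgue. cis (- (x \<bullet> \<xi>)) * f x * k \<xi>)" .
  moreover have "(LINT x|lebesgue. cis (- (x \<bullet> \<xi>)) * f x * k \<xi>) = fourier_integral f \<xi> * k \<xi>" for \<xi>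
    unfolding fourier_integral_def by (rule integral_mult_left_zero)
  moreover have "(LINT \<xi>|lebesgue. cis (- (x \<bullet> \<xi>)) * f x * k \<xi>) = f x * fourier_integral k x" for x
    unfolding fourier_integral_def
    by (subst integral_mult_right_zero[symmetric]) (simp add: inner_commute mult_ac)
  ultimately show ?thesis by (simp only:)
qed

text \<open>The Gaussian weight makes every integral absolutely convergent; letting \<open>s\<close> tend to 0 gives Plancherel.\<close>
lemma fourier_gaussian_identity:
  fixes f g :: "'n::finite cfun"
  assumes f: "integrable lebesgue f" and g: "integrable lebesgue g" and s: "0 < s"
  shows "(LINT \<xi>|lebesgue. of_real (exp (- (s * norm \<xi>)\<^sup>2 / 2)) * (fourier_integral f \<xi> * cnj (fourier_integral g \<xi>)))
    = (LINT x|lebesgue. f x * cnj (LINT y|lebesgue.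
         of_real ((sqrt (2 * pi) / s) ^ CARD('n) * exp (- (norm (y - x) / s)\<^sup>2 / 2)) * g y))"
proof -
  define w where "w \<xi> = complex_of_real (exp (- (s * norm \<xi>)\<^sup>2 / 2))" for \<xi> :: "real^'n"
  have [measurable]: "w \<in> borel_measurable borel"
    unfolding w_def[abs_def] by measurable
  have wc: "integrable lebesgue (\<lambda>\<xi>. w \<xi> * cis (v \<bullet> \<xi>))" for v
    using gaussian_fourier(1)[OF s, of v] by (subst integrable_completion) (simp_all add: w_def cis_conv_exp)
  have wint: "integrable lebesgue w"
    using wc[of 0] by simp
  \<comment> \<open>Modulation by \<open>x\<close> becomes translation by \<open>x\<close>: the
    transform of the modulated weight is the Gaussian kernel centred at \<open>x\<close>.\<close>
  have wcis: "fourier_integral (\<lambda>\<xi>. w \<xi> * cis (x \<bullet> \<xi>)) y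
      = of_real ((sqrt (2 * pi) / s) ^ CARD('n) * exp (- (norm (y - x) / s)\<^sup>2 / 2))" for x y
  proof -
    have "fourier_integral (\<lambda>\<xi>. w \<xi> * cis (x \<bullet> \<xi>)) y = (LINT \<xi>|lebesgue. w \<xi> * cis ((x - y) \<bullet> \<xi>))"
      unfolding fourier_integral_def
      by (intro Bochner_Integration.integral_cong refl)
         (simp add: mult.left_commute cis_mult inner_diff_left inner_diff_right inner_commute)
    also have "\<dots> = (LINT \<xi>|lborel. w \<xi> * cis ((x - y) \<bullet> \<xi>))"
      by (rule integral_completion) (simp add: cis_conv_exp)
    also have "\<dots> = of_real ((sqrt (2 * pi) / s) ^ CARD('n) * exp (- (norm (y - x) / s)\<^sup>2 / 2))"
      unfolding w_def gaussian_fourier(2)[OF s] by (simp add: norm_minus_commute)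
    finally show ?thesis .
  qed
  \<comment> \<open>The multiplication formula is used twice: with \<open>f\<close> and
    \<open>k\<close> to reach the transform of \<open>k\<close>, and with \<open>g\<close> and the
    modulated weight to evaluate that transform as a Gaussian average of \<open>g\<close>.\<close>
  define k where "k \<xi> = w \<xi> * cnj (fourier_integral g \<xi>)" for \<xi>
  have kint: "integrable lebesgue k"
    using Bochner_Integration.integrable_cnj[OF integrable_fourier_mult[OF g wint]]
    by (simp add: k_def[abs_def] w_def mult.commute)
  have "fourier_integral k x = cnj (LINT y|lebesgue. of_real ((sqrt (2 * pi) / s) ^ CARD('n) * exp (- (norm (y - x) / s)\<^sup>2 / 2)) * g y)" for x
  proof -
    have "fourier_integral k x = cnj (LINT \<xi>|lebesgue. fourier_integral g \<xi> * (w \<xi> * cis (x \<bullet> \<xi>)))"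
      unfolding fourier_integral_def[of k] k_def Bochner_Integration.integral_cnj[symmetric]
      by (intro Bochner_Integration.integral_cong refl) (simp add: cis_cnj w_def inner_commute mult_ac)
    also have "(LINT \<xi>|lebesgue. fourier_integral g \<xi> * (w \<xi> * cis (x \<bullet> \<xi>)))
        = (LINT y|lebesgue. g y * fourier_integral (\<lambda>\<xi>. w \<xi> * cis (x \<bullet> \<xi>)) y)"
      by (rule fourier_multiplication_formula[OF g wc])
    finally show ?thesis unfolding wcis by (simp only: mult.commute[of "g _"])
  qed
  then have "(LINT \<xi>|lebesgue. fourier_integral f \<xi> * k \<xi>) = (LINT x|lebesgue. f x * cnj (LINT y|lebesgue.
         of_real ((sqrt (2 * pi) / s) ^ CARD('n) * exp (- (norm (y - x) / s)\<^sup>2 / 2)) * g y))"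
    by (simp only: fourier_multiplication_formula[OF f kint])
  then show ?thesis
    by (simp only: k_def w_def mult_ac)
qed

text \<open>The Bochner integral of a non-integrable function is 0, so the bound is unconditional.
  It lets the next estimate pass to nonnegative integrals without any integrability check.\<close>

lemma norm_integral_le_nn_integral:
  fixes f :: "'a \<Rightarrow> 'b::{banach, second_countable_topology}"
  shows "ennreal (norm (LINT x|M. f x)) \<le> (\<integral>\<^sup>+x. ennreal (norm (f x)) \<partial>M)"
  by (cases "integrable M f") (auto intro: integral_norm_bound_ennreal simp: not_integrable_integral_eq)

text \<open>Schur's test: the product of \<open>cmod (f x)\<close> and \<open>cmod (f y)\<close> is
  at most half the sum of their squares, and by the symmetry of the kernel both halves give the same
  integral. The mass of the kernel is \<open>(2 * pi) ^ CARD('n)\<close> for every \<open>s\<close>,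
  so the bound survives the limit \<open>s \<rightarrow> 0\<close>.\<close>

lemma gaussian_quadratic_form_bound:
  fixes f :: "'n::finite cfun"
  assumes f: "f \<in> L2" and s: "0 < s"
  defines "K \<equiv> \<lambda>z::real^'n. (sqrt (2 * pi) / s) ^ CARD('n) * exp (- (norm z / s)\<^sup>2 / 2)"
  shows "cmod (LINT x|lebesgue. f x * cnj (LINT y|lebesgue. of_real (K (y - x)) * f y))
    \<le> (2 * pi) ^ CARD('n) * (L2_norm f)\<^sup>2"
proof -
  let ?c = "(2 * pi) ^ CARD('n)"
  have [measurable]: "f \<in> borel_measurable lebesgue" "K \<in> borel_measurable borel"
    using f unfolding K_def by measurable
  have K0: "0 \<le> K z" for z using s by (simp add: K_def)
  have intK: "(\<integral>\<^sup>+y. ennreal (K (y - x)) \<partial>lebesgue) = ennreal ?c" for x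
  proof -
    have eq: "K (s *\<^sub>R y) = (sqrt (2 * pi) / s) ^ CARD('n) * exp (- (norm y)\<^sup>2 / 2)" for y
      using s by (simp add: K_def)
    have "has_bochner_integral lborel (\<lambda>y::real^'n. complex_of_real (exp (- (norm y)\<^sup>2 / 2))) (of_real (sqrt (2 * pi) ^ CARD('n)))"
      using std_gaussian[of "0::real^'n"] by (simp add: has_bochner_integral_iff)
    from has_bochner_integral_Re[OF this]
    have G: "integrable lborel (\<lambda>y::real^'n. exp (- (norm y)\<^sup>2 / 2))"
        "(LINT y|(lborel::(real^'n) measure). exp (- (norm y)\<^sup>2 / 2)) = sqrt (2 * pi) ^ CARD('n)"
      by (auto simp: has_bochner_integral_iff simp flip: of_real_power)
    have int: "integrable lborel (\<lambda>y. K (y - x))"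
      using lborel_affine_integral(2)[of s "\<lambda>y. K (y - x)" x] s G(1) by (simp add: eq)
    have "(\<integral>\<^sup>+y. ennreal (K (y - x)) \<partial>lebesgue) = (\<integral>\<^sup>+y. ennreal (K (y - x)) \<partial>lborel)"
      by (rule nn_integral_completion)
    also have "\<dots> = ennreal (LINT y|lborel. K (y - x))"
      by (rule nn_integral_eq_integral[OF int]) (simp add: K0)
    also have "(LINT y|lborel. K (y - x)) = ?c"
    proof -
      have "(LINT y|lborel. K (y - x)) = s ^ CARD('n) * (LINT y|lborel. K (s *\<^sub>R y))"
        using lborel_affine_integral(1)[of s "\<lambda>y. K (y - x)" x] s by simp
      also have "\<dots> = s ^ CARD('n) * ((sqrt (2 * pi) / s) ^ CARD('n) * sqrt (2 * pi) ^ CARD('n))"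
        unfolding eq integral_mult_right_zero G(2) ..
      also have "\<dots> = (s * (sqrt (2 * pi) / s) * sqrt (2 * pi)) ^ CARD('n)"
        by (simp only: power_mult_distrib mult.assoc)
      also have "s * (sqrt (2 * pi) / s) * sqrt (2 * pi) = 2 * pi"
        using s by simp
      finally show ?thesis .
    qed
    finally show ?thesis .
  qed
  have symK: "K (y - x) = K (x - y)" for x y
    by (simp add: K_def norm_minus_commute)
  have "ennreal (cmod (LINT x|lebesgue. f x * cnj (LINT y|lebesgue. of_real (K (y - x)) * f y)))
      \<le> (\<integral>\<^sup>+x. ennreal (cmod (f x * cnj (LINT y|lebesgue. of_real (K (y - x)) * f y))) \<partial>lebesgue)"
    by (rule norm_integral_le_nn_integral)
  also have "\<dots> \<le> (\<integral>\<^sup>+x. \<integral>\<^sup>+y. ennreal (cmod (f x) * cmod (f y) * K (y - x)) \<partial>lebesgue \<partial>lebesgue)"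
  proof (rule nn_integral_mono)
    fix x
    have "ennreal (cmod (f x * cnj (LINT y|lebesgue. of_real (K (y - x)) * f y)))
        = ennreal (cmod (f x)) * ennreal (cmod (LINT y|lebesgue. of_real (K (y - x)) * f y))"
      by (simp add: norm_mult ennreal_mult)
    also have "\<dots> \<le> ennreal (cmod (f x)) * (\<integral>\<^sup>+y. ennreal (cmod (of_real (K (y - x)) * f y)) \<partial>lebesgue)"
      by (intro mult_left_mono norm_integral_le_nn_integral) simp
    also have "\<dots> = (\<integral>\<^sup>+y. ennreal (cmod (f x) * cmod (f y) * K (y - x)) \<partial>lebesgue)"
      by (subst nn_integral_cmult[symmetric])
         (auto simp: norm_mult K0 ennreal_mult[symmetric] mult_ac intro!: nn_integral_cong)
    finally show "ennreal (cmod (f x * cnj (LINT y|lebesgue. of_real (K (y - x)) * f y)))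
        \<le> (\<integral>\<^sup>+y. ennreal (cmod (f x) * cmod (f y) * K (y - x)) \<partial>lebesgue)" .
  qed
  also have "\<dots> \<le> (\<integral>\<^sup>+x. \<integral>\<^sup>+y. ennreal ((cmod (f x))\<^sup>2 / 2 * K (y - x)) + ennreal ((cmod (f y))\<^sup>2 / 2 * K (y - x)) \<partial>lebesgue \<partial>lebesgue)"
  proof (intro nn_integral_mono)
    fix x y
    have "cmod (f x) * cmod (f y) * K (y - x) \<le> ((cmod (f x))\<^sup>2 / 2 + (cmod (f y))\<^sup>2 / 2) * K (y - x)"
      using sum_squares_bound[of "cmod (f x)" "cmod (f y)"] by (intro mult_right_mono K0) simp
    then show "ennreal (cmod (f x) * cmod (f y) * K (y - x))
        \<le> ennreal ((cmod (f x))\<^sup>2 / 2 * K (y - x)) + ennreal ((cmod (f y))\<^sup>2 / 2 * K (y - x))"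
      using K0[of "y - x"] by (simp add: distrib_right flip: ennreal_plus)
  qed
  also have "\<dots> = (\<integral>\<^sup>+x. \<integral>\<^sup>+y. ennreal ((cmod (f x))\<^sup>2 / 2 * K (y - x)) \<partial>lebesgue \<partial>lebesgue)
      + (\<integral>\<^sup>+x. \<integral>\<^sup>+y. ennreal ((cmod (f y))\<^sup>2 / 2 * K (y - x)) \<partial>lebesgue \<partial>lebesgue)"
    by (simp add: nn_integral_add)
  also have "(\<integral>\<^sup>+x. \<integral>\<^sup>+y. ennreal ((cmod (f y))\<^sup>2 / 2 * K (y - x)) \<partial>lebesgue \<partial>lebesgue)
      = (\<integral>\<^sup>+y. \<integral>\<^sup>+x. ennreal ((cmod (f y))\<^sup>2 / 2 * K (y - x)) \<partial>lebesgue \<partial>lebesgue)"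
    by (rule lebesgue_pair.Fubini') simp
  also have "\<dots> = (\<integral>\<^sup>+x. \<integral>\<^sup>+y. ennreal ((cmod (f x))\<^sup>2 / 2 * K (y - x)) \<partial>lebesgue \<partial>lebesgue)"
    by (subst symK) simp
  also have "(\<integral>\<^sup>+x. \<integral>\<^sup>+y. ennreal ((cmod (f x))\<^sup>2 / 2 * K (y - x)) \<partial>lebesgue \<partial>lebesgue)
      = (\<integral>\<^sup>+x. ennreal ((cmod (f x))\<^sup>2) * ennreal (?c / 2) \<partial>lebesgue)"
  proof (rule nn_integral_cong)
    fix x
    have "(\<integral>\<^sup>+y. ennreal ((cmod (f x))\<^sup>2 / 2 * K (y - x)) \<partial>lebesgue)
        = (\<integral>\<^sup>+y. ennreal ((cmod (f x))\<^sup>2 / 2) * ennreal (K (y - x)) \<partial>lebesgue)"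
      by (intro nn_integral_cong ennreal_mult) (auto simp: K0)
    also have "\<dots> = ennreal ((cmod (f x))\<^sup>2 / 2) * ennreal ?c"
      by (simp add: nn_integral_cmult intK)
    also have "\<dots> = ennreal ((cmod (f x))\<^sup>2) * ennreal (?c / 2)"
      by (simp flip: ennreal_mult)
    finally show "(\<integral>\<^sup>+y. ennreal ((cmod (f x))\<^sup>2 / 2 * K (y - x)) \<partial>lebesgue) = ennreal ((cmod (f x))\<^sup>2) * ennreal (?c / 2)" .
  qed
  also have "\<dots> = ennreal ((L2_norm f)\<^sup>2) * ennreal (?c / 2)"
    by (simp add: nn_integral_multc nn_integral_L2_norm[OF f])
  also have "\<dots> + \<dots> = ennreal (?c * (L2_norm f)\<^sup>2)"
    by (simp flip: ennreal_mult ennreal_plus)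
  finally show ?thesis
    by (subst (asm) ennreal_le_iff) auto
qed

section \<open>The Plancherel theorem\<close>

text \<open>The diagonal case of the Gaussian identity is bounded uniformly in \<open>s\<close>, and
  Fatou's lemma removes the weight. This inequality has to precede the Plancherel identity: only
  once the transforms lie in \<open>L2\<close> is their product an integrable majorant.\<close>

lemma fourier_L2_bound:
  fixes f :: "'n::finite cfun"
  assumes f: "f \<in> L2" "integrable lebesgue f"
  shows "fourier_integral f \<in> L2"
    and "L2_norm (fourier_integral f) \<le> sqrt ((2 * pi) ^ CARD('n)) * L2_norm f"
proof -
  let ?c = "(2 * pi) ^ CARD('n)"
  let ?F = "fourier_integral f"
  have [measurable]: "?F \<in> borel_measurable lebesgue"
    using f(2) by (intro fourier_integral_measurable) auto
  define w where "w n \<xi> = exp (- (inverse (real (Suc n)) * norm \<xi>)\<^sup>2 / 2)" for n and \<xi> :: "real^'n"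
  have [measurable]: "w n \<in> borel_measurable lebesgue" for n
    unfolding w_def by measurable
  have w_lim: "(\<lambda>n. w n \<xi>) \<longlonglongrightarrow> 1" for \<xi>
  proof -
    have "(\<lambda>n. w n \<xi>) \<longlonglongrightarrow> exp (- (0 * norm \<xi>)\<^sup>2 / 2)"
      unfolding w_def by (intro tendsto_intros LIMSEQ_inverse_real_of_nat) auto
    then show ?thesis by simp
  qed
  have bound: "(\<integral>\<^sup>+\<xi>. ennreal (w n \<xi> * (cmod (?F \<xi>))\<^sup>2) \<partial>lebesgue) \<le> ennreal (?c * (L2_norm f)\<^sup>2)" for n
  proof -
    define s where "s = inverse (real (Suc n))"
    have s: "0 < s" by (simp add: s_def)
    have eq: "complex_of_real (exp (- (s * norm \<xi>)\<^sup>2 / 2)) * (?F \<xi> * cnj (?F \<xi>)) = of_real (w n \<xi> * (cmod (?F \<xi>))\<^sup>2)" for \<xi>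
      by (simp only: of_real_mult complex_norm_square w_def s_def)
    have wint: "integrable lebesgue (\<lambda>\<xi>. complex_of_real (w n \<xi>))"
      using gaussian_fourier(1)[OF s, of "0::real^'n"]
      by (subst integrable_completion) (simp_all add: w_def s_def)
    have int: "integrable lebesgue (\<lambda>\<xi>. w n \<xi> * (cmod (?F \<xi>))\<^sup>2)"
    proof (rule Bochner_Integration.integrable_bound)
      show "integrable lebesgue (\<lambda>\<xi>. (LINT x|lebesgue. cmod (f x))\<^sup>2 * cmod (complex_of_real (w n \<xi>)))"
        using wint by (intro integrable_mult_right integrable_norm)
      show "AE \<xi> in lebesgue. norm (w n \<xi> * (cmod (?F \<xi>))\<^sup>2) \<le> norm ((LINT x|lebesgue. cmod (f x))\<^sup>2 * cmod (complex_of_real (w n \<xi>)))"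
        using fourier_integral_bounded[of f]
        by (auto simp: abs_mult mult.commute w_def intro!: mult_right_mono power_mono)
    qed measurable
    have "(\<integral>\<^sup>+\<xi>. ennreal (w n \<xi> * (cmod (?F \<xi>))\<^sup>2) \<partial>lebesgue) = ennreal (LINT \<xi>|lebesgue. w n \<xi> * (cmod (?F \<xi>))\<^sup>2)"
      by (rule nn_integral_eq_integral[OF int]) (simp add: w_def)
    also have "(LINT \<xi>|lebesgue. w n \<xi> * (cmod (?F \<xi>))\<^sup>2) \<le> cmod (of_real (LINT \<xi>|lebesgue. w n \<xi> * (cmod (?F \<xi>))\<^sup>2))"
      by simp
    also have "\<dots> = cmod (LINT \<xi>|lebesgue. complex_of_real (exp (- (s * norm \<xi>)\<^sup>2 / 2)) * (?F \<xi> * cnj (?F \<xi>)))"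
      unfolding eq integral_complex_of_real ..
    also have "\<dots> \<le> ?c * (L2_norm f)\<^sup>2"
      unfolding fourier_gaussian_identity[OF f(2) f(2) s]
      by (rule gaussian_quadratic_form_bound[OF f(1) s])
    finally show ?thesis by (simp add: ennreal_leI)
  qed
  have "(\<integral>\<^sup>+\<xi>. ennreal ((cmod (?F \<xi>))\<^sup>2) \<partial>lebesgue)
      = (\<integral>\<^sup>+\<xi>. liminf (\<lambda>n. ennreal (w n \<xi> * (cmod (?F \<xi>))\<^sup>2)) \<partial>lebesgue)"
  proof (rule nn_integral_cong)
    fix \<xi>
    have "(\<lambda>n. ennreal (w n \<xi> * (cmod (?F \<xi>))\<^sup>2)) \<longlonglongrightarrow> ennreal (1 * (cmod (?F \<xi>))\<^sup>2)"
      by (intro tendsto_intros w_lim)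
    then show "ennreal ((cmod (?F \<xi>))\<^sup>2) = liminf (\<lambda>n. ennreal (w n \<xi> * (cmod (?F \<xi>))\<^sup>2))"
      using lim_imp_Liminf[OF trivial_limit_sequentially] by fastforce
  qed
  also have "\<dots> \<le> liminf (\<lambda>n. \<integral>\<^sup>+\<xi>. ennreal (w n \<xi> * (cmod (?F \<xi>))\<^sup>2) \<partial>lebesgue)"
    by (rule nn_integral_liminf) simp
  also have "\<dots> \<le> ennreal (?c * (L2_norm f)\<^sup>2)"
    by (rule Liminf_le) (use bound in auto)
  finally have le: "(\<integral>\<^sup>+\<xi>. ennreal ((cmod (?F \<xi>))\<^sup>2) \<partial>lebesgue) \<le> ennreal ((sqrt ?c * L2_norm f)\<^sup>2)"
    by (simp add: power_mult_distrib)
  show "?F \<in> L2" "L2_norm ?F \<le> sqrt ?c * L2_norm f"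
    using L2_nn_integralI[OF _ _ le] by auto
qed

text \<open>For bounded continuous \<open>g\<close> the Gaussian averages of \<open>g\<close> are
  uniformly bounded and converge at every point, so dominated convergence applies to both sides of
  the Gaussian identity.\<close>

lemma Plancherel_continuous:
  fixes f g :: "'n::finite cfun"
  assumes f: "f \<in> L2" "integrable lebesgue f" and g: "g \<in> L2" "integrable lebesgue g"
    and cont: "continuous_on UNIV g" and bdd: "\<And>x. cmod (g x) \<le> B"
  shows "L2_inner (fourier_integral f) (fourier_integral g) = of_real ((2 * pi) ^ CARD('n)) * L2_inner f g"
proof -
  let ?c = "(2 * pi) ^ CARD('n)"
  let ?F = "fourier_integral f" and ?G = "fourier_integral g"
  have [measurable]: "?F \<in> borel_measurable lebesgue" "?G \<in> borel_measurable lebesgue"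
      "f \<in> borel_measurable lebesgue" "g \<in> borel_measurable borel"
    using f(2) g(2) borel_measurable_continuous_onI[OF cont] by (auto intro: fourier_integral_measurable)
  define s where "s n = inverse (real (Suc n))" for n
  have s: "0 < s n" for n by (simp add: s_def)
  have s_lim: "s \<longlonglongrightarrow> 0" unfolding s_def[abs_def] by (rule LIMSEQ_inverse_real_of_nat)
  define h where "h n x = (LINT y|lebesgue. complex_of_real ((sqrt (2 * pi) / s n) ^ CARD('n)
      * exp (- (norm (y - x) / s n)\<^sup>2 / 2)) * g y)" for n x
  have lhs: "(\<lambda>n. LINT \<xi>|lebesgue. of_real (exp (- (s n * norm \<xi>)\<^sup>2 / 2)) * (?F \<xi> * cnj (?G \<xi>))) \<longlonglongrightarrow> L2_inner ?F ?G"
    unfolding L2_inner_def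
  proof (rule integral_dominated_convergence)
    show "integrable lebesgue (\<lambda>\<xi>. cmod (?F \<xi> * cnj (?G \<xi>)))"
      by (intro integrable_norm L2_integrable_inner fourier_L2_bound f g)
    show "AE \<xi> in lebesgue. (\<lambda>n. of_real (exp (- (s n * norm \<xi>)\<^sup>2 / 2)) * (?F \<xi> * cnj (?G \<xi>))) \<longlonglongrightarrow> ?F \<xi> * cnj (?G \<xi>)"
    proof (rule AE_I2)
      fix \<xi> :: "real^'n"
      have "(\<lambda>n. complex_of_real (exp (- (s n * norm \<xi>)\<^sup>2 / 2)) * (?F \<xi> * cnj (?G \<xi>)))
          \<longlonglongrightarrow> of_real (exp (- (0 * norm \<xi>)\<^sup>2 / 2)) * (?F \<xi> * cnj (?G \<xi>))"
        by (intro tendsto_intros s_lim) auto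
      then show "(\<lambda>n. complex_of_real (exp (- (s n * norm \<xi>)\<^sup>2 / 2)) * (?F \<xi> * cnj (?G \<xi>))) \<longlonglongrightarrow> ?F \<xi> * cnj (?G \<xi>)"
        by simp
    qed
    show "AE \<xi> in lebesgue. norm (of_real (exp (- (s n * norm \<xi>)\<^sup>2 / 2)) * (?F \<xi> * cnj (?G \<xi>))) \<le> cmod (?F \<xi> * cnj (?G \<xi>))" for n
      by (intro AE_I2) (subst norm_mult, rule mult_left_le_one_le, auto)
  qed measurable
  have G: "has_bochner_integral lborel (\<lambda>y::real^'n. complex_of_real (exp (- (norm y)\<^sup>2 / 2))) (of_real (sqrt (2 * pi) ^ CARD('n)))"
    using std_gaussian[of "0::real^'n"] by (simp add: has_bochner_integral_iff)
  \<comment> \<open>The substitution \<open>y = x + s n *\<^sub>R z\<close> moves the parameter from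
    the kernel into the argument of \<open>g\<close>; the Jacobian cancels the power of
    \<open>s n\<close> in the prefactor.\<close>
  have h_eq: "h n x = of_real (sqrt (2 * pi) ^ CARD('n))
      * (LINT y|lborel. complex_of_real (exp (- (norm y)\<^sup>2 / 2)) * g (x + s n *\<^sub>R y))" for n x
  proof -
    let ?k = "\<lambda>y. complex_of_real ((sqrt (2 * pi) / s n) ^ CARD('n) * exp (- (norm (y - x) / s n)\<^sup>2 / 2)) * g y"
    have "h n x = (LINT y|lborel. ?k y)"
    proof -
      have "?k \<in> borel_measurable borel" by measurable
      then show ?thesis
        unfolding h_def by (intro integral_completion) simp
    qed
    also have "\<dots> = \<bar>s n\<bar> ^ CARD('n) *\<^sub>R (LINT y|lborel. ?k (x + s n *\<^sub>R y))"
      using lborel_affine_integral(1)[of "s n" ?k x] s[of n] by simp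
    also have "\<dots> = (LINT y|lborel. \<bar>s n\<bar> ^ CARD('n) *\<^sub>R ?k (x + s n *\<^sub>R y))"
      by (rule integral_scaleR_right[symmetric])
    also have "\<dots> = (LINT y|lborel. of_real (sqrt (2 * pi) ^ CARD('n)) * (complex_of_real (exp (- (norm y)\<^sup>2 / 2)) * g (x + s n *\<^sub>R y)))"
      using s[of n] by (intro Bochner_Integration.integral_cong refl) (simp add: scaleR_conv_of_real[where 'a=complex] power_divide)
    finally show ?thesis
      by (simp only: integral_mult_right_zero)
  qed
  have h_bdd: "cmod (h n x) \<le> ?c * B" for n x
  proof -
    have "cmod (LINT y|lborel. complex_of_real (exp (- (norm y)\<^sup>2 / 2)) * g (x + s n *\<^sub>R y))
        \<le> (LINT y|(lborel :: (real^'n) measure). B * exp (- (norm y)\<^sup>2 / 2))"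
    proof (rule Bochner_Integration.integral_norm_bound_integral)
      show int: "integrable lborel (\<lambda>y::real^'n. B * exp (- (norm y)\<^sup>2 / 2))"
        using integrable_norm[OF integrable.intros[OF G]] by simp
      show *: "norm (complex_of_real (exp (- (norm y)\<^sup>2 / 2)) * g (x + s n *\<^sub>R y)) \<le> B * exp (- (norm y)\<^sup>2 / 2)" for y
        using mult_left_mono[OF bdd, of "exp (- (norm y)\<^sup>2 / 2)"] by (simp add: norm_mult mult.commute)
      show "integrable lborel (\<lambda>y. complex_of_real (exp (- (norm y)\<^sup>2 / 2)) * g (x + s n *\<^sub>R y))"
        by (rule Bochner_Integration.integrable_bound[OF int]) (use * in \<open>auto intro: order_trans[OF _ abs_ge_self]\<close>)
    qed
    also have "\<dots> = B * sqrt (2 * pi) ^ CARD('n)"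
      using has_bochner_integral_Re[OF G] by (simp add: has_bochner_integral_iff flip: of_real_power)
    finally have le: "cmod (LINT y|lborel. complex_of_real (exp (- (norm y)\<^sup>2 / 2)) * g (x + s n *\<^sub>R y)) \<le> B * sqrt (2 * pi) ^ CARD('n)" .
    have "cmod (h n x) \<le> sqrt (2 * pi) ^ CARD('n) * (B * sqrt (2 * pi) ^ CARD('n))"
      unfolding h_eq by (subst norm_mult) (use le in \<open>simp add: norm_power mult_left_mono\<close>)
    also have "\<dots> = (sqrt (2 * pi) * sqrt (2 * pi)) ^ CARD('n) * B"
      by (simp only: power_mult_distrib mult_ac)
    finally show ?thesis by simp
  qed
  have h_lim: "(\<lambda>n. h n x) \<longlonglongrightarrow> of_real ?c * g x" for x
  proof -
    have "(\<lambda>n. LINT y|lborel. complex_of_real (exp (- (norm y)\<^sup>2 / 2)) * g (x + s n *\<^sub>R y))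
        \<longlonglongrightarrow> (LINT y|lborel. complex_of_real (exp (- (norm (y::real^'n))\<^sup>2 / 2)) * g x)"
    proof (rule integral_dominated_convergence)
      show "integrable lborel (\<lambda>y::real^'n. B * exp (- (norm y)\<^sup>2 / 2))"
        using integrable_norm[OF integrable.intros[OF G]] by simp
      show "AE y in lborel. norm (complex_of_real (exp (- (norm y)\<^sup>2 / 2)) * g (x + s n *\<^sub>R y)) \<le> B * exp (- (norm y)\<^sup>2 / 2)" for n
        using mult_left_mono[OF bdd, of "exp (- (norm y)\<^sup>2 / 2)" for y :: "real^'n"] by (simp add: norm_mult mult.commute)
      show "AE y in lborel. (\<lambda>n. complex_of_real (exp (- (norm y)\<^sup>2 / 2)) * g (x + s n *\<^sub>R y))
          \<longlonglongrightarrow> complex_of_real (exp (- (norm y)\<^sup>2 / 2)) * g x"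
      proof (intro AE_I2 tendsto_intros)
        fix y :: "real^'n"
        have "(\<lambda>n. x + s n *\<^sub>R y) \<longlonglongrightarrow> x + 0 *\<^sub>R y"
          by (intro tendsto_intros s_lim)
        then show "(\<lambda>n. g (x + s n *\<^sub>R y)) \<longlonglongrightarrow> g x"
          using continuous_on_tendsto_compose[OF cont] by force
      qed
      have "(\<lambda>y. complex_of_real (exp (- (norm y)\<^sup>2 / 2)) * g (x + s n *\<^sub>R y)) \<in> borel_measurable borel" for n
        by measurable
      then show "(\<lambda>y. complex_of_real (exp (- (norm y)\<^sup>2 / 2)) * g (x + s n *\<^sub>R y)) \<in> borel_measurable lborel" for n
        by simp
    qed simp
    then have "(\<lambda>n. h n x) \<longlonglongrightarrow> of_real (sqrt (2 * pi) ^ CARD('n))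
        * (LINT y|lborel. complex_of_real (exp (- (norm (y::real^'n))\<^sup>2 / 2)) * g x)"
      unfolding h_eq by (rule tendsto_mult_left)
    also have "(LINT y|lborel. complex_of_real (exp (- (norm (y::real^'n))\<^sup>2 / 2)) * g x)
        = of_real (sqrt (2 * pi) ^ CARD('n)) * g x"
      using has_bochner_integral_integral_eq[OF G] by (simp only: integral_mult_left_zero)
    also have "complex_of_real (sqrt (2 * pi) ^ CARD('n)) * (of_real (sqrt (2 * pi) ^ CARD('n)) * g x)
        = of_real ((sqrt (2 * pi) * sqrt (2 * pi)) ^ CARD('n)) * g x"
      by (simp only: power_mult_distrib of_real_mult mult.assoc)
    finally show ?thesis by simp
  qed
  have "(\<lambda>n. LINT x|lebesgue. f x * cnj (h n x)) \<longlonglongrightarrow> (LINT x|lebesgue. f x * cnj (of_real ?c * g x))"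
  proof (rule integral_dominated_convergence)
    show "integrable lebesgue (\<lambda>x. ?c * B * cmod (f x))"
      using f(2) by auto
    show "AE x in lebesgue. (\<lambda>n. f x * cnj (h n x)) \<longlonglongrightarrow> f x * cnj (of_real ?c * g x)"
      by (intro AE_I2 tendsto_intros h_lim)
    show "AE x in lebesgue. norm (f x * cnj (h n x)) \<le> ?c * B * cmod (f x)" for n
      by (intro AE_I2, subst norm_mult, subst mult.commute) (simp only: complex_mod_cnj mult_right_mono[OF h_bdd] norm_ge_zero)
    show "(\<lambda>x. f x * cnj (h n x)) \<in> borel_measurable lebesgue" for n
      unfolding h_def by measurable
  qed (auto simp: measurable_completion)
  moreover have "(LINT x|lebesgue. f x * cnj (of_real ?c * g x)) = of_real ?c * L2_inner f g"
    unfolding L2_inner_def by (subst integral_mult_right_zero[symmetric]) (simp add: mult_ac)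
  ultimately have "(\<lambda>n. LINT \<xi>|lebesgue. of_real (exp (- (s n * norm \<xi>)\<^sup>2 / 2)) * (?F \<xi> * cnj (?G \<xi>)))
      \<longlonglongrightarrow> of_real ?c * L2_inner f g"
    unfolding fourier_gaussian_identity[OF f(2) g(2) s] h_def by simp
  from LIMSEQ_unique[OF lhs this] show ?thesis .
qed

lemma L2_tendsto_cutoff:
  fixes f :: "'n::finite cfun"
  assumes "f \<in> L2"
  shows "L2_tendsto (\<lambda>n x. if norm x \<le> real n then f x else 0) f"
proof (rule L2_tendsto_truncate[OF assms])
  fix x :: "real^'n"
  obtain m where "norm x \<le> real m"
    using real_arch_simple by blast
  then show "\<forall>\<^sub>F n in sequentially. norm x \<le> real n"
    by (intro eventually_sequentiallyI[of m]) auto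
qed measurable

lemma L2_tendsto_fourier:
  fixes f :: "'n::finite cfun"
  assumes lim: "L2_tendsto \<phi> f" and \<phi>: "\<And>n. integrable lebesgue (\<phi> n)" and f: "integrable lebesgue f"
  shows "L2_tendsto (\<lambda>n. fourier_integral (\<phi> n)) (fourier_integral f)"
  unfolding L2_tendsto_def
proof (intro conjI allI)
  note L = L2_tendstoD[OF lim]
  show "fourier_integral (\<phi> n) \<in> L2" for n by (intro fourier_L2_bound L \<phi>)
  show "fourier_integral f \<in> L2" by (intro fourier_L2_bound L f)
  have le: "L2_norm (\<lambda>x. fourier_integral (\<phi> n) x - fourier_integral f x)
      \<le> sqrt ((2 * pi) ^ CARD('n)) * L2_norm (\<lambda>x. \<phi> n x - f x)" for n
    using fourier_L2_bound(2)[OF L2_diff[OF L(1,2)] Bochner_Integration.integrable_diff[OF \<phi> f], of n]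
      fourier_integral_lincomb[OF \<phi> f, of 1 n "-1"] by simp
  show "(\<lambda>n. L2_norm (\<lambda>x. fourier_integral (\<phi> n) x - fourier_integral f x)) \<longlonglongrightarrow> 0"
  proof (rule Lim_null_comparison[OF always_eventually tendsto_mult_right_zero[OF L(3)]], rule allI)
    show "norm (L2_norm (\<lambda>x. fourier_integral (\<phi> n) x - fourier_integral f x))
        \<le> sqrt ((2 * pi) ^ CARD('n)) * L2_norm (\<lambda>x. \<phi> n x - f x)" for n
      using le by (simp only: real_norm_def abs_of_nonneg L2_norm_nonneg)
  qed
qed

text \<open>By \<open>fourier_L2_bound\<close> both sides are continuous in \<open>g\<close> for the
  \<open>L2\<close> norm. Continuous approximants of bounded support are integrable and bounded, so
  the preceding lemma covers them.\<close>

theorem Plancherel_L1_L2: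
  fixes f g :: "'n::finite cfun"
  assumes f: "f \<in> L2" "integrable lebesgue f" and g: "g \<in> L2" "integrable lebesgue g"
  shows "L2_inner (fourier_integral f) (fourier_integral g) = of_real ((2 * pi) ^ CARD('n)) * L2_inner f g"
proof -
  have "\<exists>h R. continuous_on UNIV h \<and> (\<forall>x. norm x > R \<longrightarrow> h x = 0) \<and> h \<in> L2
      \<and> L2_norm (\<lambda>x. g x - h x) < inverse (real (Suc n))" for n
    by (rule L2_dense_continuous[OF g(1)]) simp
  then obtain h R where h: "\<And>n. continuous_on UNIV (h n)" "\<And>n x. norm x > R n \<Longrightarrow> h n x = 0"
      "\<And>n. h n \<in> L2" "\<And>n. L2_norm (\<lambda>x. g x - h n x) < inverse (real (Suc n))"
    by metis
  have h_int: "integrable lebesgue (h n)" for n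
  proof -
    have "(\<lambda>x. if norm x \<le> R n then h n x else 0) = h n"
      using h(2)[of n] by (auto simp: fun_eq_iff not_le)
    then show ?thesis
      using L2_cutoff_integrable[OF h(3), of "R n" n] by simp
  qed
  have h_bdd: "\<exists>B. \<forall>x. cmod (h n x) \<le> B" for n
  proof -
    have "bounded (h n ` cball 0 (R n))"
      by (intro compact_imp_bounded compact_continuous_image continuous_on_subset[OF h(1)]) auto
    then obtain B where B: "\<And>x. norm x \<le> R n \<Longrightarrow> cmod (h n x) \<le> B"
      unfolding bounded_iff by (metis imageI mem_cball_0)
    have "cmod (h n x) \<le> max B 0" for x
      using B[of x] h(2)[of n x] by (cases "norm x \<le> R n") auto
    then show ?thesis by blast
  qed
  have L: "L2_tendsto h g"
    unfolding L2_tendsto_def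
  proof (intro conjI allI h g)
    show "(\<lambda>n. L2_norm (\<lambda>x. h n x - g x)) \<longlonglongrightarrow> 0"
    proof (rule Lim_null_comparison[OF _ LIMSEQ_inverse_real_of_nat])
      show "\<forall>\<^sub>F n in sequentially. norm (L2_norm (\<lambda>x. h n x - g x)) \<le> inverse (real (Suc n))"
        using h(4) L2_norm_minus_commute[of "h _" g] by (simp add: less_imp_le)
    qed
  qed
  have "L2_inner (fourier_integral f) (fourier_integral (h n)) = of_real ((2 * pi) ^ CARD('n)) * L2_inner f (h n)" for n
    using h_bdd[of n] Plancherel_continuous[OF f h(3) h_int h(1)] by blast
  moreover have "(\<lambda>n. L2_inner (fourier_integral f) (fourier_integral (h n))) \<longlonglongrightarrow> L2_inner (fourier_integral f) (fourier_integral g)"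
    by (intro L2_tendsto_inner L2_tendsto_const fourier_L2_bound f L2_tendsto_fourier L h_int g)
  moreover have "(\<lambda>n. of_real ((2 * pi) ^ CARD('n)) * L2_inner f (h n)) \<longlonglongrightarrow> of_real ((2 * pi) ^ CARD('n)) * L2_inner f g"
    by (intro tendsto_mult_left L2_tendsto_inner L2_tendsto_const f L)
  ultimately show ?thesis
    by (simp add: LIMSEQ_unique)
qed

section \<open>The Fourier transform on \<open>L2\<close>: isometry, closed graph,
  surjectivity\<close>

lemma has_fourier_L2:
  assumes "has_fourier f F"
  shows "f \<in> L2" "F \<in> L2"
  using assms by (auto simp: has_fourier_def L2_tendsto_def)

lemma has_fourier_fourier_integral:
  assumes "f \<in> L2" "integrable lebesgue f"
  shows "has_fourier f (fourier_integral f)"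
  unfolding has_fourier_def
  by (rule exI[of _ "\<lambda>_. f"]) (intro conjI allI L2_tendsto_const fourier_L2_bound assms)

lemma Plancherel:
  fixes f g :: "'n::finite cfun"
  assumes "has_fourier f F" "has_fourier g G"
  shows "L2_inner F G = of_real ((2 * pi) ^ CARD('n)) * L2_inner f g"
proof -
  from assms obtain \<phi> \<psi> where \<phi>: "\<And>n. integrable lebesgue (\<phi> n)" "L2_tendsto \<phi> f" "L2_tendsto (\<lambda>n. fourier_integral (\<phi> n)) F"
    and \<psi>: "\<And>n. integrable lebesgue (\<psi> n)" "L2_tendsto \<psi> g" "L2_tendsto (\<lambda>n. fourier_integral (\<psi> n)) G"
    unfolding has_fourier_def by blast
  have eq: "L2_inner (fourier_integral (\<phi> n)) (fourier_integral (\<psi> n)) = of_real ((2 * pi) ^ CARD('n)) * L2_inner (\<phi> n) (\<psi> n)" for n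
    by (intro Plancherel_L1_L2 \<phi> \<psi> L2_tendstoD[OF \<phi>(2)] L2_tendstoD[OF \<psi>(2)])
  show ?thesis
    using L2_tendsto_inner[OF \<phi>(3) \<psi>(3)] tendsto_mult_left[OF L2_tendsto_inner[OF \<phi>(2) \<psi>(2)]]
    unfolding eq by (rule LIMSEQ_unique)
qed

lemma Plancherel_norm:
  fixes f :: "'n::finite cfun"
  assumes "has_fourier f F"
  shows "L2_norm F = sqrt ((2 * pi) ^ CARD('n)) * L2_norm f"
proof -
  have "(L2_norm F)\<^sup>2 = (2 * pi) ^ CARD('n) * (L2_norm f)\<^sup>2"
    using Plancherel[OF assms assms] unfolding L2_inner_self of_real_mult[symmetric] of_real_eq_iff .
  then have "(L2_norm F)\<^sup>2 = (sqrt ((2 * pi) ^ CARD('n)) * L2_norm f)\<^sup>2"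
    by (simp add: power_mult_distrib)
  then show ?thesis
    by (rule power2_eq_imp_eq) auto
qed

lemma has_fourier_lincomb:
  assumes "has_fourier f F" "has_fourier g G"
  shows "has_fourier (\<lambda>x. a * f x + b * g x) (\<lambda>x. a * F x + b * G x)"
proof -
  from assms obtain \<phi> \<psi> where \<phi>: "\<And>n. integrable lebesgue (\<phi> n)" "L2_tendsto \<phi> f" "L2_tendsto (\<lambda>n. fourier_integral (\<phi> n)) F"
    and \<psi>: "\<And>n. integrable lebesgue (\<psi> n)" "L2_tendsto \<psi> g" "L2_tendsto (\<lambda>n. fourier_integral (\<psi> n)) G"
    unfolding has_fourier_def by blast
  show ?thesis
    unfolding has_fourier_def
  proof (intro exI[of _ "\<lambda>n x. a * \<phi> n x + b * \<psi> n x"] conjI allI)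
    show "integrable lebesgue (\<lambda>x. a * \<phi> n x + b * \<psi> n x)" for n
      using \<phi>(1) \<psi>(1) by auto
    show "L2_tendsto (\<lambda>n x. a * \<phi> n x + b * \<psi> n x) (\<lambda>x. a * f x + b * g x)"
      by (intro L2_tendsto_lincomb \<phi> \<psi>)
    show "L2_tendsto (\<lambda>n. fourier_integral (\<lambda>x. a * \<phi> n x + b * \<psi> n x)) (\<lambda>x. a * F x + b * G x)"
      unfolding fourier_integral_lincomb[OF \<phi>(1) \<psi>(1)]
      by (intro L2_tendsto_lincomb \<phi> \<psi>)
  qed
qed

lemma has_fourier_diff:
  "has_fourier f F \<Longrightarrow> has_fourier g G \<Longrightarrow> has_fourier (\<lambda>x. f x - g x) (\<lambda>x. F x - G x)"
  using has_fourier_lincomb[of f F g G 1 "-1"] by simp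

text \<open>The two directions are well-definedness and injectivity of the transform; both come from
  the Plancherel identity for the difference.\<close>

lemma has_fourier_ae_eq_iff:
  fixes f g :: "'n::finite cfun"
  assumes "has_fourier f F" "has_fourier g G"
  shows "f =\<^sub>a\<^sub>e g \<longleftrightarrow> F =\<^sub>a\<^sub>e G"
proof -
  note L = has_fourier_L2[OF assms(1)] has_fourier_L2[OF assms(2)]
  have ae: "u =\<^sub>a\<^sub>e v \<longleftrightarrow> L2_norm (\<lambda>x. u x - v x) = 0" if "u \<in> L2" "v \<in> L2" for u v :: "'n cfun"
    using L2_norm_eq_0[OF L2_diff[OF that]] by (simp add: ae_eq_def)
  show ?thesis
    using Plancherel_norm[OF has_fourier_diff[OF assms]] by (simp add: ae L)
qed

lemma L2_tendsto_cong:
  assumes "L2_tendsto \<phi> f" "f =\<^sub>a\<^sub>e f'"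
  shows "L2_tendsto \<phi> f'"
proof -
  note L = L2_tendstoD[OF assms(1)]
  have "f' \<in> L2" by (rule ae_eq_L2[OF assms(2) L(2)])
  moreover have "L2_norm (\<lambda>x. \<phi> n x - f' x) = L2_norm (\<lambda>x. \<phi> n x - f x)" for n
  proof (rule L2_norm_cong[symmetric])
    show "(\<lambda>x. \<phi> n x - f x) =\<^sub>a\<^sub>e (\<lambda>x. \<phi> n x - f' x)"
      using assms(2) unfolding ae_eq_def by eventually_elim simp
  qed (intro L2_diff L)
  ultimately show ?thesis
    using L by (simp add: L2_tendsto_def)
qed

lemma has_fourier_cong:
  "has_fourier f F \<Longrightarrow> f =\<^sub>a\<^sub>e f' \<Longrightarrow> F =\<^sub>a\<^sub>e F' \<Longrightarrow> has_fourier f' F'"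
  unfolding has_fourier_def using L2_tendsto_cong by blast

text \<open>A diagonal argument: the \<open>n\<close>-th pair is replaced by an integrable function
  and its Fourier integral, each within \<open>inverse (real (Suc n))\<close> of the
  original.\<close>

lemma has_fourier_closed:
  fixes f :: "'n::finite cfun"
  assumes fF: "\<And>n. has_fourier (f' n) (F' n)" and f: "L2_tendsto f' f" and F: "L2_tendsto F' F"
  shows "has_fourier f F"
proof -
  have "\<exists>k. integrable lebesgue k \<and> k \<in> L2 \<and> fourier_integral k \<in> L2
      \<and> L2_norm (\<lambda>x. k x - f' n x) < inverse (real (Suc n))
      \<and> L2_norm (\<lambda>x. fourier_integral k x - F' n x) < inverse (real (Suc n))" for n
  proof -
    obtain \<phi> where \<phi>: "\<And>n. integrable lebesgue (\<phi> n)" "L2_tendsto \<phi> (f' n)" "L2_tendsto (\<lambda>n. fourier_integral (\<phi> n)) (F' n)"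
      using fF[of n] unfolding has_fourier_def by blast
    have "\<forall>\<^sub>F m in sequentially. L2_norm (\<lambda>x. \<phi> m x - f' n x) < inverse (real (Suc n))"
        "\<forall>\<^sub>F m in sequentially. L2_norm (\<lambda>x. fourier_integral (\<phi> m) x - F' n x) < inverse (real (Suc n))"
      using order_tendstoD(2)[OF L2_tendstoD(3)[OF \<phi>(2)], of "inverse (real (Suc n))"]
        order_tendstoD(2)[OF L2_tendstoD(3)[OF \<phi>(3)], of "inverse (real (Suc n))"] by simp_all
    from eventually_happens[OF eventually_conj[OF this]]
    obtain m where "L2_norm (\<lambda>x. \<phi> m x - f' n x) < inverse (real (Suc n))"
        "L2_norm (\<lambda>x. fourier_integral (\<phi> m) x - F' n x) < inverse (real (Suc n))"
      by auto
    then show ?thesis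
      using \<phi>(1) L2_tendstoD(1)[OF \<phi>(2)] L2_tendstoD(1)[OF \<phi>(3)] by blast
  qed
  then have "\<forall>n. \<exists>k. integrable lebesgue k \<and> k \<in> L2 \<and> fourier_integral k \<in> L2
      \<and> L2_norm (\<lambda>x. k x - f' n x) < inverse (real (Suc n))
      \<and> L2_norm (\<lambda>x. fourier_integral k x - F' n x) < inverse (real (Suc n))"
    by (rule allI)
  from choice[OF this] obtain k where k: "integrable lebesgue (k n)" "k n \<in> L2" "fourier_integral (k n) \<in> L2"
      "L2_norm (\<lambda>x. k n x - f' n x) < inverse (real (Suc n))"
      "L2_norm (\<lambda>x. fourier_integral (k n) x - F' n x) < inverse (real (Suc n))" for n
    by blast
  have tends: "L2_tendsto u g" if u: "\<And>n. u n \<in> L2" "L2_tendsto v g" "\<And>n. L2_norm (\<lambda>x. u n x - v n x) < inverse (real (Suc n))"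
    for u v and g :: "'n cfun"
    unfolding L2_tendsto_def
  proof (intro conjI allI u L2_tendstoD(2)[OF u(2)])
    note L = L2_tendstoD[OF u(2)]
    have lim: "(\<lambda>n. inverse (real (Suc n)) + L2_norm (\<lambda>x. v n x - g x)) \<longlonglongrightarrow> 0"
      using tendsto_add[OF LIMSEQ_inverse_real_of_nat L(3)] by simp
    show "(\<lambda>n. L2_norm (\<lambda>x. u n x - g x)) \<longlonglongrightarrow> 0"
    proof (rule Lim_null_comparison[OF always_eventually lim], rule allI)
      fix n
      have "L2_norm (\<lambda>x. u n x - g x) \<le> L2_norm (\<lambda>x. u n x - v n x) + L2_norm (\<lambda>x. v n x - g x)"
        by (intro L2_norm_diff_triangle u L)
      also have "\<dots> \<le> inverse (real (Suc n)) + L2_norm (\<lambda>x. v n x - g x)"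
        using u(3)[of n] by simp
      finally show "norm (L2_norm (\<lambda>x. u n x - g x)) \<le> inverse (real (Suc n)) + L2_norm (\<lambda>x. v n x - g x)"
        by simp
    qed
  qed
  show ?thesis
    unfolding has_fourier_def
    using k(1) tends[OF k(2) f k(4)] tends[OF k(3) F k(5)] by blast
qed

lemma L2_tendsto_Cauchy:
  assumes "L2_tendsto \<phi> f" "0 < e"
  shows "\<exists>N. \<forall>m\<ge>N. \<forall>n\<ge>N. L2_norm (\<lambda>x. \<phi> m x - \<phi> n x) < e"
proof -
  note L = L2_tendstoD[OF assms(1)]
  obtain N where N: "\<And>n. n \<ge> N \<Longrightarrow> L2_norm (\<lambda>x. \<phi> n x - f x) < e / 2"
    using LIMSEQ_D[OF L(3), of "e / 2"] assms(2) by auto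
  have "L2_norm (\<lambda>x. \<phi> m x - \<phi> n x) < e" if "m \<ge> N" "n \<ge> N" for m n
    using N[OF that(1)] N[OF that(2)] L2_norm_diff_triangle[OF L(1,2,1), of m n] L2_norm_minus_commute[of f "\<phi> n"]
    by simp
  then show ?thesis by blast
qed

text \<open>Plancherel carries the Cauchy property from either side to the other, completeness
  provides the limit there, and closedness of the graph links the two limits.\<close>

lemma has_fourier_limit:
  fixes f :: "'n::finite cfun"
  assumes fF: "\<And>n. has_fourier (f' n) (F' n)"
  shows "L2_tendsto f' f \<Longrightarrow> \<exists>F. L2_tendsto F' F \<and> has_fourier f F"
    and "L2_tendsto F' F \<Longrightarrow> \<exists>f. L2_tendsto f' f \<and> has_fourier f F"
proof -
  define c where "c = sqrt ((2 * pi) ^ CARD('n))"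
  have c: "0 < c" by (simp add: c_def)
  have eq: "L2_norm (\<lambda>x. F' m x - F' n x) = c * L2_norm (\<lambda>x. f' m x - f' n x)" for m n
    unfolding c_def by (intro Plancherel_norm has_fourier_diff fF)
  show "\<exists>F. L2_tendsto F' F \<and> has_fourier f F" if f: "L2_tendsto f' f"
  proof -
    have "\<exists>F. L2_tendsto F' F"
    proof (rule L2_complete[OF has_fourier_L2(2)[OF fF]])
      show "\<exists>N. \<forall>m\<ge>N. \<forall>n\<ge>N. L2_norm (\<lambda>x. F' m x - F' n x) < e" if "0 < e" for e
        using L2_tendsto_Cauchy[OF f, of "e / c"] that c by (simp add: eq field_simps)
    qed
    then show ?thesis
      using has_fourier_closed[OF fF f] by blast
  qed
  show "\<exists>f. L2_tendsto f' f \<and> has_fourier f F" if F: "L2_tendsto F' F"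
  proof -
    have "\<exists>f. L2_tendsto f' f"
    proof (rule L2_complete[OF has_fourier_L2(1)[OF fF]])
      show "\<exists>N. \<forall>m\<ge>N. \<forall>n\<ge>N. L2_norm (\<lambda>x. f' m x - f' n x) < e" if "0 < e" for e
        using L2_tendsto_Cauchy[OF F, of "c * e"] that c by (simp add: eq)
    qed
    then show ?thesis
      using has_fourier_closed[OF fF _ F] by blast
  qed
qed

lemma has_fourier_exists:
  fixes f :: "'n::finite cfun"
  assumes "f \<in> L2"
  shows "\<exists>F. L2_tendsto (\<lambda>n. fourier_integral (\<lambda>x. if norm x \<le> real n then f x else 0)) F \<and> has_fourier f F"
  by (rule has_fourier_limit(1)[OF has_fourier_fourier_integral L2_tendsto_cutoff[OF assms]])
     (intro L2_tendstoD(1)[OF L2_tendsto_cutoff[OF assms]] L2_cutoff_integrable assms)+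

text \<open>The adjoint \<open>T\<close> of the Fourier transform is its complex conjugate, hence also a multiple of an
  isometry on \<open>L1 \<inter> L2\<close>, so that it provides preimages.\<close>
lemma has_fourier_surj_L1_L2:
  fixes F :: "'n::finite cfun"
  assumes F: "F \<in> L2" "integrable lebesgue F"
  shows "\<exists>f. has_fourier f F"
proof -
  define C where "C = complex_of_real ((2 * pi) ^ CARD('n))"
  have C: "C \<noteq> 0" by (simp add: C_def)
  define T where "T k x = cnj (fourier_integral (\<lambda>\<xi>. cnj (k \<xi>)) x)" for k and x :: "real^'n"
  have T: "T k \<in> L2" if "k \<in> L2" "integrable lebesgue k" for k
    unfolding T_def[abs_def] by (intro L2_cnj fourier_L2_bound Bochner_Integration.integrable_cnj that)
  have cnj_inner: "L2_inner (\<lambda>x. cnj (u x)) (\<lambda>x. cnj (v x)) = cnj (L2_inner u v)" for u v :: "'n cfun"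
    unfolding L2_inner_def by (subst Bochner_Integration.integral_cnj[symmetric]) simp
  have TT: "L2_inner (T F) (T k) = C * L2_inner F k" if "k \<in> L2" "integrable lebesgue k" for k
  proof -
    have "L2_inner (fourier_integral (\<lambda>\<xi>. cnj (F \<xi>))) (fourier_integral (\<lambda>\<xi>. cnj (k \<xi>)))
        = C * L2_inner (\<lambda>\<xi>. cnj (F \<xi>)) (\<lambda>\<xi>. cnj (k \<xi>))"
      unfolding C_def by (intro Plancherel_L1_L2 L2_cnj Bochner_Integration.integrable_cnj that F)
    then show ?thesis
      unfolding T_def[abs_def] cnj_inner by (simp add: C_def)
  qed
  \<comment> \<open>Candidate preimage: up to the factor \<open>C\<close> the adjoint of the
    transform is its inverse.\<close>
  define f where "f x = inverse C * T F x" for x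
  have f: "f \<in> L2"
    unfolding f_def[abs_def] by (intro L2_scale T F)
  define f' where "f' n = (\<lambda>x. if norm x \<le> real n then f x else 0)" for n
  have f': "L2_tendsto f' f" "\<And>n. integrable lebesgue (f' n)" "\<And>n. f' n \<in> L2"
    unfolding f'_def using L2_tendsto_cutoff[OF f] L2_tendstoD(1)[OF L2_tendsto_cutoff[OF f]] L2_cutoff_integrable[OF f]
    by blast+
  obtain G where G: "L2_tendsto (\<lambda>n. fourier_integral (f' n)) G" "has_fourier f G"
    using has_fourier_exists[OF f] unfolding f'_def by blast
  \<comment> \<open>The transform \<open>G\<close> of the candidate is compared with
    \<open>F\<close> only weakly, against integrable \<open>k\<close>, because there the
    multiplication formula moves the transform onto \<open>k\<close> and \<open>TT\<close> evaluates
    the result.\<close>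
  have GF: "L2_inner G k = L2_inner F k" if k: "k \<in> L2" "integrable lebesgue k" for k
  proof (rule LIMSEQ_unique)
    show "(\<lambda>n. L2_inner (fourier_integral (f' n)) k) \<longlonglongrightarrow> L2_inner G k"
      by (intro L2_tendsto_inner L2_tendsto_const G k)
    have "L2_inner (fourier_integral (f' n)) k = L2_inner (f' n) (T k)" for n
      unfolding L2_inner_def T_def using k f'(2)
      by (simp add: fourier_multiplication_formula)
    moreover have "(\<lambda>n. L2_inner (f' n) (T k)) \<longlonglongrightarrow> L2_inner f (T k)"
      by (intro L2_tendsto_inner L2_tendsto_const f' T k)
    moreover have "L2_inner f (T k) = L2_inner F k"
      using L2_inner_lincomb_left[OF T[OF F] T[OF F] T[OF k], of "inverse C" 0] TT[OF k]
      using C by (simp add: f_def[abs_def])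
    ultimately show "(\<lambda>n. L2_inner (fourier_integral (f' n)) k) \<longlonglongrightarrow> L2_inner F k" by simp
  qed
  have GL: "G \<in> L2" using G(2) by (rule has_fourier_L2)
  define d where "d x = G x - F x" for x
  have d: "d \<in> L2" unfolding d_def[abs_def] by (intro L2_diff GL F)
  \<comment> \<open>The difference is tested with its own cutoffs, which are integrable and converge
    to it, so its norm vanishes.\<close>
  have "L2_inner d (\<lambda>x. if norm x \<le> real n then d x else 0) = 0" for n
  proof -
    let ?k = "\<lambda>x. if norm x \<le> real n then d x else 0"
    have k: "?k \<in> L2" "integrable lebesgue ?k"
      using L2_tendstoD(1)[OF L2_tendsto_cutoff[OF d]] L2_cutoff_integrable[OF d] by blast+
    show ?thesis
      using L2_inner_diff_left[OF GL F(1) k(1)] GF[OF k] by (simp add: d_def[symmetric, abs_def])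
  qed
  then have "L2_inner d d = 0"
    using L2_tendsto_inner[OF L2_tendsto_const[OF d] L2_tendsto_cutoff[OF d]] by (simp add: LIMSEQ_const_iff)
  then have "L2_norm (\<lambda>x. G x - F x) = 0"
    by (simp add: L2_inner_self d_def[symmetric, abs_def])
  then have "G =\<^sub>a\<^sub>e F"
    by (rule L2_norm_diff_eq_0[OF GL F(1)])
  then show ?thesis
    using has_fourier_cong[OF G(2) ae_eq_refl] by blast
qed

lemma has_fourier_surj:
  fixes F :: "'n::finite cfun"
  assumes "F \<in> L2"
  shows "\<exists>f. has_fourier f F"
proof -
  let ?F = "\<lambda>n x. if norm x \<le> real n then F x else 0"
  have "\<exists>f. has_fourier f (?F n)" for n
    by (intro has_fourier_surj_L1_L2 L2_tendstoD(1)[OF L2_tendsto_cutoff[OF assms]] L2_cutoff_integrable[OF assms])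
  then obtain f' where "\<And>n. has_fourier (f' n) (?F n)" by metis
  from has_fourier_limit(2)[OF this L2_tendsto_cutoff[OF assms]] show ?thesis by blast
qed

section \<open>Projection-valued measures\<close>

lemma pvm_L2:
  "projection_valued_measure E \<Longrightarrow> B \<in> sets borel \<Longrightarrow> f \<in> L2 \<Longrightarrow> E B f \<in> L2"
  by (simp add: projection_valued_measure_def)

lemma pvm_symmetric:
  "projection_valued_measure E \<Longrightarrow> B \<in> sets borel \<Longrightarrow> f \<in> L2 \<Longrightarrow> g \<in> L2 \<Longrightarrow>
    L2_inner (E B f) g = L2_inner f (E B g)"
  by (simp add: projection_valued_measure_def)

lemma pvm_idem:
  assumes E: "projection_valued_measure E" "B \<in> sets borel" and fg: "f \<in> L2" "g \<in> L2"
  shows "L2_inner (E B f) (E B g) = L2_inner (E B f) g"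
proof -
  have "E (B \<inter> B) f =\<^sub>a\<^sub>e E B (E B f)"
    using E fg unfolding projection_valued_measure_def by blast
  then have "E B f =\<^sub>a\<^sub>e E B (E B f)"
    by simp
  then have "L2_inner (E B f) g = L2_inner (E B (E B f)) g"
    by (rule L2_inner_cong[OF _ ae_eq_refl pvm_L2[OF E fg(1)] fg(2)])
  also have "\<dots> = L2_inner (E B f) (E B g)"
    by (rule pvm_symmetric[OF E pvm_L2[OF E fg(1)] fg(2)])
  finally show ?thesis ..
qed

lemma pvm_inner_self:
  assumes E: "projection_valued_measure E" "B \<in> sets borel" and f: "f \<in> L2"
  shows "L2_inner (E B f) f = of_real ((L2_norm (E B f))\<^sup>2)"
  using pvm_idem[OF E f f] by (simp add: L2_inner_self)

lemma pvm_inner_lincomb: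
  assumes E: "projection_valued_measure E" "B \<in> sets borel" and f: "f \<in> L2" and k: "k \<in> L2"
  shows "L2_inner (E B (\<lambda>x. f x + c * k x)) (\<lambda>x. f x + c * k x)
    = L2_inner (E B f) f + cnj c * L2_inner (E B f) k + c * L2_inner (E B k) f + c * cnj c * L2_inner (E B k) k"
proof -
  let ?h = "\<lambda>x. 1 * f x + c * k x"
  note [simp] = f k pvm_L2[OF E]
  have h: "?h \<in> L2" by (intro L2_lincomb) simp_all
  \<comment> \<open>The definition does not state linearity of \<open>E B\<close>. Symmetry moves
    \<open>E B\<close> to the other factor, where the inner product supplies linearity.\<close>
  have "L2_inner (E B ?h) g = L2_inner (E B f) g + c * L2_inner (E B k) g" if g: "g \<in> L2" for g
  proof -
    have "L2_inner (E B ?h) g = L2_inner ?h (E B g)"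
      by (rule pvm_symmetric[OF E h g])
    also have "\<dots> = L2_inner f (E B g) + c * L2_inner k (E B g)"
      using g by (subst L2_inner_lincomb_left) simp_all
    finally show ?thesis
      using g by (simp add: pvm_symmetric[OF E])
  qed
  from this[OF h] have "L2_inner (E B ?h) ?h = L2_inner (E B f) ?h + c * L2_inner (E B k) ?h" .
  also have "\<dots> = L2_inner (E B f) f + cnj c * L2_inner (E B f) k + c * (L2_inner (E B k) f + cnj c * L2_inner (E B k) k)"
    by (subst (1 2) L2_inner_lincomb_right) simp_all
  finally show ?thesis by (simp add: algebra_simps)
qed

lemma pvm_empty:
  assumes E: "projection_valued_measure E" and f: "f \<in> L2"
  shows "L2_norm (E {} f) = 0"
proof -
  \<comment> \<open>Countable additivity for the sequence of empty sets gives a convergent constant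
    series, whose terms must be 0.\<close>
  have "(\<lambda>n::nat. L2_inner (E {} f) f) sums L2_inner (E (\<Union>n::nat. {}) f) f"
    using E f unfolding projection_valued_measure_def by (elim conjE allE[of _ "\<lambda>_. {}"]) (auto simp: disjoint_family_on_def)
  then have "L2_inner (E {} f) f = 0"
    using sums_summable summable_const_iff by blast
  then show ?thesis
    by (simp add: pvm_inner_self[OF E _ f])
qed

section \<open>Scalar measures and bounds for spectral integrals\<close>

lemma sets_scalar_measure [simp, measurable_cong]: "sets (scalar_measure E f) = sets borel"
  and space_scalar_measure [simp]: "space (scalar_measure E f) = UNIV"
proof -
  have "sigma_algebra UNIV (sets (borel :: real measure))"
    using sets.sigma_algebra_axioms[of "borel :: real measure"] by simp
  then have "sigma_sets UNIV (sets (borel :: real measure)) = sets borel"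
    by (rule sigma_algebra.sigma_sets_eq)
  then show "sets (scalar_measure E f) = sets borel" "space (scalar_measure E f) = UNIV"
    by (simp_all add: scalar_measure_def)
qed

lemma emeasure_scalar_measure:
  assumes E: "projection_valued_measure E" and f: "f \<in> L2" and B: "B \<in> sets borel"
  shows "emeasure (scalar_measure E f) B = ennreal ((L2_norm (E B f))\<^sup>2)"
proof -
  let ?\<mu> = "\<lambda>B. ennreal (Re (L2_inner (E B f) f))"
  have "emeasure (scalar_measure E f) B = ?\<mu> B"
    unfolding scalar_measure_def
  proof (rule emeasure_measure_of_sigma)
    show "sigma_algebra UNIV (sets (borel :: real measure))"
      using sets.sigma_algebra_axioms[of "borel :: real measure"] by simp
    show "positive (sets borel) ?\<mu>"
      by (simp add: positive_def pvm_inner_self[OF E _ f] pvm_empty[OF E f])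
    show "countably_additive (sets borel) ?\<mu>"
      unfolding countably_additive_def
    proof (intro allI impI)
      fix A :: "nat \<Rightarrow> real set"
      assume A: "range A \<subseteq> sets borel" "disjoint_family A" "(\<Union>i. A i) \<in> sets borel"
      then have "(\<lambda>n. L2_inner (E (A n) f) f) sums L2_inner (E (\<Union>n. A n) f) f"
        using E f unfolding projection_valued_measure_def by blast
      then have "(\<lambda>n. Re (L2_inner (E (A n) f) f)) sums Re (L2_inner (E (\<Union>n. A n) f) f)"
        by (rule sums_Re)
      then show "(\<Sum>i. ?\<mu> (A i)) = ?\<mu> (\<Union>i. A i)"
        using A by (subst suminf_ennreal2) (auto simp: pvm_inner_self[OF E _ f] sums_iff image_subset_iff)
    qed
  qed (use B in simp)
  then show ?thesis
    by (simp add: pvm_inner_self[OF E B f])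
qed

lemma measurable_scalar_measure_iff [simp]:
  "g \<in> measurable (scalar_measure E f) M \<longleftrightarrow> g \<in> measurable borel M"
  by (rule measurable_cong_sets[THEN arg_cong[where f="\<lambda>S. g \<in> S"]]) simp_all

lemma measure_scalar_measure:
  assumes E: "projection_valued_measure E" and f: "f \<in> L2" and B: "B \<in> sets borel"
  shows "measure (scalar_measure E f) B = (L2_norm (E B f))\<^sup>2"
  using emeasure_scalar_measure[OF assms] by (simp add: measure_def)

lemma finite_scalar_measure:
  assumes "projection_valued_measure E" "f \<in> L2"
  shows "finite_measure (scalar_measure E f)"
  by standard (simp add: emeasure_scalar_measure[OF assms])

lemma pvm_UNIV_norm:
  assumes "projection_valued_measure E" "f \<in> L2"
  shows "L2_norm (E UNIV f) = L2_norm f"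
proof (rule L2_norm_cong)
  show "E UNIV f =\<^sub>a\<^sub>e f" using assms by (auto simp: projection_valued_measure_def)
qed (auto intro: pvm_L2 assms)

text \<open>The unwanted terms carry the factors \<open>\<i> ^ j\<close> or
  \<open>\<i> ^ (2 * j)\<close>, which sum to 0 over the fourth roots of unity; the factor of
  \<open>b\<close> is constantly 1. This justifies the form of
  \<open>spectral_integral\<close>.\<close>

lemma polarization_sum:
  fixes a b c d :: complex
  shows "(\<Sum>j<4. \<i> ^ j * (a + cnj (\<i> ^ j) * b + \<i> ^ j * c + \<i> ^ j * cnj (\<i> ^ j) * d)) / 4 = b"
  by (simp add: eval_nat_numeral algebra_simps)

lemma polarization_measure:
  assumes E: "projection_valued_measure E" and f: "f \<in> L2" and k: "k \<in> L2" and B: "B \<in> sets borel"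
  shows "(\<Sum>j<4. \<i> ^ j * of_real (measure (scalar_measure E (\<lambda>x. f x + \<i> ^ j * k x)) B)) / 4 = L2_inner (E B f) k"
proof -
  have "complex_of_real (measure (scalar_measure E (\<lambda>x. f x + c * k x)) B)
      = L2_inner (E B f) f + cnj c * L2_inner (E B f) k + c * L2_inner (E B k) f + c * cnj c * L2_inner (E B k) k" for c
  proof -
    have h: "(\<lambda>x. f x + c * k x) \<in> L2" by (intro L2_add L2_scale f k)
    show ?thesis
      by (simp only: measure_scalar_measure[OF E h B] pvm_inner_self[OF E B h, symmetric] pvm_inner_lincomb[OF E B f k])
  qed
  then show ?thesis by (simp only: polarization_sum)
qed

text \<open>The scalar measures are finite, so the domain of a constant is all of \<open>L2\<close>
  and \<open>h - f\<close> itself may serve as test function. The statement covers every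
  \<open>E\<close> because the spectral measure behind a given version is unknown; it identifies the
  value at time 0.\<close>

lemma spectral_operator_one:
  assumes E: "projection_valued_measure E" and op: "spectral_operator E (\<lambda>r. 1) f h"
  shows "h =\<^sub>a\<^sub>e f"
proof (rule L2_norm_diff_eq_0)
  show f: "f \<in> L2" and h: "h \<in> L2"
    using op by (auto simp: spectral_operator_def spectral_domain_def)
  have dom: "spectral_domain E (\<lambda>r. 1) = L2"
    unfolding spectral_domain_def
    using finite_measure.integrable_const[OF finite_scalar_measure[OF E], of _ "1::real"] by auto
  define d where "d x = h x - f x" for x
  have d: "d \<in> L2" unfolding d_def[abs_def] by (intro L2_diff f h)
  have "L2_inner h d = spectral_integral E (\<lambda>r. 1) f d"
    using op d by (auto simp: spectral_operator_def dom)
  also have "\<dots> = L2_inner (E UNIV f) d"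
    using polarization_measure[OF E f d, of UNIV] by (simp add: spectral_integral_def scaleR_conv_of_real)
  also have "\<dots> = L2_inner f d"
    using E f d by (intro L2_inner_cong) (auto simp: projection_valued_measure_def)
  finally have "L2_inner d d = 0"
    using L2_inner_diff_left[OF h f d] by (simp add: d_def[abs_def])
  then show "L2_norm (\<lambda>x. h x - f x) = 0"
    by (simp add: L2_inner_self d_def[abs_def])
qed

text \<open>On sets this is the parallelogram law for the projections with one of the two squares
  dropped; induction over measurable functions does the rest. It shows that the combinations with
  \<open>\<i> ^ j\<close> in \<open>spectral_integral\<close> stay in the spectral domain.\<close>

lemma nn_integral_scalar_measure_lincomb:
  assumes E: "projection_valued_measure E" and f: "f \<in> L2" and k: "k \<in> L2" and c: "cmod c = 1"
    and u: "u \<in> borel_measurable borel"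
  shows "(\<integral>\<^sup>+r. u r \<partial>scalar_measure E (\<lambda>x. f x + c * k x))
    \<le> 2 * ((\<integral>\<^sup>+r. u r \<partial>scalar_measure E f) + (\<integral>\<^sup>+r. u r \<partial>scalar_measure E k))"
proof -
  let ?\<mu> = "scalar_measure E (\<lambda>x. f x + c * k x)"
  have h: "(\<lambda>x. f x + a * k x) \<in> L2" for a by (intro L2_add L2_scale f k)
  have em: "emeasure ?\<mu> B \<le> 2 * (emeasure (scalar_measure E f) B + emeasure (scalar_measure E k) B)" if B: "B \<in> sets borel" for B
  proof -
    let ?n = "\<lambda>g. (L2_norm (E B g))\<^sup>2"
    have "cmod c ^ 2 = 1" using c by simp
    then have cc: "c * cnj c = 1" by (metis complex_norm_square of_real_1)
    have "complex_of_real (?n (\<lambda>x. f x + c * k x)) + of_real (?n (\<lambda>x. f x + (- c) * k x))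
        = 2 * (of_real (?n f) + of_real (?n k))"
      by (simp only: pvm_inner_self[OF E B h, symmetric] pvm_inner_self[OF E B f, symmetric]
          pvm_inner_self[OF E B k, symmetric] pvm_inner_lincomb[OF E B f k]) (simp add: cc)
    then have "complex_of_real (?n (\<lambda>x. f x + c * k x) + ?n (\<lambda>x. f x + (- c) * k x)) = of_real (2 * (?n f + ?n k))"
      by simp
    then have "?n (\<lambda>x. f x + c * k x) + ?n (\<lambda>x. f x + (- c) * k x) = 2 * (?n f + ?n k)"
      unfolding of_real_eq_iff .
    then have "?n (\<lambda>x. f x + c * k x) \<le> 2 * (?n f + ?n k)"
      by (smt (verit) zero_le_power2)
    then have "ennreal (?n (\<lambda>x. f x + c * k x)) \<le> ennreal (2 * (?n f + ?n k))"
      by (rule ennreal_leI)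
    also have "\<dots> = 2 * (ennreal (?n f) + ennreal (?n k))"
      by (simp add: ennreal_mult ennreal_plus)
    finally show ?thesis
      by (simp only: emeasure_scalar_measure[OF E _ B] h f k)
  qed
  from u show ?thesis
  proof (induction u rule: borel_measurable_induct)
    case (cong u v)
    then have "u = v" by (auto simp: fun_eq_iff)
    then show ?case using cong by simp
  next
    case (set A)
    then show ?case using em by simp
  next
    case (mult u a)
    have "a * (\<integral>\<^sup>+r. u r \<partial>?\<mu>) \<le> a * (2 * ((\<integral>\<^sup>+r. u r \<partial>scalar_measure E f) + (\<integral>\<^sup>+r. u r \<partial>scalar_measure E k)))"
      by (intro mult_left_mono mult.IH) simp
    then show ?case
      using mult by (simp add: nn_integral_cmult distrib_left mult.left_commute)
  next
    case (add u v)
    then have eq: "(\<integral>\<^sup>+r. u r + v r \<partial>scalar_measure E h) = (\<integral>\<^sup>+r. u r \<partial>scalar_measure E h) + (\<integral>\<^sup>+r. v r \<partial>scalar_measure E h)" for h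
      by (intro nn_integral_add) simp_all
    from add_mono[OF add.IH(2) add.IH(1)] show ?case
      by (simp only: eq distrib_left add_ac)
  next
    case (seq U)
    have mono: "incseq U" and [measurable]: "\<And>i. U i \<in> borel_measurable borel" using seq by auto
    have sup: "(\<integral>\<^sup>+r. (SUP i. U i r) \<partial>scalar_measure E g) = (SUP i. \<integral>\<^sup>+r. U i r \<partial>scalar_measure E g)" for g
      by (rule nn_integral_monotone_convergence_SUP[OF mono]) simp
    have le: "(\<integral>\<^sup>+r. U i r \<partial>scalar_measure E g) \<le> (SUP i. \<integral>\<^sup>+r. U i r \<partial>scalar_measure E g)" for g i
      by (rule SUP_upper) simp
    have "(SUP i. \<integral>\<^sup>+r. U i r \<partial>?\<mu>) \<le> 2 * ((SUP i. \<integral>\<^sup>+r. U i r \<partial>scalar_measure E f) + (SUP i. \<integral>\<^sup>+r. U i r \<partial>scalar_measure E k))"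
      by (rule SUP_least) (use seq.IH in \<open>blast intro: order_trans mult_left_mono add_mono le zero_le\<close>)
    then show ?case
      by (simp add: sup image_comp)
  qed
qed

lemma spectral_domain_lincomb:
  assumes E: "projection_valued_measure E" and g: "g \<in> borel_measurable borel"
    and f: "f \<in> spectral_domain E g" and k: "k \<in> spectral_domain E g" and c: "cmod c = 1"
  shows "(\<lambda>x. f x + c * k x) \<in> spectral_domain E g"
proof -
  have L: "f \<in> L2" "k \<in> L2" using f k by (auto simp: spectral_domain_def)
  have [measurable]: "g \<in> borel_measurable borel" by fact
  have iff: "h \<in> spectral_domain E g \<longleftrightarrow> h \<in> L2 \<and> (\<integral>\<^sup>+r. ennreal ((cmod (g r))\<^sup>2) \<partial>scalar_measure E h) < \<infinity>" for h
  proof -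
    have "(\<lambda>r. (cmod (g r))\<^sup>2) \<in> borel_measurable (scalar_measure E h)" using g by simp
    then show ?thesis
      unfolding spectral_domain_def by (auto simp: integrable_iff_bounded)
  qed
  have "(\<integral>\<^sup>+r. ennreal ((cmod (g r))\<^sup>2) \<partial>scalar_measure E (\<lambda>x. f x + c * k x))
      \<le> 2 * ((\<integral>\<^sup>+r. ennreal ((cmod (g r))\<^sup>2) \<partial>scalar_measure E f) + (\<integral>\<^sup>+r. ennreal ((cmod (g r))\<^sup>2) \<partial>scalar_measure E k))"
    by (rule nn_integral_scalar_measure_lincomb[OF E L c]) measurable
  also have "\<dots> < \<infinity>"
    using f k by (simp add: iff ennreal_mult_less_top)
  finally show ?thesis
    using L by (auto simp: iff)
qed

lemma integral_comp_simple_function: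
  fixes \<phi> :: "'b \<Rightarrow> 'c::{banach, second_countable_topology}"
  assumes "finite_measure M" and s: "simple_function M s"
  shows "(LINT x|M. \<phi> (s x)) = (\<Sum>y\<in>s ` space M. measure M (s -` {y} \<inter> space M) *\<^sub>R \<phi> y)"
proof -
  interpret finite_measure M by fact
  have fin: "finite (s ` space M)" and [measurable]: "\<And>y. y \<in> s ` space M \<Longrightarrow> s -` {y} \<inter> space M \<in> sets M"
    using s by (auto simp: simple_function_def)
  have "(LINT x|M. \<phi> (s x)) = (LINT x|M. (\<Sum>y\<in>s ` space M. indicator (s -` {y} \<inter> space M) x *\<^sub>R \<phi> y))"
  proof (rule Bochner_Integration.integral_cong[OF refl])
    fix x assume "x \<in> space M"
    then have "(\<Sum>y\<in>s ` space M. indicator (s -` {y} \<inter> space M) x *\<^sub>R \<phi> y) = (\<Sum>y\<in>s ` space M. if y = s x then \<phi> y else 0)"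
      by (intro sum.cong) (auto simp: indicator_def)
    then show "\<phi> (s x) = (\<Sum>y\<in>s ` space M. indicator (s -` {y} \<inter> space M) x *\<^sub>R \<phi> y)"
      using fin \<open>x \<in> space M\<close> by simp
  qed
  also have "\<dots> = (\<Sum>y\<in>s ` space M. measure M (s -` {y} \<inter> space M) *\<^sub>R \<phi> y)"
    using emeasure_finite by (subst Bochner_Integration.integral_sum) (auto simp: less_top[symmetric])
  finally show ?thesis .
qed

text \<open>Polarization turns the integral of a simple function into a finite sum of inner products
  of the components \<open>E (s -\<close> {y}) k\<open>and\<close>E (s -\<open>{y}) f\<close>,
  weighted by \<open>y\<close>. Cauchy-Schwarz is applied to each inner product and again to the
  sum; the components of \<open>k\<close> recombine to its full norm.\<close>

lemma spectral_integral_simple_bound: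
  assumes E: "projection_valued_measure E" and k: "k \<in> L2" and f: "f \<in> L2"
    and s: "simple_function borel (s :: real \<Rightarrow> complex)"
  shows "cmod (spectral_integral E s k f) \<le> L2_norm k * sqrt (LINT r|scalar_measure E f. (cmod (s r))\<^sup>2)"
proof -
  let ?B = "\<lambda>y. s -` {y}"
  have B: "?B y \<in> sets borel" for y
    using simple_functionD(2)[OF s, of "{y}"] by simp
  have s': "simple_function (scalar_measure E h) s" for h
    using s by (simp add: simple_function_def)
  have int: "(LINT r|scalar_measure E h. \<phi> (s r)) = (\<Sum>y\<in>range s. (L2_norm (E (?B y) h))\<^sup>2 *\<^sub>R \<phi> y)"
    if "h \<in> L2" for h and \<phi> :: "complex \<Rightarrow> 'z::{banach, second_countable_topology}"
    using integral_comp_simple_function[OF finite_scalar_measure[OF E that] s', of \<phi>] that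
    by (simp add: measure_scalar_measure[OF E _ B])
  have "spectral_integral E s k f
      = (\<Sum>j<4. \<i> ^ j * (\<Sum>y\<in>range s. of_real (measure (scalar_measure E (\<lambda>x. k x + \<i> ^ j * f x)) (?B y)) * y)) / 4"
    unfolding spectral_integral_def
    using integral_comp_simple_function[OF finite_scalar_measure[OF E] s', of "\<lambda>x. k x + \<i> ^ j * f x" "\<lambda>y. y" for j] k f
    by (simp add: L2_add L2_scale scaleR_conv_of_real)
  also have "\<dots> = (\<Sum>y\<in>range s. (\<Sum>j<4. \<i> ^ j * of_real (measure (scalar_measure E (\<lambda>x. k x + \<i> ^ j * f x)) (?B y))) / 4 * y)"
    by (simp only: sum_distrib_left sum_distrib_right sum_divide_distrib times_divide_eq_left mult.assoc)
       (rule sum.swap)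
  also have "\<dots> = (\<Sum>y\<in>range s. L2_inner (E (?B y) k) (E (?B y) f) * y)"
    by (simp only: polarization_measure[OF E k f B] pvm_idem[OF E B k f])
  also have "cmod \<dots> \<le> (\<Sum>y\<in>range s. cmod (L2_inner (E (?B y) k) (E (?B y) f) * y))"
    by (rule norm_sum)
  also have "\<dots> \<le> (\<Sum>y\<in>range s. \<bar>L2_norm (E (?B y) k)\<bar> * \<bar>L2_norm (E (?B y) f) * cmod y\<bar>)"
  proof (rule sum_mono)
    fix y
    have "cmod (L2_inner (E (?B y) k) (E (?B y) f)) * cmod y \<le> (L2_norm (E (?B y) k) * L2_norm (E (?B y) f)) * cmod y"
      by (intro mult_right_mono L2_Cauchy_Schwarz pvm_L2[OF E B] k f) simp
    then show "cmod (L2_inner (E (?B y) k) (E (?B y) f) * y) \<le> \<bar>L2_norm (E (?B y) k)\<bar> * \<bar>L2_norm (E (?B y) f) * cmod y\<bar>"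
      by (simp add: norm_mult abs_mult)
  qed
  also have "\<dots> \<le> L2_set (\<lambda>y. L2_norm (E (?B y) k)) (range s) * L2_set (\<lambda>y. L2_norm (E (?B y) f) * cmod y) (range s)"
    by (rule L2_set_mult_ineq)
  also have "L2_set (\<lambda>y. L2_norm (E (?B y) k)) (range s) = L2_norm k"
  proof -
    have "(\<Sum>y\<in>range s. (L2_norm (E (?B y) k))\<^sup>2) = (L2_norm k)\<^sup>2"
      using int[OF k, of "\<lambda>_. 1::real"] measure_scalar_measure[OF E k, of UNIV] pvm_UNIV_norm[OF E k] by simp
    then show ?thesis by (simp add: L2_set_def)
  qed
  also have "L2_set (\<lambda>y. L2_norm (E (?B y) f) * cmod y) (range s) = sqrt (LINT r|scalar_measure E f. (cmod (s r))\<^sup>2)"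
    using int[OF f, of "\<lambda>y. (cmod y)\<^sup>2"] by (simp add: L2_set_def power_mult_distrib)
  finally show ?thesis .
qed

text \<open>The point is that \<open>k\<close> enters through its \<open>L2\<close> norm only. Thus
  for \<open>f\<close> in the domain, \<open>k \<mapsto> spectral_integral E g k f\<close> is a
  bounded functional, which is what the later adjoint argument uses. Membership of \<open>k\<close>
  in the domain serves the limit from simple functions to \<open>g\<close>.\<close>

lemma spectral_integral_bound:
  assumes E: "projection_valued_measure E" and g: "g \<in> borel_measurable borel"
    and k: "k \<in> spectral_domain E g" and f: "f \<in> spectral_domain E g"
  shows "cmod (spectral_integral E g k f) \<le> L2_norm k * sqrt (LINT r|scalar_measure E f. (cmod (g r))\<^sup>2)"
proof -
  have L: "k \<in> L2" "f \<in> L2" using f k by (auto simp: spectral_domain_def)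
  have [measurable]: "g \<in> borel_measurable borel" by fact
  obtain s where s: "\<And>i. simple_function borel (s i)" "\<And>x. (\<lambda>i. s i x) \<longlonglongrightarrow> g x"
      "\<And>i x. cmod (s i x) \<le> 2 * cmod (g x)"
    using borel_measurable_implies_sequence_metric[OF g, of 0] by (auto simp: dist_norm)
  have [measurable]: "s i \<in> borel_measurable borel" for i
    using s(1) by (rule borel_measurable_simple_function)
  have "(\<lambda>i. LINT r|scalar_measure E h. s i r) \<longlonglongrightarrow> (LINT r|scalar_measure E h. g r)" if h: "h \<in> spectral_domain E g" for h
  proof (rule integral_dominated_convergence)
    have "integrable (scalar_measure E h) (\<lambda>r. cmod (g r))"
      by (rule finite_measure.square_integrable_imp_integrable[OF finite_scalar_measure[OF E]])
         (use h g in \<open>auto simp: spectral_domain_def\<close>)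
    then show "integrable (scalar_measure E h) (\<lambda>r. 2 * cmod (g r))" by simp
  qed (use s in auto)
  note lim = this
  have lhs: "(\<lambda>i. spectral_integral E (s i) k f) \<longlonglongrightarrow> spectral_integral E g k f"
    unfolding spectral_integral_def
    by (intro tendsto_intros lim spectral_domain_lincomb[OF E g k f]) (auto simp: norm_power)
  have "(\<lambda>i. LINT r|scalar_measure E f. (cmod (s i r))\<^sup>2) \<longlonglongrightarrow> (LINT r|scalar_measure E f. (cmod (g r))\<^sup>2)"
  proof (rule integral_dominated_convergence)
    show "integrable (scalar_measure E f) (\<lambda>r. 4 * (cmod (g r))\<^sup>2)"
      using f by (simp add: spectral_domain_def)
    show "AE r in scalar_measure E f. norm ((cmod (s i r))\<^sup>2) \<le> 4 * (cmod (g r))\<^sup>2" for i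
      using power_mono[OF s(3), of i _ 2] by (simp add: power_mult_distrib)
    show "AE r in scalar_measure E f. (\<lambda>i. (cmod (s i r))\<^sup>2) \<longlonglongrightarrow> (cmod (g r))\<^sup>2"
      by (intro AE_I2 tendsto_intros s)
  qed auto
  then have rhs: "(\<lambda>i. L2_norm k * sqrt (LINT r|scalar_measure E f. (cmod (s i r))\<^sup>2))
      \<longlonglongrightarrow> L2_norm k * sqrt (LINT r|scalar_measure E f. (cmod (g r))\<^sup>2)"
    by (intro tendsto_intros)
  show ?thesis
    by (rule LIMSEQ_le[OF tendsto_norm[OF lhs] rhs]) (use spectral_integral_simple_bound[OF E L s(1)] in auto)
qed

section \<open>Functional calculus of a Fourier multiplier\<close>

text \<open>The transform is a relation between representatives, so one has to be chosen. By
  \<open>has_fourier_projection\<close> the result works with every transform \<open>F\<close> of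
  \<open>f\<close>, whichever one the choice used.\<close>

definition fourier_projection :: "(real^'n::finite \<Rightarrow> real) \<Rightarrow> real set \<Rightarrow> 'n cfun \<Rightarrow> 'n cfun" where
  "fourier_projection P B f =
     (SOME h. \<exists>F. has_fourier f F \<and> has_fourier h (\<lambda>\<xi>. indicator B (P \<xi>) * F \<xi>))"

lemma ae_eq_mult: "f =\<^sub>a\<^sub>e g \<Longrightarrow> (\<lambda>x. m x * f x) =\<^sub>a\<^sub>e (\<lambda>x. m x * g x)"
  unfolding ae_eq_def by (auto elim: eventually_mono)

lemma has_fourier_unique: "has_fourier f F \<Longrightarrow> has_fourier f G \<Longrightarrow> F =\<^sub>a\<^sub>e G"
  using has_fourier_ae_eq_iff[of f F f G] by simp

lemma integrable_divide_iff:
  fixes f :: "'a \<Rightarrow> real"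
  assumes "c \<noteq> 0"
  shows "integrable M (\<lambda>x. f x / c) \<longleftrightarrow> integrable M f"
proof
  assume "integrable M (\<lambda>x. f x / c)"
  from integrable_mult_left[OF this, of c] show "integrable M f"
    using assms by simp
qed (rule Bochner_Integration.integrable_divide)

context
  fixes P :: "real^'n::finite \<Rightarrow> real"
  assumes P [measurable]: "P \<in> borel_measurable lebesgue"
begin

lemma measurable_comp_symbol:
  "g \<in> borel_measurable borel \<Longrightarrow> (\<lambda>\<xi>. g (P \<xi>)) \<in> borel_measurable lebesgue"
  by (rule measurable_compose[OF P])

lemma indicator_mult_L2:
  assumes "F \<in> L2" "B \<in> sets borel"
  shows "(\<lambda>\<xi>. indicator B (P \<xi>) * F \<xi>) \<in> L2"
  by (rule L2_mult_bounded[OF assms(1) measurable_comp_symbol, of _ 1])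
     (use assms(2) in \<open>auto simp: indicator_def\<close>)

lemma has_fourier_projection:
  assumes f: "has_fourier f F" and B: "B \<in> sets borel"
  shows "has_fourier (fourier_projection P B f) (\<lambda>\<xi>. indicator B (P \<xi>) * F \<xi>)"
proof -
  have "\<exists>h F. has_fourier f F \<and> has_fourier h (\<lambda>\<xi>. indicator B (P \<xi>) * F \<xi>)"
    using has_fourier_surj[OF indicator_mult_L2[OF has_fourier_L2(2)[OF f] B]] f by blast
  from someI_ex[OF this] obtain G where G: "has_fourier f G"
      "has_fourier (fourier_projection P B f) (\<lambda>\<xi>. indicator B (P \<xi>) * G \<xi>)"
    unfolding fourier_projection_def by blast
  show ?thesis
    by (rule has_fourier_cong[OF G(2) ae_eq_refl ae_eq_mult[OF has_fourier_unique[OF G(1) f]]])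
qed

text \<open>The distribution of the symbol under the density of \<open>F\<close>, that is, the
  scalar spectral measure of a function with transform \<open>F\<close>. The divisor compensates the
  Plancherel constant.\<close>

definition symbol_distr :: "'n cfun \<Rightarrow> real measure" where
  "symbol_distr F = distr (density lebesgue (\<lambda>\<xi>. ennreal ((cmod (F \<xi>))\<^sup>2 / (2 * pi) ^ CARD('n)))) borel P"

lemma emeasure_symbol_distr:
  assumes f: "has_fourier f F" and B: "B \<in> sets borel"
  shows "emeasure (symbol_distr F) B = ennreal ((L2_norm (fourier_projection P B f))\<^sup>2)"
proof -
  let ?c = "(2 * pi) ^ CARD('n)"
  let ?FB = "\<lambda>\<xi>. indicator B (P \<xi>) * F \<xi>"
  have F: "F \<in> L2" and [measurable]: "F \<in> borel_measurable lebesgue" "B \<in> sets borel"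
    using has_fourier_L2[OF f] B by auto
  have PB: "P -` B \<in> sets lebesgue"
    using measurable_sets[OF P B] by simp
  have "emeasure (symbol_distr F) B = emeasure (density lebesgue (\<lambda>\<xi>. ennreal ((cmod (F \<xi>))\<^sup>2 / ?c))) (P -` B)"
    unfolding symbol_distr_def using B by (subst emeasure_distr) auto
  also have "\<dots> = (\<integral>\<^sup>+\<xi>. ennreal ((cmod (F \<xi>))\<^sup>2 / ?c) * indicator (P -` B) \<xi> \<partial>lebesgue)"
    by (rule emeasure_density[OF _ PB]) measurable
  also have "\<dots> = (\<integral>\<^sup>+\<xi>. ennreal (1 / ?c) * ennreal ((cmod (?FB \<xi>))\<^sup>2) \<partial>lebesgue)"
    by (intro nn_integral_cong) (auto simp: indicator_def simp flip: ennreal_mult)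
  also have "\<dots> = ennreal (1 / ?c) * ennreal ((L2_norm ?FB)\<^sup>2)"
    using L2_measurable[OF indicator_mult_L2[OF F B]] nn_integral_L2_norm[OF indicator_mult_L2[OF F B]]
    by (subst nn_integral_cmult) simp_all
  also have "\<dots> = ennreal (1 / ?c * (L2_norm ?FB)\<^sup>2)"
    by (rule ennreal_mult[symmetric]) simp_all
  also have "(L2_norm ?FB)\<^sup>2 = ?c * (L2_norm (fourier_projection P B f))\<^sup>2"
    by (subst Plancherel_norm[OF has_fourier_projection[OF f B]]) (simp add: power_mult_distrib)
  finally show ?thesis by simp
qed

lemma finite_symbol_distr: "has_fourier f F \<Longrightarrow> finite_measure (symbol_distr F)"
  by standard (subst emeasure_symbol_distr, auto simp: symbol_distr_def)

lemma inner_fourier_projection: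
  assumes f: "has_fourier f F" and g: "has_fourier g G" and B: "B \<in> sets borel"
  shows "of_real ((2 * pi) ^ CARD('n)) * L2_inner (fourier_projection P B f) g
    = (LINT \<xi>|lebesgue. indicator B (P \<xi>) * (F \<xi> * cnj (G \<xi>)))"
  unfolding Plancherel[OF has_fourier_projection[OF f B] g, symmetric]
  by (simp only: L2_inner_def mult.assoc)

lemma fourier_projection_inner_self:
  assumes f: "has_fourier f F" and B: "B \<in> sets borel"
  shows "L2_inner (fourier_projection P B f) f = of_real (measure (symbol_distr F) B)"
proof -
  let ?c = "complex_of_real ((2 * pi) ^ CARD('n))"
  have Bf: "has_fourier (fourier_projection P B f) (\<lambda>\<xi>. indicator B (P \<xi>) * F \<xi>)"
    by (rule has_fourier_projection[OF f B])
  have "?c * L2_inner (fourier_projection P B f) (fourier_projection P B f)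
      = L2_inner (\<lambda>\<xi>. indicator B (P \<xi>) * F \<xi>) (\<lambda>\<xi>. indicator B (P \<xi>) * F \<xi>)"
    by (rule Plancherel[OF Bf Bf, symmetric])
  also have "\<dots> = (LINT \<xi>|lebesgue. indicator B (P \<xi>) * (F \<xi> * cnj (F \<xi>)))"
    unfolding L2_inner_def by (intro Bochner_Integration.integral_cong) (auto simp: indicator_def)
  also have "\<dots> = ?c * L2_inner (fourier_projection P B f) f"
    by (rule inner_fourier_projection[OF f f B, symmetric])
  finally have "L2_inner (fourier_projection P B f) f = L2_inner (fourier_projection P B f) (fourier_projection P B f)"
    by simp
  moreover have "measure (symbol_distr F) B = (L2_norm (fourier_projection P B f))\<^sup>2"
    using emeasure_symbol_distr[OF f B] by (simp add: measure_def)
  ultimately show ?thesis by (simp add: L2_inner_self)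
qed

lemma projection_valued_measure_fourier: "projection_valued_measure (fourier_projection P)"
  unfolding projection_valued_measure_def
proof (intro conjI ballI allI impI)
  let ?E = "fourier_projection P"
  let ?c = "complex_of_real ((2 * pi) ^ CARD('n))"
  have c: "?c \<noteq> 0" by simp
  fix f :: "'n cfun" assume f: "f \<in> L2"
  then obtain F where F: "has_fourier f F" using has_fourier_exists by blast
  show "?E B f \<in> L2" if "B \<in> sets borel" for B
    using has_fourier_L2(1)[OF has_fourier_projection[OF F that]] .
  show "L2_inner (?E B f) g = L2_inner f (?E B g)" if B: "B \<in> sets borel" and g: "g \<in> L2" for B g
  proof -
    obtain G where G: "has_fourier g G" using has_fourier_exists[OF g] by blast
    have "?c * L2_inner (?E B f) g = (LINT \<xi>|lebesgue. cnj (indicator B (P \<xi>) * (G \<xi> * cnj (F \<xi>))))"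
      unfolding inner_fourier_projection[OF F G B]
      by (intro Bochner_Integration.integral_cong) (auto simp: indicator_def)
    also have "\<dots> = cnj (?c * L2_inner (?E B g) f)"
      unfolding inner_fourier_projection[OF G F B] by (rule Bochner_Integration.integral_cnj)
    finally have "?c * L2_inner (?E B f) g = ?c * cnj (L2_inner (?E B g) f)"
      by simp
    then have "L2_inner (?E B f) g = cnj (L2_inner (?E B g) f)"
      by (rule mult_left_cancel[OF c, THEN iffD1])
    then show ?thesis
      by (simp only: L2_inner_cnj[of f "?E B g", symmetric])
  qed
  show "?E (B \<inter> C) f =\<^sub>a\<^sub>e ?E B (?E C f)" if B: "B \<in> sets borel" and C: "C \<in> sets borel" for B C
  proof (subst has_fourier_ae_eq_iff)
    show "has_fourier (?E (B \<inter> C) f) (\<lambda>\<xi>. indicator (B \<inter> C) (P \<xi>) * F \<xi>)"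
      using B C by (intro has_fourier_projection F) auto
    show "has_fourier (?E B (?E C f)) (\<lambda>\<xi>. indicator B (P \<xi>) * (indicator C (P \<xi>) * F \<xi>))"
      by (intro has_fourier_projection F B C)
  qed (simp add: ae_eq_def indicator_inter_arith mult.assoc)
  show "?E UNIV f =\<^sub>a\<^sub>e f"
    using has_fourier_ae_eq_iff[OF has_fourier_projection[OF F, of UNIV] F] by simp
  show "(\<lambda>n. L2_inner (?E (B n) f) f) sums L2_inner (?E (\<Union>n. B n) f) f"
    if B: "range B \<subseteq> sets borel" "disjoint_family B" for B :: "nat \<Rightarrow> real set"
  proof -
    have "B n \<in> sets borel" for n using B by auto
    moreover have "(\<lambda>n. measure (symbol_distr F) (B n)) sums measure (symbol_distr F) (\<Union>n. B n)"
      using B by (intro finite_measure.finite_measure_UNION[OF finite_symbol_distr[OF F]]) (auto simp: symbol_distr_def)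
    ultimately show ?thesis
      by (simp add: fourier_projection_inner_self[OF F] sets.countable_UN sums_of_real_iff)
  qed
qed

lemma scalar_measure_fourier:
  assumes "has_fourier f F"
  shows "scalar_measure (fourier_projection P) f = symbol_distr F"
proof (rule measure_eqI)
  show "sets (scalar_measure (fourier_projection P) f) = sets (symbol_distr F)"
    by (simp add: symbol_distr_def)
  show "emeasure (scalar_measure (fourier_projection P) f) B = emeasure (symbol_distr F) B"
    if "B \<in> sets (scalar_measure (fourier_projection P) f)" for B
    using that emeasure_symbol_distr[OF assms, of B]
      emeasure_scalar_measure[OF projection_valued_measure_fourier has_fourier_L2(1)[OF assms], of B] by simp
qed

lemma integral_symbol_distr:
  fixes g :: "real \<Rightarrow> 'b::{banach, second_countable_topology}"
  assumes F: "F \<in> L2" and g: "g \<in> borel_measurable borel"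
  shows "(LINT r|symbol_distr F. g r) = (LINT \<xi>|lebesgue. ((cmod (F \<xi>))\<^sup>2 / (2 * pi) ^ CARD('n)) *\<^sub>R g (P \<xi>))"
    and "integrable (symbol_distr F) g \<longleftrightarrow> integrable lebesgue (\<lambda>\<xi>. ((cmod (F \<xi>))\<^sup>2 / (2 * pi) ^ CARD('n)) *\<^sub>R g (P \<xi>))"
proof -
  have [measurable]: "F \<in> borel_measurable lebesgue" using F by measurable
  have gP: "(\<lambda>\<xi>. g (P \<xi>)) \<in> borel_measurable lebesgue"
    by (rule measurable_comp_symbol[OF g])
  show "(LINT r|symbol_distr F. g r) = (LINT \<xi>|lebesgue. ((cmod (F \<xi>))\<^sup>2 / (2 * pi) ^ CARD('n)) *\<^sub>R g (P \<xi>))"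
    unfolding symbol_distr_def using g gP
    by (subst integral_distr) (auto simp: integral_density)
  show "integrable (symbol_distr F) g \<longleftrightarrow> integrable lebesgue (\<lambda>\<xi>. ((cmod (F \<xi>))\<^sup>2 / (2 * pi) ^ CARD('n)) *\<^sub>R g (P \<xi>))"
    unfolding symbol_distr_def using g gP
    by (subst integrable_distr_eq) (auto simp: integrable_density)
qed

lemma spectral_domain_fourier:
  assumes f: "has_fourier f F" and g: "g \<in> borel_measurable borel"
  shows "f \<in> spectral_domain (fourier_projection P) g \<longleftrightarrow> (\<lambda>\<xi>. g (P \<xi>) * F \<xi>) \<in> L2"
proof -
  let ?c = "(2 * pi) ^ CARD('n)"
  have gP: "(\<lambda>\<xi>. g (P \<xi>)) \<in> borel_measurable lebesgue"
    by (rule measurable_comp_symbol[OF g])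
  have F: "F \<in> borel_measurable lebesgue"
    using has_fourier_L2(2)[OF f] by measurable
  have "f \<in> spectral_domain (fourier_projection P) g \<longleftrightarrow>
      integrable lebesgue (\<lambda>\<xi>. ((cmod (F \<xi>))\<^sup>2 / ?c) *\<^sub>R (cmod (g (P \<xi>)))\<^sup>2)"
    unfolding spectral_domain_def
    using has_fourier_L2[OF f] g by (simp add: scalar_measure_fourier[OF f] integral_symbol_distr(2))
  also have "(\<lambda>\<xi>. ((cmod (F \<xi>))\<^sup>2 / ?c) *\<^sub>R (cmod (g (P \<xi>)))\<^sup>2) = (\<lambda>\<xi>. (cmod (g (P \<xi>) * F \<xi>))\<^sup>2 / ?c)"
    by (auto simp: norm_mult power_mult_distrib)
  also have "integrable lebesgue (\<lambda>\<xi>. (cmod (g (P \<xi>) * F \<xi>))\<^sup>2 / ?c) \<longleftrightarrow> (\<lambda>\<xi>. g (P \<xi>) * F \<xi>) \<in> L2"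
  proof -
    have "integrable lebesgue (\<lambda>\<xi>. (cmod (g (P \<xi>) * F \<xi>))\<^sup>2 / ?c) \<longleftrightarrow> integrable lebesgue (\<lambda>\<xi>. (cmod (g (P \<xi>) * F \<xi>))\<^sup>2)"
      by (rule integrable_divide_iff) simp
    then show ?thesis
      using gP F by (simp add: L2_def)
  qed
  finally show ?thesis .
qed

text \<open>On the Fourier side polarization can be undone pointwise under the integral: the four
  squares of \<open>F + \<i> ^ j * K\<close> combine to \<open>F * cnj K\<close>. The two
  \<open>L2\<close> assumptions make each of the four integrals converge, so that they may be
  added.\<close>

lemma spectral_integral_fourier:
  assumes f: "has_fourier f F" and k: "has_fourier k K" and g: "g \<in> borel_measurable borel"
    and gF: "(\<lambda>\<xi>. g (P \<xi>) * F \<xi>) \<in> L2" and gK: "(\<lambda>\<xi>. g (P \<xi>) * K \<xi>) \<in> L2"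
  shows "of_real ((2 * pi) ^ CARD('n)) * spectral_integral (fourier_projection P) g f k = L2_inner (\<lambda>\<xi>. g (P \<xi>) * F \<xi>) K"
proof -
  define c where "c = complex_of_real ((2 * pi) ^ CARD('n))"
  have c: "c \<noteq> 0" by (simp add: c_def)
  note L = has_fourier_L2(2)[OF f] has_fourier_L2(2)[OF k]
  let ?H = "\<lambda>j \<xi>. F \<xi> + \<i> ^ j * K \<xi>"
  have h: "has_fourier (\<lambda>x. f x + \<i> ^ j * k x) (?H j)" for j
    using has_fourier_lincomb[OF f k, of 1 "\<i> ^ j"] by simp
  have HL: "?H j \<in> L2" for j by (rule has_fourier_L2(2)[OF h])
  have int: "integrable lebesgue (\<lambda>\<xi>. g (P \<xi>) * (?H j \<xi> * cnj (?H j \<xi>)))" for j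
  proof -
    have "(\<lambda>\<xi>. g (P \<xi>) * ?H j \<xi>) \<in> L2"
      using L2_add[OF gF L2_scale[OF gK, of "\<i> ^ j"]] by (simp add: algebra_simps)
    from L2_integrable_inner[OF this HL[of j]] show ?thesis by (simp add: mult.assoc)
  qed
  have "c * (LINT r|scalar_measure (fourier_projection P) (\<lambda>x. f x + \<i> ^ j * k x). g r)
      = (LINT \<xi>|lebesgue. g (P \<xi>) * (?H j \<xi> * cnj (?H j \<xi>)))" for j
    unfolding scalar_measure_fourier[OF h] integral_symbol_distr(1)[OF HL g]
    by (subst integral_mult_right_zero[symmetric], intro Bochner_Integration.integral_cong refl)
       (simp add: scaleR_conv_of_real c_def complex_norm_square[symmetric] del: complex_cnj_add)
  then have "c * spectral_integral (fourier_projection P) g f k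
      = (\<Sum>j<4. \<i> ^ j * (LINT \<xi>|lebesgue. g (P \<xi>) * (?H j \<xi> * cnj (?H j \<xi>)))) / 4"
    unfolding spectral_integral_def by (simp add: sum_distrib_left mult.left_commute[of c])
  also have "\<dots> = (LINT \<xi>|lebesgue. (\<Sum>j<4. \<i> ^ j * (g (P \<xi>) * (?H j \<xi> * cnj (?H j \<xi>)))) / 4)"
    using int by (simp add: Bochner_Integration.integral_sum)
  also have "\<dots> = (LINT \<xi>|lebesgue. g (P \<xi>) * F \<xi> * cnj (K \<xi>))"
  proof (intro Bochner_Integration.integral_cong refl)
    fix \<xi>
    show "(\<Sum>j<4. \<i> ^ j * (g (P \<xi>) * (?H j \<xi> * cnj (?H j \<xi>)))) / 4 = g (P \<xi>) * F \<xi> * cnj (K \<xi>)"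
      by (simp add: eval_nat_numeral algebra_simps)
  qed
  finally show ?thesis
    unfolding L2_inner_def c_def .
qed

text \<open>The implication from left to right is the substantial one:
  \<open>spectral_operator\<close> offers only a weak identity against the spectral domain, so
  enough elements of that domain have to be produced.\<close>

theorem spectral_operator_fourier:
  assumes g: "g \<in> borel_measurable borel"
  shows "spectral_operator (fourier_projection P) g f h \<longleftrightarrow>
    (\<exists>F. has_fourier f F \<and> has_fourier h (\<lambda>\<xi>. g (P \<xi>) * F \<xi>))"
proof
  let ?c = "complex_of_real ((2 * pi) ^ CARD('n))"
  have gP: "(\<lambda>\<xi>. g (P \<xi>)) \<in> borel_measurable lebesgue"
    by (rule measurable_comp_symbol[OF g])
  {
    assume op: "spectral_operator (fourier_projection P) g f h"
    then have f: "f \<in> spectral_domain (fourier_projection P) g" and hL: "h \<in> L2"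
      and hk: "\<And>k. k \<in> spectral_domain (fourier_projection P) g \<Longrightarrow>
        L2_inner h k = spectral_integral (fourier_projection P) g f k"
      by (auto simp: spectral_operator_def)
    then have "f \<in> L2" by (simp add: spectral_domain_def)
    then obtain F H where F: "has_fourier f F" and H: "has_fourier h H"
      using has_fourier_exists hL by blast
    let ?G = "\<lambda>\<xi>. g (P \<xi>) * F \<xi>"
    have G: "?G \<in> L2" using spectral_domain_fourier[OF F g] f by simp
    define D where "D \<xi> = H \<xi> - ?G \<xi>" for \<xi>
    have D: "D \<in> L2"
      unfolding D_def[abs_def] by (intro L2_diff has_fourier_L2(2)[OF H] G)
    have [measurable]: "(\<lambda>\<xi>. g (P \<xi>)) \<in> borel_measurable lebesgue" "D \<in> borel_measurable lebesgue"
      using gP D by auto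
    let ?Q = "\<lambda>n \<xi>. cmod (g (P \<xi>)) \<le> real n"
    \<comment> \<open>Cutting \<open>D\<close> off where the symbol is large makes
      \<open>g (P \<xi>) * K n \<xi>\<close> square integrable, so the function with transform
      \<open>K n\<close> is an admissible test function; as \<open>K n\<close> tends to
      \<open>D\<close>, orthogonality to all \<open>K n\<close> gives \<open>D = 0\<close>.\<close>
    define K where "K n \<xi> = (if ?Q n \<xi> then D \<xi> else 0)" for n \<xi>
    have KD: "L2_tendsto K D"
      unfolding K_def[abs_def]
    proof (rule L2_tendsto_truncate[OF D])
      fix \<xi>
      obtain m where "cmod (g (P \<xi>)) \<le> real m"
        using real_arch_simple by blast
      then show "\<forall>\<^sub>F n in sequentially. ?Q n \<xi>"
        by (intro eventually_sequentiallyI[of m]) auto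
    qed measurable
    have "L2_inner D (K n) = 0" for n
    proof -
      have KL: "K n \<in> L2" by (rule L2_tendstoD(1)[OF KD])
      then obtain k where k: "has_fourier k (K n)" using has_fourier_surj by blast
      have gK: "(\<lambda>\<xi>. g (P \<xi>) * K n \<xi>) \<in> L2"
      proof (rule L2_dominated)
        show "integrable lebesgue (\<lambda>\<xi>. (real n)\<^sup>2 * (cmod (D \<xi>))\<^sup>2)"
          using L2_integrable[OF D] by simp
        show "AE \<xi> in lebesgue. (cmod (g (P \<xi>) * K n \<xi>))\<^sup>2 \<le> (real n)\<^sup>2 * (cmod (D \<xi>))\<^sup>2"
          by (auto simp: K_def norm_mult power_mult_distrib intro!: mult_right_mono power_mono)
      qed (use L2_measurable[OF KL] gP in auto)
      then have "L2_inner h k = spectral_integral (fourier_projection P) g f k"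
        by (intro hk) (simp add: spectral_domain_fourier[OF k g])
      then have "L2_inner H (K n) = L2_inner ?G (K n)"
        by (simp only: Plancherel[OF H k] spectral_integral_fourier[OF F k g G gK])
      then show ?thesis
        using L2_inner_diff_left[OF has_fourier_L2(2)[OF H] G KL] by (simp add: D_def[abs_def])
    qed
    then have "L2_inner D D = 0"
      using L2_tendsto_inner[OF L2_tendsto_const[OF D] KD] by (simp add: LIMSEQ_const_iff)
    then have "H =\<^sub>a\<^sub>e ?G"
      by (intro L2_norm_diff_eq_0 has_fourier_L2(2)[OF H] G) (simp add: L2_inner_self D_def[abs_def])
    then show "\<exists>F. has_fourier f F \<and> has_fourier h (\<lambda>\<xi>. g (P \<xi>) * F \<xi>)"
      using F has_fourier_cong[OF H ae_eq_refl] by blast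
  }
  {
    assume "\<exists>F. has_fourier f F \<and> has_fourier h (\<lambda>\<xi>. g (P \<xi>) * F \<xi>)"
    then obtain F where F: "has_fourier f F" and h: "has_fourier h (\<lambda>\<xi>. g (P \<xi>) * F \<xi>)" by blast
    note G = has_fourier_L2(2)[OF h]
    have "L2_inner h k = spectral_integral (fourier_projection P) g f k"
      if k: "k \<in> spectral_domain (fourier_projection P) g" for k
    proof -
      have "k \<in> L2" using k by (simp add: spectral_domain_def)
      then obtain K where K: "has_fourier k K" using has_fourier_exists by blast
      have "?c * L2_inner h k = ?c * spectral_integral (fourier_projection P) g f k"
        using spectral_integral_fourier[OF F K g G] Plancherel[OF h K] spectral_domain_fourier[OF K g] k
        by simp
      then show ?thesis by simp
    qed
    then show "spectral_operator (fourier_projection P) g f h"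
      using g G F has_fourier_L2(1)[OF h] by (auto simp: spectral_operator_def spectral_domain_fourier)
  }
qed

lemma is_spectral_measure_fourier: "is_spectral_measure (fourier_multiplier P) (fourier_projection P)"
  unfolding is_spectral_measure_def
proof (intro conjI ext)
  show "projection_valued_measure (fourier_projection P)" by (rule projection_valued_measure_fourier)
  show "fourier_multiplier P f h = spectral_operator (fourier_projection P) complex_of_real f h" for f h
    by (subst spectral_operator_fourier) (auto simp: fourier_multiplier_def)
qed

text \<open>The Fourier projections witness the existential quantifier in \<open>fun_calc\<close>.
  Only this introduction direction is stated; consequences of a given \<open>fun_calc\<close> are
  drawn from an arbitrary \<open>E\<close>.\<close>

lemma fun_calc_fourier:
  assumes "g \<in> borel_measurable borel" "has_fourier f F" "has_fourier h (\<lambda>\<xi>. g (P \<xi>) * F \<xi>)"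
  shows "fun_calc (fourier_multiplier P) g f h"
  unfolding fun_calc_def
  using is_spectral_measure_fourier spectral_operator_fourier[OF assms(1)] assms(2,3) by blast

end

section \<open>Continuous versions of the unitary group\<close>

lemma L2_norm_mono:
  assumes "f \<in> L2" "g \<in> L2" "\<And>x. cmod (f x) \<le> cmod (g x)"
  shows "L2_norm f \<le> L2_norm g"
  unfolding L2_norm_def
  by (intro real_sqrt_le_mono integral_mono L2_integrable assms power_mono) auto

lemma norm_cis_diff_le: "cmod (cis a - cis b) \<le> \<bar>a - b\<bar>"
proof -
  have "cis a - cis b = cis b * (cis (a - b) - 1)"
    by (simp add: algebra_simps cis_mult)
  then have "cmod (cis a - cis b) = cmod (cis (a - b) - 1)"
    by (simp add: norm_mult)
  also have "\<dots> \<le> \<bar>a - b\<bar>"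
    using iexp_approx1[of "a - b" 0] by (simp add: cis_conv_exp)
  finally show ?thesis .
qed

text \<open>Self-adjointness: testing with \<open>k\<close> whose Fourier transform is \<open>P F\<close> cut off to \<open>P \<le> n\<close> turns
  the bound on \<open>k \<mapsto> \<langle>P(D) k, f\<rangle>\<close> provided by an arbitrary spectral measure \<open>E\<close> into a bound on the
  norm of this truncation of \<open>P F\<close>.\<close>
lemma spectral_domain_imp_multiplier_L2:
  fixes P :: "real^'n::finite \<Rightarrow> real"
  assumes P [measurable]: "P \<in> borel_measurable lebesgue" and P0: "\<And>\<xi>. 0 \<le> P \<xi>"
    and E: "is_spectral_measure (fourier_multiplier P) E"
    and f: "f \<in> spectral_domain E complex_of_real" and F: "has_fourier f F"
  shows "(\<lambda>\<xi>. of_real (P \<xi>) * F \<xi>) \<in> L2"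
proof -
  let ?c = "(2 * pi) ^ CARD('n)"
  have pvm: "projection_valued_measure E" and A: "fourier_multiplier P = spectral_operator E complex_of_real"
    using E by (auto simp: is_spectral_measure_def)
  have FL: "F \<in> L2" and [measurable]: "F \<in> borel_measurable lebesgue"
    using has_fourier_L2[OF F] by auto
  \<comment> \<open>By the isometry property of the functional calculus this is the value expected
    for the norm of \<open>P(D) f\<close>. It does not depend on the truncation level.\<close>
  define M where "M = sqrt (LINT r|scalar_measure E f. (cmod (complex_of_real r))\<^sup>2)"
  have M0: "0 \<le> M" by (simp add: M_def)
  define K where "K n \<xi> = (if P \<xi> \<le> real n then of_real (P \<xi>) * F \<xi> else 0)" for n \<xi>
  have bound: "K n \<in> L2 \<and> L2_norm (K n) \<le> sqrt ?c * M" for n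
  proof -
    define m where "m \<xi> = (if P \<xi> \<le> real n then P \<xi> else 0)" for \<xi>
    have [measurable]: "m \<in> borel_measurable lebesgue" unfolding m_def[abs_def] by measurable
    \<comment> \<open>The truncated symbol is either \<open>P\<close> or 0, hence the third
      identity. It makes the inner product of \<open>P * K n\<close> with \<open>F\<close> equal to
      the squared norm of \<open>K n\<close>.\<close>
    have m: "0 \<le> m \<xi>" "m \<xi> \<le> real n" "P \<xi> * m \<xi> = m \<xi> * m \<xi>" for \<xi>
      using P0[of \<xi>] by (auto simp: m_def)
    have K: "K n = (\<lambda>\<xi>. of_real (m \<xi>) * F \<xi>)"
      by (auto simp: K_def m_def)
    have KL: "K n \<in> L2"
      unfolding K using m by (intro L2_mult_bounded[OF FL, of _ "real n"]) auto
    have "(\<lambda>\<xi>. of_real (m \<xi>) * K n \<xi>) \<in> L2"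
      using m by (intro L2_mult_bounded[OF KL, of _ "real n"]) auto
    also have "(\<lambda>\<xi>. of_real (m \<xi>) * K n \<xi>) = (\<lambda>\<xi>. of_real (P \<xi>) * K n \<xi>)"
      unfolding K by (simp only: mult.assoc[symmetric] of_real_mult[symmetric] m(3))
    finally have PKL: "(\<lambda>\<xi>. of_real (P \<xi>) * K n \<xi>) \<in> L2" .
    obtain k h where k: "has_fourier k (K n)" and h: "has_fourier h (\<lambda>\<xi>. of_real (P \<xi>) * K n \<xi>)"
      using has_fourier_surj KL PKL by metis
    \<comment> \<open>Here the two descriptions of the operator meet: the image of \<open>k\<close>
      is known on the Fourier side, whereas about \<open>f\<close> only the information relative to
      \<open>E\<close> is available.\<close>
    have "spectral_operator E complex_of_real k h"
      unfolding A[symmetric] fourier_multiplier_def using k h by blast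
    then have hf: "L2_inner h f = spectral_integral E complex_of_real k f" and kd: "k \<in> spectral_domain E complex_of_real"
      using f by (auto simp: spectral_operator_def)
    have "L2_inner (\<lambda>\<xi>. of_real (P \<xi>) * K n \<xi>) F = L2_inner (K n) (K n)"
      unfolding L2_inner_def
    proof (intro Bochner_Integration.integral_cong refl)
      fix \<xi>
      have "complex_of_real (P \<xi> * m \<xi>) * (F \<xi> * cnj (F \<xi>)) = of_real (m \<xi> * m \<xi>) * (F \<xi> * cnj (F \<xi>))"
        by (simp only: m(3))
      then show "of_real (P \<xi>) * K n \<xi> * cnj (F \<xi>) = K n \<xi> * cnj (K n \<xi>)"
        by (simp add: K mult_ac)
    qed
    then have "of_real ?c * L2_inner h f = of_real ?c * L2_inner k k"
      by (simp only: Plancherel[OF h F, symmetric] Plancherel[OF k k, symmetric])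
    then have "L2_inner h f = of_real ((L2_norm k)\<^sup>2)"
      by (simp add: L2_inner_self)
    then have "(L2_norm k)\<^sup>2 = cmod (spectral_integral E complex_of_real k f)"
      by (simp add: hf[symmetric] norm_power)
    also have "\<dots> \<le> L2_norm k * M"
      unfolding M_def by (rule spectral_integral_bound[OF pvm _ kd f]) simp
    \<comment> \<open>Cancelling one factor leaves a bound uniform in \<open>n\<close>; Fatou's
      lemma then removes the truncation below.\<close>
    finally have "L2_norm k * L2_norm k \<le> L2_norm k * M"
      by (simp add: power2_eq_square)
    then have "L2_norm k \<le> M"
      using M0 L2_norm_nonneg[of k] by (cases "L2_norm k = 0") (auto simp: mult_le_cancel_left)
    then show ?thesis
      using KL Plancherel_norm[OF k] by (simp add: mult_left_mono)
  qed
  have "(\<integral>\<^sup>+\<xi>. ennreal ((cmod (of_real (P \<xi>) * F \<xi>))\<^sup>2) \<partial>lebesgue)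
      = (\<integral>\<^sup>+\<xi>. liminf (\<lambda>n. ennreal ((cmod (K n \<xi>))\<^sup>2)) \<partial>lebesgue)"
  proof (rule nn_integral_cong)
    fix \<xi>
    obtain n0 where "P \<xi> \<le> real n0" using real_arch_simple by blast
    then have "(\<lambda>n. ennreal ((cmod (K n \<xi>))\<^sup>2)) \<longlonglongrightarrow> ennreal ((cmod (of_real (P \<xi>) * F \<xi>))\<^sup>2)"
      by (intro tendsto_eventually eventually_sequentiallyI[of n0]) (auto simp: K_def)
    then show "ennreal ((cmod (of_real (P \<xi>) * F \<xi>))\<^sup>2) = liminf (\<lambda>n. ennreal ((cmod (K n \<xi>))\<^sup>2))"
      using lim_imp_Liminf[OF trivial_limit_sequentially] by fastforce
  qed
  also have "\<dots> \<le> liminf (\<lambda>n. \<integral>\<^sup>+\<xi>. ennreal ((cmod (K n \<xi>))\<^sup>2) \<partial>lebesgue)"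
  proof (rule nn_integral_liminf)
    have [measurable]: "K n \<in> borel_measurable lebesgue" for n
      using bound by (intro L2_measurable) blast
    show "(\<lambda>\<xi>. ennreal ((cmod (K n \<xi>))\<^sup>2)) \<in> borel_measurable lebesgue" for n
      by simp
  qed
  also have "\<dots> \<le> ennreal ((sqrt ?c * M)\<^sup>2)"
  proof (rule Liminf_le)
    show "\<forall>\<^sub>F n in sequentially. (\<integral>\<^sup>+\<xi>. ennreal ((cmod (K n \<xi>))\<^sup>2) \<partial>lebesgue) \<le> ennreal ((sqrt ?c * M)\<^sup>2)"
    proof (intro always_eventually allI)
      fix n
      have "(\<integral>\<^sup>+\<xi>. ennreal ((cmod (K n \<xi>))\<^sup>2) \<partial>lebesgue) = ennreal ((L2_norm (K n))\<^sup>2)"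
        by (rule nn_integral_L2_norm) (use bound in blast)
      also have "\<dots> \<le> ennreal ((sqrt ?c * M)\<^sup>2)"
        by (intro ennreal_leI power_mono) (use bound in auto)
      finally show "(\<integral>\<^sup>+\<xi>. ennreal ((cmod (K n \<xi>))\<^sup>2) \<partial>lebesgue) \<le> ennreal ((sqrt ?c * M)\<^sup>2)" .
    qed
  qed simp
  finally have le: "(\<integral>\<^sup>+\<xi>. ennreal ((cmod (of_real (P \<xi>) * F \<xi>))\<^sup>2) \<partial>lebesgue) \<le> ennreal ((sqrt ?c * M)\<^sup>2)" .
  show ?thesis
    by (rule L2_nn_integralI(1)[OF _ _ le]) (use M0 in auto)
qed

text \<open>On the unit interval around 0 the square of \<open>r\<close> is controlled by the
  constant 1, integrable because the scalar measure is finite; elsewhere it is controlled by the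
  larger power.\<close>

lemma spectral_domain_powr_imp:
  fixes f :: "'n::finite cfun"
  assumes E: "projection_valued_measure E" and \<delta>: "1 \<le> \<delta>"
    and f: "f \<in> spectral_domain E (\<lambda>r. complex_of_real (r powr \<delta>))"
  shows "f \<in> spectral_domain E complex_of_real"
proof -
  have fL: "f \<in> L2" and int: "integrable (scalar_measure E f) (\<lambda>r. (cmod (complex_of_real (r powr \<delta>)))\<^sup>2)"
    using f by (auto simp: spectral_domain_def)
  interpret finite_measure "scalar_measure E f"
    by (rule finite_scalar_measure[OF E fL])
  have "integrable (scalar_measure E f) (\<lambda>r. (cmod (complex_of_real r))\<^sup>2)"
  proof (rule Bochner_Integration.integrable_bound)
    show "integrable (scalar_measure E f) (\<lambda>r. 1 + (cmod (complex_of_real (r powr \<delta>)))\<^sup>2)"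
      using int by simp
    have "\<bar>r\<bar>\<^sup>2 \<le> 1 + \<bar>r powr \<delta>\<bar>\<^sup>2" for r :: real
    proof (cases "\<bar>r\<bar> \<le> 1")
      case True
      then have "\<bar>r\<bar>\<^sup>2 \<le> 1" by (simp add: abs_square_le_1)
      then show ?thesis by (smt (verit) zero_le_power2)
    next
      case False
      have "\<bar>r\<bar> powr 1 \<le> \<bar>r\<bar> powr \<delta>"
        using False \<delta> by (intro powr_mono) auto
      \<comment> \<open>Nothing proved about \<open>E\<close> confines it to the nonnegative
        half-line, so the estimate has to hold for negative \<open>r\<close> as well.\<close>
      also have "\<bar>r\<bar> powr \<delta> = \<bar>r powr \<delta>\<bar>"
        by (cases "0 \<le> r") (auto simp: uminus_powr_eq)
      finally have "\<bar>r\<bar> \<le> \<bar>r powr \<delta>\<bar>"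
        using False by simp
      then have "\<bar>r\<bar>\<^sup>2 \<le> \<bar>r powr \<delta>\<bar>\<^sup>2" by (intro power_mono) auto
      then show ?thesis by simp
    qed
    then show "AE r in scalar_measure E f. norm ((cmod (complex_of_real r))\<^sup>2) \<le> norm (1 + (cmod (complex_of_real (r powr \<delta>)))\<^sup>2)"
      by (auto intro!: AE_I2)
  qed simp
  then show ?thesis using fL by (simp add: spectral_domain_def)
qed

section \<open>Kolmogorov's continuity argument\<close>

definition dyadic :: "nat \<Rightarrow> real \<Rightarrow> real" where
  "dyadic n t = of_int \<lfloor>2 ^ n * t\<rfloor> / 2 ^ n"

lemma dyadic_le: "\<bar>dyadic n t - t\<bar> \<le> 1 / 2 ^ n"
proof -
  have "\<bar>of_int \<lfloor>2 ^ n * t\<rfloor> - 2 ^ n * t\<bar> \<le> 1" by linarith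
  then have "\<bar>of_int \<lfloor>2 ^ n * t\<rfloor> - 2 ^ n * t\<bar> / 2 ^ n \<le> 1 / 2 ^ n"
    by (rule divide_right_mono) simp
  moreover have "\<bar>of_int \<lfloor>2 ^ n * t\<rfloor> - 2 ^ n * t\<bar> / 2 ^ n = \<bar>(of_int \<lfloor>2 ^ n * t\<rfloor> - 2 ^ n * t) / 2 ^ n\<bar>"
    by (simp add: abs_divide)
  moreover have "(of_int \<lfloor>2 ^ n * t\<rfloor> - 2 ^ n * t) / 2 ^ n = dyadic n t - t"
    by (simp add: dyadic_def diff_divide_distrib)
  ultimately show ?thesis by simp
qed

text \<open>The pointwise half of Kolmogorov's argument: increments of geometric size along each
  dyadic grid make the approximations at level \<open>n\<close> converge uniformly near every point,
  and neighbouring grid cells differ by one more increment. The constant may depend on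
  \<open>N\<close>, since continuity is local.\<close>

lemma dyadic_limit_continuous:
  fixes w :: "real \<Rightarrow> complex"
  assumes p: "0 < p" "p < 1"
    and incr: "\<And>N. \<exists>D. \<forall>n. \<forall>k\<in>{- (int N * 2 ^ n)..<int N * 2 ^ n}.
      cmod (w (of_int (k + 1) / 2 ^ n) - w (of_int k / 2 ^ n)) \<le> D * p ^ n"
  shows "continuous_on UNIV (\<lambda>t. lim (\<lambda>n. w (dyadic n t)))"
proof -
  define v where "v n t = w (dyadic n t)" for n t
  define u where "u t = lim (\<lambda>n. v n t)" for t
  have "isCont u t0" for t0
  proof -
    \<comment> \<open>The window has to contain every \<open>t\<close> at distance less than 1 from
      \<open>t0\<close>.\<close>
    define N where "N = nat \<lceil>\<bar>t0\<bar> + 1\<rceil>"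
    have N: "\<bar>t0\<bar> + 1 \<le> real N" unfolding N_def by linarith
    obtain D where D: "\<And>n k. k \<in> {- (int N * 2 ^ n)..<int N * 2 ^ n} \<Longrightarrow>
        cmod (w (of_int (k + 1) / 2 ^ n) - w (of_int k / 2 ^ n)) \<le> D * p ^ n"
      using incr[of N] by blast
    \<comment> \<open>As \<open>N\<close> is positive, the index 0 belongs to the range, so
      \<open>D\<close> bounds a norm.\<close>
    have "D \<ge> 0"
    proof -
      have "0 < N" using N by linarith
      then show ?thesis using order_trans[OF norm_ge_zero D[of 0 0]] by simp
    qed
    have fl: "\<lfloor>2 ^ n * t\<rfloor> \<in> {- (int N * 2 ^ n)..<int N * 2 ^ n}" if "\<bar>t - t0\<bar> < 1" for n t
    proof -
      have tN: "- real N \<le> t" "t < real N" using that N by auto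
      have "(- real N) * 2 ^ n \<le> t * 2 ^ n" "t * 2 ^ n < real N * 2 ^ n"
        by (rule mult_right_mono[OF tN(1)], simp) (rule mult_strict_right_mono[OF tN(2)], simp)
      then have "of_int (- (int N * 2 ^ n)) \<le> 2 ^ n * t" "2 ^ n * t < of_int (int N * 2 ^ n)" by (simp_all add: mult.commute[of _ t])
      then show ?thesis by (simp add: le_floor_iff floor_less_iff)
    qed
    have step: "cmod (v (Suc n) t - v n t) \<le> D * p ^ n" if t: "\<bar>t - t0\<bar> < 1" for n t
    proof -
      define k where "k = \<lfloor>2 ^ n * t\<rfloor>"
      \<comment> \<open>Refining the grid either keeps the dyadic point or moves it right by one
        cell of the finer grid, so one increment at level \<open>Suc n\<close> suffices.\<close>
      have "\<lfloor>2 ^ Suc n * t\<rfloor> = 2 * k \<or> \<lfloor>2 ^ Suc n * t\<rfloor> = 2 * k + 1"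
        unfolding k_def by simp linarith
      then show ?thesis
      proof
        assume "\<lfloor>2 ^ Suc n * t\<rfloor> = 2 * k"
        then have "dyadic (Suc n) t = dyadic n t" by (simp add: dyadic_def k_def)
        then show ?thesis using \<open>D \<ge> 0\<close> p by (simp add: v_def)
      next
        assume *: "\<lfloor>2 ^ Suc n * t\<rfloor> = 2 * k + 1"
        have "int N * 2 ^ Suc n = 2 * (int N * 2 ^ n)" by simp
        then have "2 * k \<in> {- (int N * 2 ^ Suc n)..<int N * 2 ^ Suc n}"
          using fl[OF t, of n] unfolding k_def[symmetric] atLeastLessThan_iff by linarith
        then have "cmod (w (of_int (2 * k + 1) / 2 ^ Suc n) - w (of_int (2 * k) / 2 ^ Suc n)) \<le> D * p ^ Suc n"
          by (rule D)
        moreover have "of_int (2 * k) / 2 ^ Suc n = dyadic n t" by (simp add: dyadic_def k_def)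
        moreover have "of_int (2 * k + 1) / 2 ^ Suc n = dyadic (Suc n) t" unfolding dyadic_def * ..
        moreover have "D * p ^ Suc n \<le> D * p ^ n"
          using \<open>D \<ge> 0\<close> p by (intro mult_left_mono power_decreasing) auto
        ultimately show ?thesis by (simp add: v_def)
      qed
    qed
    have near: "cmod (u t - v n t) \<le> D * p ^ n / (1 - p)" if t: "\<bar>t - t0\<bar> < 1" for n t
    proof -
      have geo: "summable (\<lambda>k. D * p ^ n * p ^ k)" for n
        using p by (intro summable_mult summable_geometric) simp
      have stepk: "cmod (v (Suc (k + n)) t - v (k + n) t) \<le> D * p ^ n * p ^ k" for k n
        using step[OF t, of "k + n"] by (simp add: power_add mult_ac)
      have summ: "summable (\<lambda>k. v (Suc (k + n)) t - v (k + n) t)" for n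
        by (rule summable_comparison_test'[OF geo[of n], where N=0]) (rule stepk)
      have "(\<lambda>m. \<Sum>k<m. v (Suc (k + n)) t - v (k + n) t) \<longlonglongrightarrow> (\<Sum>k. v (Suc (k + n)) t - v (k + n) t)" for n
        by (rule summable_LIMSEQ[OF summ])
      moreover have tel: "(\<Sum>k<m. v (Suc (k + n)) t - v (k + n) t) = v (m + n) t - v n t" for m n
        using sum_lessThan_telescope[of "\<lambda>k. v (k + n) t" m] by simp
      ultimately have L: "(\<lambda>m. v (m + n) t - v n t) \<longlonglongrightarrow> (\<Sum>k. v (Suc (k + n)) t - v (k + n) t)" for n
        by simp
      have L': "(\<lambda>m. v (m + n) t) \<longlonglongrightarrow> (\<Sum>k. v (Suc (k + n)) t - v (k + n) t) + v n t" for n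
        using tendsto_add[OF L[of n] tendsto_const[of "v n t"]] by simp
      then have "(\<lambda>m. v m t) \<longlonglongrightarrow> (\<Sum>k. v (Suc (k + n)) t - v (k + n) t) + v n t"
        by (rule LIMSEQ_offset)
      then have "u t = (\<Sum>k. v (Suc (k + n)) t - v (k + n) t) + v n t"
        unfolding u_def by (rule limI)
      then have "cmod (u t - v n t) = cmod (\<Sum>k. v (Suc (k + n)) t - v (k + n) t)"
        by simp
      also have "\<dots> \<le> (\<Sum>k. D * p ^ n * p ^ k)"
        by (rule norm_suminf_le[OF stepk geo])
      also have "\<dots> = D * p ^ n / (1 - p)"
        using p by (subst suminf_mult) (simp_all add: suminf_geometric)
      finally show ?thesis .
    qed
    show ?thesis
      unfolding continuous_at_eps_delta
    proof (intro allI impI)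
      fix e :: real assume e: "0 < e"
      \<comment> \<open>Two distances to level \<open>n\<close>, each at most
        \<open>D * p ^ n / (1 - p)\<close>, and one grid increment; the final 1 keeps
        \<open>C\<close> positive when \<open>D = 0\<close>.\<close>
      define C where "C = 2 * D / (1 - p) + D + 1"
      have C: "0 < C" using \<open>D \<ge> 0\<close> p by (simp add: C_def add_nonneg_pos)
      obtain n where n: "p ^ n < e / C"
        using real_arch_pow_inv[of "e / C" p] e C p by auto
      have "cmod (u t - u t0) < e" if t: "\<bar>t - t0\<bar> < min 1 (1 / 2 ^ n)" for t
      proof -
        have t1: "\<bar>t - t0\<bar> < 1" "\<bar>t0 - t0\<bar> < 1" using t unfolding min_less_iff_conj by auto
        define k j where "k = \<lfloor>2 ^ n * t0\<rfloor>" and "j = \<lfloor>2 ^ n * t\<rfloor>"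
        have "\<bar>2 ^ n * t - 2 ^ n * t0\<bar> < 1"
        proof -
          have "\<bar>2 ^ n * t - 2 ^ n * t0\<bar> = 2 ^ n * \<bar>t - t0\<bar>"
            by (simp add: right_diff_distrib[symmetric] abs_mult)
          also have "\<dots> < 1" using t by (simp add: field_simps)
          finally show ?thesis .
        qed
        \<comment> \<open>Points closer than one cell width lie in the same cell or in adjacent
          ones.\<close>
        then have "j = k \<or> j = k + 1 \<or> k = j + 1"
          unfolding k_def j_def by linarith
        then have "cmod (v n t - v n t0) \<le> D * p ^ n"
          using D[OF fl[OF t1(1)], of n] D[OF fl[OF t1(2)], of n] \<open>D \<ge> 0\<close> p
          by (auto simp: v_def dyadic_def k_def[symmetric] j_def[symmetric] norm_minus_commute)
        then have "cmod (u t - u t0) \<le> D * p ^ n / (1 - p) + D * p ^ n + D * p ^ n / (1 - p)"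
          using near[OF t1(1), of n] near[OF t1(2), of n]
          by (smt (verit) norm_diff_triangle_ineq norm_minus_commute norm_triangle_ineq4 norm_diff_triangle_le)
        also have "\<dots> \<le> C * p ^ n"
          using p by (simp add: C_def divide_inverse algebra_simps)
        also have "\<dots> < e"
          using n C by (simp add: field_simps)
        finally show ?thesis .
      qed
      then show "\<exists>d>0. \<forall>t. dist t t0 < d \<longrightarrow> dist (u t) (u t0) < e"
        by (intro exI[of _ "min 1 (1 / 2 ^ n)"]) (auto simp: dist_norm)
    qed
  qed
  then have "continuous_on UNIV u"
    by (simp add: continuous_at_imp_continuous_on)
  then show ?thesis
    by (simp add: u_def[abs_def] v_def)
qed

text \<open>Kolmogorov's argument: the squared increments over the dyadic intervals of length \<open>2\<^sup>-\<^sup>n\<close> in a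
  bounded interval have total integral of order \<open>2\<^sup>-\<^sup>n\<close>.\<close>
lemma L2_Lipschitz_continuous_version:
  fixes U :: "real \<Rightarrow> 'n::finite cfun"
  assumes U: "\<And>t. U t \<in> L2" and M: "0 \<le> M" and lip: "\<And>s t. L2_norm (\<lambda>x. U t x - U s x) \<le> M * \<bar>t - s\<bar>"
  shows "\<exists>u. (\<forall>t. U t =\<^sub>a\<^sub>e u t) \<and> (AE x in lebesgue. continuous_on UNIV (\<lambda>t. u t x))"
proof -
  define u where "u t x = lim (\<lambda>n. U (dyadic n t) x)" for t x
  have meas [measurable]: "U t \<in> borel_measurable lebesgue" for t using U by measurable
  have nn: "(\<integral>\<^sup>+x. ennreal ((cmod (U t x - U s x))\<^sup>2) \<partial>lebesgue) \<le> ennreal ((M * d)\<^sup>2)" if "\<bar>t - s\<bar> \<le> d" for s t d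
  proof -
    have "L2_norm (\<lambda>x. U t x - U s x) \<le> M * d"
      using lip[of t s] mult_left_mono[OF that M] by simp
    then show ?thesis
      by (subst nn_integral_L2_norm[OF L2_diff[OF U U]]) (intro ennreal_leI power_mono, auto)
  qed
  have "U t =\<^sub>a\<^sub>e u t" for t
  proof -
    \<comment> \<open>For fixed \<open>t\<close> the Lipschitz bound at distance
      \<open>1 / 2 ^ n\<close> has exactly the form \<open>M\<^sup>2 * (q\<^sup>2) ^ n\<close> with
      \<open>q = 1/2\<close>, so the dyadic values converge to \<open>U t\<close> almost
      everywhere.\<close>
    have "AE x in lebesgue. \<exists>C. \<forall>n. (cmod (U (dyadic n t) x - U t x))\<^sup>2 \<le> C * (1/2) ^ n"
    proof (rule AE_geometric_bound[where K="M\<^sup>2"])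
      fix n
      have "(M * (1 / 2 ^ n))\<^sup>2 = M\<^sup>2 * ((1/2)\<^sup>2) ^ n"
        by (simp only: power_mult_distrib power_one_over[symmetric] power_mult[symmetric] mult.commute[of n])
      then show "(\<integral>\<^sup>+x. ennreal ((cmod (U (dyadic n t) x - U t x))\<^sup>2) \<partial>lebesgue) \<le> ennreal (M\<^sup>2 * ((1/2)\<^sup>2) ^ n)"
        using nn[OF dyadic_le, of n t] by simp
    qed (intro borel_measurable_power borel_measurable_norm borel_measurable_diff meas, auto)
    then show ?thesis
      unfolding ae_eq_def
    proof eventually_elim
      case (elim x)
      then obtain C where C: "\<And>n. (cmod (U (dyadic n t) x - U t x))\<^sup>2 \<le> C * (1/2) ^ n" by blast
      have "(\<lambda>n. C * (1/2) ^ n) \<longlonglongrightarrow> 0"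
        by (intro tendsto_mult_right_zero LIMSEQ_power_zero) simp
      then have "(\<lambda>n. (cmod (U (dyadic n t) x - U t x))\<^sup>2) \<longlonglongrightarrow> 0"
        by (rule Lim_null_comparison[rotated]) (simp add: C)
      then have "(\<lambda>n. sqrt ((cmod (U (dyadic n t) x - U t x))\<^sup>2)) \<longlonglongrightarrow> sqrt 0"
        by (rule tendsto_real_sqrt)
      then have "(\<lambda>n. cmod (U (dyadic n t) x - U t x)) \<longlonglongrightarrow> 0" by simp
      then have "(\<lambda>n. U (dyadic n t) x) \<longlonglongrightarrow> U t x"
        by (rule LIM_zero_cancel[OF tendsto_norm_zero_cancel])
      then show ?case unfolding u_def by (rule limI[symmetric])
    qed
  qed
  moreover have "AE x in lebesgue. continuous_on UNIV (\<lambda>t. u t x)"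
  proof -
    define I where "I N n = {- (int N * 2 ^ n)..<int N * 2 ^ n}" for N n :: nat
    define S where "S N n x = (\<Sum>k\<in>I N n. (cmod (U (of_int (k + 1) / 2 ^ n) x - U (of_int k / 2 ^ n) x))\<^sup>2)" for N n x
    \<comment> \<open>There are \<open>2 * N * 2 ^ n\<close> increments, each with integral at most
      \<open>M\<^sup>2 / 4 ^ n\<close>, which gives the constant \<open>K\<close> and decay by
      \<open>1/2\<close>. The ratio \<open>49/64\<close> is chosen because its square exceeds
      \<open>1/2\<close>, while its square root is the rational \<open>7/8\<close>, the decay of the
      increments themselves.\<close>
    have "AE x in lebesgue. \<exists>C. \<forall>n. S N n x \<le> C * (49/64) ^ n" for N
    proof (rule AE_geometric_bound[where K="2 * real N * M\<^sup>2"])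
      fix n
      have "(\<integral>\<^sup>+x. ennreal (S N n x) \<partial>lebesgue)
          = (\<Sum>k\<in>I N n. \<integral>\<^sup>+x. ennreal ((cmod (U (of_int (k + 1) / 2 ^ n) x - U (of_int k / 2 ^ n) x))\<^sup>2) \<partial>lebesgue)"
        unfolding S_def by (subst nn_integral_sum[symmetric]) (auto simp: sum_ennreal)
      also have "\<dots> \<le> (\<Sum>k\<in>I N n. ennreal ((M * (1 / 2 ^ n))\<^sup>2))"
      proof (intro sum_mono nn)
        show "\<bar>of_int (k + 1) / 2 ^ n - of_int k / 2 ^ n\<bar> \<le> (1 / 2 ^ n :: real)" for k :: int
          by (simp add: diff_divide_distrib[symmetric])
      qed
      also have "\<dots> = of_nat (card (I N n)) * ennreal ((M * (1 / 2 ^ n))\<^sup>2)"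
        by simp
      also have "card (I N n) = 2 * N * 2 ^ n"
        unfolding I_def by (simp add: nat_mult_distrib nat_power_eq flip: distrib_right)
      also have "of_nat (2 * N * 2 ^ n) * ennreal ((M * (1 / 2 ^ n))\<^sup>2) = ennreal (real (2 * N * 2 ^ n) * (M * (1 / 2 ^ n))\<^sup>2)"
        by (subst ennreal_mult) (auto simp: ennreal_of_nat_eq_real_of_nat)
      also have "real (2 * N * 2 ^ n) * (M * (1 / 2 ^ n))\<^sup>2 = 2 * real N * M\<^sup>2 * (1/2) ^ n"
        by (simp add: power2_eq_square power_one_over field_simps)
      also have "\<dots> \<le> 2 * real N * M\<^sup>2 * ((49/64)\<^sup>2) ^ n"
        by (intro mult_left_mono power_mono) (auto simp: power2_eq_square)
      finally show "(\<integral>\<^sup>+x. ennreal (S N n x) \<partial>lebesgue) \<le> ennreal (2 * real N * M\<^sup>2 * ((49/64)\<^sup>2) ^ n)"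
        by (simp add: ennreal_leI)
    qed (auto simp: S_def[abs_def] sum_nonneg)
    then have "AE x in lebesgue. \<forall>N. \<exists>C. \<forall>n. S N n x \<le> C * (49/64) ^ n"
      by (simp add: AE_all_countable)
    then show ?thesis
    proof eventually_elim
      case (elim x)
      show ?case
        unfolding u_def
      proof (rule dyadic_limit_continuous[where p="7/8"])
        fix N
        obtain C where C: "\<And>n. S N n x \<le> C * (49/64) ^ n" using elim by blast
        have "cmod (U (of_int (k + 1) / 2 ^ n) x - U (of_int k / 2 ^ n) x) \<le> sqrt C * (7/8) ^ n" if "k \<in> I N n" for n k
        proof -
          have "(cmod (U (of_int (k + 1) / 2 ^ n) x - U (of_int k / 2 ^ n) x))\<^sup>2 \<le> S N n x"
            unfolding S_def by (rule member_le_sum[OF that]) (auto simp: I_def)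
          then have "(cmod (U (of_int (k + 1) / 2 ^ n) x - U (of_int k / 2 ^ n) x))\<^sup>2 \<le> C * (49/64) ^ n"
            using C[of n] by simp
          then have "cmod (U (of_int (k + 1) / 2 ^ n) x - U (of_int k / 2 ^ n) x) \<le> sqrt (C * (49/64) ^ n)"
            by (rule real_le_rsqrt)
          also have "\<dots> = sqrt C * (7/8) ^ n"
          proof -
            have "sqrt (49/64) = (7/8::real)" by (rule real_sqrt_unique) (auto simp: power2_eq_square)
            then show ?thesis by (simp only: real_sqrt_mult real_sqrt_power)
          qed
          finally show ?thesis .
        qed
        then show "\<exists>D. \<forall>n. \<forall>k\<in>{- (int N * 2 ^ n)..<int N * 2 ^ n}.
            cmod (U (of_int (k + 1) / 2 ^ n) x - U (of_int k / 2 ^ n) x) \<le> D * (7/8) ^ n"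
          unfolding I_def by blast
      qed auto
    qed
  qed
  ultimately show ?thesis by blast
qed

text \<open>The multipliers \<open>cis (t * P \<xi>)\<close> and \<open>cis (s * P \<xi>)\<close>
  differ by at most \<open>\<bar>t - s\<bar> * \<bar>P \<xi>\<bar>\<close>, so Plancherel gives a
  Lipschitz constant equal to the norm of \<open>P F\<close> divided by \<open>c\<close>. Passing
  from \<open>U\<close> to the continuous version changes each \<open>U t\<close> on a null set
  only, which \<open>has_fourier\<close> does not notice.\<close>

lemma unitary_group_continuous_version:
  fixes P :: "real^'n::finite \<Rightarrow> real"
  assumes P [measurable]: "P \<in> borel_measurable lebesgue"
    and F: "has_fourier f F" and PF: "(\<lambda>\<xi>. of_real (P \<xi>) * F \<xi>) \<in> L2"
  shows "\<exists>u. continuous_version (fourier_multiplier P) f UNIV u"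
proof -
  let ?G = "\<lambda>t \<xi>. cis (t * P \<xi>) * F \<xi>"
  have G: "?G t \<in> L2" for t
    by (rule L2_mult_bounded[OF has_fourier_L2(2)[OF F], of _ 1]) (auto simp: cis_conv_exp)
  have "\<forall>t. \<exists>h. has_fourier h (?G t)"
    using has_fourier_surj[OF G] by blast
  from choice[OF this] obtain U where U: "\<And>t. has_fourier (U t) (?G t)" by blast
  define c where "c = sqrt ((2 * pi) ^ CARD('n))"
  have c: "0 < c" by (simp add: c_def)
  define M where "M = L2_norm (\<lambda>\<xi>. of_real (P \<xi>) * F \<xi>) / c"
  have "L2_norm (\<lambda>x. U t x - U s x) \<le> M * \<bar>t - s\<bar>" for s t
  proof -
    have "c * L2_norm (\<lambda>x. U t x - U s x) = L2_norm (\<lambda>\<xi>. ?G t \<xi> - ?G s \<xi>)"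
      unfolding c_def by (rule Plancherel_norm[OF has_fourier_diff[OF U U], symmetric])
    also have "\<dots> \<le> L2_norm (\<lambda>\<xi>. of_real (t - s) * (of_real (P \<xi>) * F \<xi>))"
    proof (rule L2_norm_mono[OF L2_diff[OF G G] L2_scale[OF PF]])
      fix \<xi>
      have "cmod (?G t \<xi> - ?G s \<xi>) = cmod (cis (t * P \<xi>) - cis (s * P \<xi>)) * cmod (F \<xi>)"
        by (simp add: left_diff_distrib[symmetric] norm_mult)
      also have "\<dots> \<le> \<bar>t * P \<xi> - s * P \<xi>\<bar> * cmod (F \<xi>)"
        by (intro mult_right_mono norm_cis_diff_le) simp
      also have "\<dots> = cmod (of_real (t - s) * (of_real (P \<xi>) * F \<xi>))"
        by (simp only: norm_mult norm_of_real left_diff_distrib[symmetric] abs_mult mult.assoc)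
      finally show "cmod (?G t \<xi> - ?G s \<xi>) \<le> cmod (of_real (t - s) * (of_real (P \<xi>) * F \<xi>))" .
    qed
    also have "\<dots> = c * (M * \<bar>t - s\<bar>)"
      unfolding L2_norm_scale using c by (simp add: M_def flip: of_real_diff)
    finally show ?thesis using c by (simp add: mult_le_cancel_left)
  qed
  moreover have "0 \<le> M" using c by (simp add: M_def)
  ultimately obtain u where u: "\<And>t. U t =\<^sub>a\<^sub>e u t" "AE x in lebesgue. continuous_on UNIV (\<lambda>t. u t x)"
    using L2_Lipschitz_continuous_version[of U M] has_fourier_L2(1)[OF U] by blast
  have "unitary_op (fourier_multiplier P) t f (u t)" for t
    unfolding unitary_op_def
  proof (rule fun_calc_fourier[OF P _ F])
    show "has_fourier (u t) (?G t)"
      by (rule has_fourier_cong[OF U u(1) ae_eq_refl])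
  qed (auto simp: cis_conv_exp)
  then show ?thesis
    using u(2) unfolding continuous_version_def by blast
qed

lemma unitary_op_zero:
  assumes "unitary_op A 0 f h"
  shows "h =\<^sub>a\<^sub>e f"
  using assms spectral_operator_one unfolding unitary_op_def fun_calc_def is_spectral_measure_def by force

text \<open>A version is continuous up to and including time 0 for almost every \<open>x\<close>, so
  only its value there has to be identified, and \<open>unitary_op_zero\<close> does so for any
  spectral measure.\<close>

lemma continuous_version_tendsto:
  assumes "continuous_version A f {0..} u"
  shows "AE x in lebesgue. ((\<lambda>t. u t x) \<longlongrightarrow> f x) (at_right 0)"
proof -
  have "u 0 =\<^sub>a\<^sub>e f"
    using assms by (intro unitary_op_zero) (auto simp: continuous_version_def)
  moreover have "AE x in lebesgue. continuous_on {0..} (\<lambda>t. u t x)"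
    using assms by (auto simp: continuous_version_def)
  ultimately show ?thesis
    unfolding ae_eq_def
  proof eventually_elim
    case (elim x)
    from elim(2) have "((\<lambda>t. u t x) \<longlongrightarrow> u 0 x) (at 0 within {0..})"
      unfolding continuous_on_def by (rule bspec) simp
    then show ?case
      unfolding elim(1) by (rule tendsto_within_subset) auto
  qed
qed

text \<open>The exponent \<open>s / a\<close> turns growth of order \<open>a\<close> into growth of
  order \<open>s\<close>, which the Sobolev weight dominates.\<close>

lemma sobolev_op_dom_powr:
  fixes P :: "real^'n::finite \<Rightarrow> real"
  assumes P [measurable]: "P \<in> borel_measurable lebesgue" and P0: "\<And>\<xi>. 0 \<le> P \<xi>"
    and a: "0 < a" and s: "0 \<le> s" and cmp: "comparable_to_power P a" and f: "f \<in> sobolev s"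
  shows "f \<in> op_dom (op_powr (fourier_multiplier P) (s / a))"
proof -
  let ?\<delta> = "s / a"
  obtain F where F: "has_fourier f F" and FL: "(\<lambda>\<xi>. complex_of_real ((1 + (norm \<xi>)\<^sup>2) powr (s / 2)) * F \<xi>) \<in> L2"
    using f by (auto simp: sobolev_def)
  obtain C where C: "0 < C" and le: "AE \<xi> in lebesgue. P \<xi> \<le> C * norm \<xi> powr a"
    using cmp P0 unfolding comparable_to_power_def by (auto elim!: eventually_mono)
  have [measurable]: "F \<in> borel_measurable lebesgue"
    using has_fourier_L2[OF F] by auto
  have "(\<lambda>\<xi>. complex_of_real (P \<xi> powr ?\<delta>) * F \<xi>) \<in> L2"
  proof (rule L2_dominated[OF L2_integrable[OF L2_scale[OF FL, of "of_real (C powr ?\<delta>)"]]])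
    show "(\<lambda>\<xi>. complex_of_real (P \<xi> powr ?\<delta>) * F \<xi>) \<in> borel_measurable lebesgue" by measurable
    show "AE \<xi> in lebesgue. (cmod (complex_of_real (P \<xi> powr ?\<delta>) * F \<xi>))\<^sup>2
        \<le> (cmod (of_real (C powr ?\<delta>) * (complex_of_real ((1 + (norm \<xi>)\<^sup>2) powr (s / 2)) * F \<xi>)))\<^sup>2"
      using le
    proof eventually_elim
      case (elim \<xi>)
      have "P \<xi> powr ?\<delta> \<le> (C * norm \<xi> powr a) powr ?\<delta>"
        using elim P0 a s by (intro powr_mono2) auto
      also have "\<dots> = C powr ?\<delta> * norm \<xi> powr s"
        using C a by (simp add: powr_mult powr_powr)
      also have "norm \<xi> powr s = ((norm \<xi>)\<^sup>2) powr (s / 2)"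
        by (subst powr_numeral[symmetric]) (simp_all only: powr_powr, simp_all)
      also have "C powr ?\<delta> * ((norm \<xi>)\<^sup>2) powr (s / 2) \<le> C powr ?\<delta> * (1 + (norm \<xi>)\<^sup>2) powr (s / 2)"
        using s by (intro mult_left_mono powr_mono2) auto
      finally have "P \<xi> powr ?\<delta> \<le> C powr ?\<delta> * (1 + (norm \<xi>)\<^sup>2) powr (s / 2)" .
      then have "P \<xi> powr ?\<delta> * cmod (F \<xi>) \<le> C powr ?\<delta> * (1 + (norm \<xi>)\<^sup>2) powr (s / 2) * cmod (F \<xi>)"
        by (rule mult_right_mono) simp
      then show ?case
        by (intro power_mono) (simp_all add: norm_mult mult.assoc)
    qed
  qed
  then obtain h where "has_fourier h (\<lambda>\<xi>. complex_of_real (P \<xi> powr ?\<delta>) * F \<xi>)"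
    using has_fourier_surj by blast
  then have "op_powr (fourier_multiplier P) ?\<delta> f h"
    unfolding op_powr_def by (intro fun_calc_fourier[OF P _ F]) simp_all
  then show ?thesis by (auto simp: op_dom_def)
qed

text \<open>Existence of a continuous version is asserted separately, so that the claim about all
  versions is not vacuous: a version on the whole line restricts to one on \<open>{0..}\<close>. The
  last conjunct is the Sobolev example, with \<open>\<delta> = s / a\<close> as the witness.\<close>

theorem corollary6p10:
  fixes P :: "real^'n::finite \<Rightarrow> real"
  assumes "P \<in> borel_measurable lebesgue"
    and "\<forall>\<xi>. 0 \<le> P \<xi>"
    and "(\<forall>t\<ge>0. lattice_positive (heat_op (fourier_multiplier P) t)) \<or>
         (\<exists>S. positive_contraction_semigroup S \<and> dominated_by (heat_op (fourier_multiplier P)) S)"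
  shows "(\<forall>\<delta>>2. \<forall>f\<in>op_dom (op_powr (fourier_multiplier P) \<delta>).
            (\<exists>u. continuous_version (fourier_multiplier P) f UNIV u) \<and>
            (\<forall>u. continuous_version (fourier_multiplier P) f {0..} u \<longrightarrow>
               (AE x in lebesgue. ((\<lambda>t. u t x) \<longlongrightarrow> f x) (at_right 0)))) \<and>
         (\<forall>a>0. \<forall>s>2 * a. comparable_to_power P a \<longrightarrow>
            (\<forall>f\<in>sobolev s. \<exists>\<delta>>2. f \<in> op_dom (op_powr (fourier_multiplier P) \<delta>)))"
proof (intro conjI allI impI ballI)
  fix \<delta> :: real and f :: "'n cfun"
  assume \<delta>: "2 < \<delta>" and "f \<in> op_dom (op_powr (fourier_multiplier P) \<delta>)"
  then obtain E where E: "is_spectral_measure (fourier_multiplier P) E"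
      and "f \<in> spectral_domain E (\<lambda>r. complex_of_real (r powr \<delta>))"
    by (auto simp: op_dom_def op_powr_def fun_calc_def spectral_operator_def)
  then have dom: "f \<in> spectral_domain E complex_of_real"
    using \<delta> by (intro spectral_domain_powr_imp[of E \<delta>]) (auto simp: is_spectral_measure_def)
  then have "f \<in> L2" by (simp add: spectral_domain_def)
  then obtain F where F: "has_fourier f F" using has_fourier_exists by blast
  show "\<exists>u. continuous_version (fourier_multiplier P) f UNIV u"
    using spectral_domain_imp_multiplier_L2[OF assms(1) _ E dom F] assms(2)
    by (intro unitary_group_continuous_version[OF assms(1) F]) auto
next
  show "AE x in lebesgue. ((\<lambda>t. u t x) \<longlongrightarrow> f x) (at_right 0)"
    if "continuous_version (fourier_multiplier P) f {0..} u" for f u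
    using that by (rule continuous_version_tendsto)
next
  fix a s :: real and f :: "'n cfun"
  assume a: "0 < a" and s: "2 * a < s" and *: "comparable_to_power P a" "f \<in> sobolev s"
  have "f \<in> op_dom (op_powr (fourier_multiplier P) (s / a))"
    using a s assms(2) by (intro sobolev_op_dom_powr[OF assms(1) _ a _ *]) auto
  moreover have "2 < s / a" using a s by (simp add: field_simps)
  ultimately show "\<exists>\<delta>>2. f \<in> op_dom (op_powr (fourier_multiplier P) \<delta>)" by blast
qed

end
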